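(* Let $R$ be a commutative ring with identity, let $F\colon\mathbb{N}^r\to\mathrm{Spaces}$ be a compact multifiltration of simplicial complexes, and let $n\geq 0$. Consider the two homomorphisms of free $\mathbb{N}^r$-graded $R[x_1,\ldots,x_r]$-modules $$\boldsymbol{R\mathcal{K}F_n}\oplus\boldsymbol{R\mathcal{G}F_{n+1}}\xrightarrow{\left[\boldsymbol{\pi_0}-\boldsymbol{\pi_1}\ \ \sum_{i=0}^{n+1}(-1)^i\boldsymbol{\overline{d_i}}\right]}\boldsymbol{R\mathcal{G}F_n}\xrightarrow{\sum_{j=0}^{n}(-1)^j\boldsymbol{\alpha_j}}\boldsymbol{RD_{n-1}}$$ (defined in the context). The composition of these two homomorphisms is zero, and the homology of this complex at $\boldsymbol{R\mathcal{G}F_n}$ (the kernel of the second homomorphism modulo the image of the first) is isomorphic, as an $\mathbb{N}^r$-graded $R[x_1,\ldots,x_r]$-module, to $\boldsymbol{H_n(F,R)}$.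
   Context: Posets and modules. $\mathbb{N}=\{0,1,2,\ldots\}$; $\mathbb{N}^r$ carries the componentwise order and is viewed as a category; $\max\{v_0,v_1\}$ is the join. A functor $G\colon\mathbb{N}^r\to R\text{-}\mathrm{Mod}$ is identified with the $\mathbb{N}^r$-graded $R[x_1,\ldots,x_r]$-module $\boldsymbol{G}=\bigoplus_{v}G(v)$, where $x_i$ acts on $G(v)$ via $G(v\leq v+e_i)$. The $R$-span of a set $S$ is $\bigoplus_S R$, and for a functor $G\colon\mathbb{N}^r\to\mathrm{Sets}$, $RG$ denotes the composite with the $R$-span functor; natural transformations of set-valued functors induce homomorphisms, denoted by the same letter in boldface. For $v\in\mathbb{N}^r$, $\mathrm{mor}_{\mathbb{N}^r}(v,-)\colon\mathbb{N}^r\to\mathrm{Sets}$ is the representable functor (a point at $w$ if $v\leq w$, empty otherwise); the module associated with $R\,\mathrm{mor}_{\mathbb{N}^r}(v,-)$ is $\langle x^v\rangle$, the free module on one generator of grade $v$. If $w\leq v$ there is a unique natural transformation $\mathrm{mor}_{\mathbb{N}^r}(v,-)\to\mathrm{mor}_{\mathbb{N}^r}(w,-)$. Simplicial complexes. A simplicial complex $X$ is a collection of subsets (simplices) of a vertex set $X_0$, containing all singletons of $X_0$ and closed under taking subsets; it is finite if $X_0$ is finite. A morphism is a map of vertex sets sending simplices to simplices; it is a monomorphism iff it is injective on vertices. $\mathrm{Spaces}$ is the category of simplicial complexes. A multifiltration is a functor $F\colon\mathbb{N}^r\to\mathrm{Spaces}$ sending every morphism to a monomorphism; it is compact if $X:=\mathrm{colim}\,F$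 is a finite complex. Choose a total order on the vertices of $X$, inducing orders on the vertices of each $F(v)$. For a complex $Y$ with ordered vertices, $Y_n$ is the set of ordered $n$-simplices, i.e. strictly increasing sequences $y_0<\cdots<y_n$ of vertices forming a simplex, and $d_i\colon Y_{n+1}\to Y_n$ ($0\leq i\leq n+1$) forgets the $i$-th entry. $F_n\colon\mathbb{N}^r\to\mathrm{Sets}$ is the functor $v\mapsto F(v)_n$, and the $d_i$ are natural transformations $F_{n+1}\to F_n$. $H_n(F,R)\colon\mathbb{N}^r\to R\text{-}\mathrm{Mod}$ is the homology at $RF_n$ of $RF_{n+1}\xrightarrow{\sum_i(-1)^id_i}RF_n\xrightarrow{\sum_i(-1)^id_i}RF_{n-1}$, where $RF_{-1}=0$; $\boldsymbol{H_n(F,R)}$ is the associated graded module. The modules. For $\sigma\in X_m$, $\mathrm{gen}(\sigma)$ is the (finite) set of minimal elements of $\{v\in\mathbb{N}^r\mid\sigma\in F(v)\}$. Set $$\mathcal{G}F_m=\coprod_{\sigma\in X_m}\ \coprod_{v\in\mathrm{gen}(\sigma)}\mathrm{mor}_{\mathbb{N}^r}(v,-),\qquad \mathcal{K}F_m=\coprod_{\sigma\in X_m}\ \coprod_{v_0\neq v_1\in\mathrm{gen}(\sigma)}\mathrm{mor}_{\mathbb{N}^r}(\max\{v_0,v_1\},-),$$ where in $\mathcal{K}F_m$ the inner coproduct is over unordered pairs of distinct elements of $\mathrm{gen}(\sigma)$, each listed in some chosen order $(v_0,v_1)$, and $D_{n-1}=\coprod_{\tau\in X_{n-1}}\mathrm{mor}_{\mathbb{N}^r}(0,-)$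 (so $RD_{-1}=0$ when $n=0$). Thus $\boldsymbol{R\mathcal{G}F_m}=\bigoplus_{\sigma\in X_m}\bigoplus_{v\in\mathrm{gen}(\sigma)}\langle x^v\rangle$, $\boldsymbol{R\mathcal{K}F_n}=\bigoplus_{\sigma\in X_n}\bigoplus_{v_0\neq v_1\in\mathrm{gen}(\sigma)}\langle x^{\max\{v_0,v_1\}}\rangle$, $\boldsymbol{RD_{n-1}}=\bigoplus_{\tau\in X_{n-1}}R[x_1,\ldots,x_r]$. The maps. (i) $\pi_i\colon\mathcal{K}F_n\to\mathcal{G}F_n$ ($i=0,1$) sends the summand indexed by $\sigma$ and $(v_0,v_1)$ to the summand indexed by $\sigma$ and $v_i$ via the unique natural transformation $\mathrm{mor}_{\mathbb{N}^r}(\max\{v_0,v_1\},-)\to\mathrm{mor}_{\mathbb{N}^r}(v_i,-)$. (ii) $\overline{d_i}\colon\mathcal{G}F_{n+1}\to\mathcal{G}F_n$ ($0\leq i\leq n+1$) sends the summand indexed by $\sigma\in X_{n+1}$ and $v\in\mathrm{gen}(\sigma)$ to the summand indexed by $d_i(\sigma)$ and $w$, via the unique natural transformation, where $w$ is the lexicographically smallest element of the (non-empty) set $\{w\in\mathrm{gen}(d_i(\sigma))\mid w\leq v\}$. (iii) For $n\geq1$, $\alpha_j\colon\mathcal{G}F_n\to D_{n-1}$ ($0\leq j\leq n$) sends the summand indexed by $\sigma\in X_n$ and $v\in\mathrm{gen}(\sigma)$ to the summand of $D_{n-1}$ indexed by $d_j(\sigma)$, via the unique natural transformation $\mathrm{mor}_{\mathbb{N}^r}(v,-)\to\mathrm{mor}_{\mathbb{N}^r}(0,-)$.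 For $n=0$ the second homomorphism is the zero map to $0$. *)

theory Defs
  imports "HOL-Algebra.Module" "HOL-Algebra.AbelCoset" "HOL-Library.Fun_Lexorder"
begin

section \<open>Grades\<close>

text \<open>An element of \<open>\<nat>\<^sup>r\<close> is a function on the natural numbers that vanishes outside
  \<open>{..<r}\<close>. The order and the join are the pointwise ones of the function space, and
  \<^const>\<open>less_fun\<close> is the strict lexicographic order.\<close>

type_synonym grade = "nat \<Rightarrow> nat"

definition grades :: "nat \<Rightarrow> grade set" where
  "grades r = {v. \<forall>i\<ge>r. v i = 0}"

definition minimal_elements :: "grade set \<Rightarrow> grade set" where
  "minimal_elements A = {v \<in> A. \<forall>u\<in>A. u \<le> v \<longrightarrow> u = v}"

definition lex_least :: "grade set \<Rightarrow> grade" where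
  "lex_least A = (THE w. w \<in> A \<and> (\<forall>u\<in>A. u \<noteq> w \<longrightarrow> less_fun w u))"


section \<open>Modules and homology of a sequence of modules\<close>

text \<open>The multiplicative fields of a module record carry no information and are left
  unspecified.\<close>

definition self_module :: "('b, 'c) ring_scheme \<Rightarrow> ('b, 'b) module" where
  "self_module R = ring.extend (ring.truncate R) \<lparr>smult = mult R\<rparr>"

definition direct_sum :: "'i set \<Rightarrow> ('i \<Rightarrow> ('b, 'm, 'c) module_scheme) \<Rightarrow> ('b, 'i \<Rightarrow> 'm) module"
  where
  "direct_sum I M =
    \<lparr>carrier = {x \<in> \<Pi>\<^sub>E i\<in>I. carrier (M i). finite {i \<in> I. x i \<noteq> \<zero>\<^bsub>M i\<^esub>}},
     mult = undefined, one = undefined,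
     zero = (\<lambda>i\<in>I. \<zero>\<^bsub>M i\<^esub>),
     add = (\<lambda>x y. \<lambda>i\<in>I. x i \<oplus>\<^bsub>M i\<^esub> y i),
     smult = (\<lambda>a x. \<lambda>i\<in>I. a \<odot>\<^bsub>M i\<^esub> x i)\<rparr>"

definition span_module :: "('b, 'c) ring_scheme \<Rightarrow> 's set \<Rightarrow> ('b, 's \<Rightarrow> 'b) module" where
  "span_module R S = direct_sum S (\<lambda>_. self_module R)"

text \<open>The linear extension of a map \<open>f : S \<rightarrow> T\<close>. The sum runs over the finitely many points of
  the fibre where \<open>c\<close> does not vanish, because \<^const>\<open>finsum\<close> over an infinite set is
  zero by convention.\<close>

definition span_map ::
  "('b, 'c) ring_scheme \<Rightarrow> 's set \<Rightarrow> 't set \<Rightarrow> ('s \<Rightarrow> 't) \<Rightarrow> ('s \<Rightarrow> 'b) \<Rightarrow> 't \<Rightarrow> 'b" where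
  "span_map R S T f c = (\<lambda>t\<in>T. \<Oplus>\<^bsub>R\<^esub>s\<in>{s \<in> S. f s = t \<and> c s \<noteq> \<zero>\<^bsub>R\<^esub>}. c s)"

definition quotient_module :: "('b, 'm, 'c) module_scheme \<Rightarrow> 'm set \<Rightarrow> ('b, 'm set) module" where
  "quotient_module M H =
    \<lparr>carrier = a_rcosets\<^bsub>M\<^esub> H, mult = undefined, one = undefined, zero = H, add = set_add M,
     smult = (\<lambda>a C. \<Union>x\<in>C. H +>\<^bsub>M\<^esub> (a \<odot>\<^bsub>M\<^esub> x))\<rparr>"

text \<open>The kernel of \<open>g\<close> modulo the image of \<open>f\<close>, for \<open>f : A \<rightarrow> M\<close> and \<open>g : M \<rightarrow> N\<close>.\<close>

definition homology_module ::
  "('b, 'l, 'd) module_scheme \<Rightarrow> ('l \<Rightarrow> 'm) \<Rightarrow> ('b, 'm, 'e) module_scheme \<Rightarrow> ('m \<Rightarrow> 'n) \<Rightarrow>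
   ('b, 'n, 'f) module_scheme \<Rightarrow> ('b, 'm set) module" where
  "homology_module A f M g N =
    quotient_module (M\<lparr>carrier := a_kernel M N g\<rparr>) (f ` carrier A)"

definition alternating_sum :: "('b, 'c) ring_scheme \<Rightarrow> nat \<Rightarrow> (nat \<Rightarrow> 'b) \<Rightarrow> 'b" where
  "alternating_sum M k y = (\<Oplus>\<^bsub>M\<^esub>i\<in>{..k}. [((-1) ^ i :: int)] \<cdot>\<^bsub>M\<^esub> (y i))"


section \<open>The polynomial ring and graded modules\<close>

text \<open>A polynomial in \<open>R[x\<^sub>1,\<dots>,x\<^sub>r]\<close> is a finitely supported family of coefficients
  indexed by the exponents in \<open>\<nat>\<^sup>r\<close>.\<close>

definition mpoly_ring :: "('b, 'c) ring_scheme \<Rightarrow> nat \<Rightarrow> (grade \<Rightarrow> 'b) ring" where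
  "mpoly_ring R r =
    \<lparr>carrier = carrier (span_module R (grades r)),
     mult = (\<lambda>p q. \<lambda>u\<in>grades r. \<Oplus>\<^bsub>R\<^esub>w\<in>{w. w \<le> u}. p w \<otimes>\<^bsub>R\<^esub> q (\<lambda>i. u i - w i)),
     one = (\<lambda>u\<in>grades r. if u = (\<lambda>_. 0) then \<one>\<^bsub>R\<^esub> else \<zero>\<^bsub>R\<^esub>),
     zero = zero (span_module R (grades r)),
     add = add (span_module R (grades r))\<rparr>"

record ('p, 'm) graded_module = "('p, 'm) module" +
  component :: "grade \<Rightarrow> 'm set"

definition graded_direct_sum ::
  "('p, 'm, 'c) graded_module_scheme \<Rightarrow> ('p, 'n, 'd) graded_module_scheme \<Rightarrow>
   ('p, 'm \<times> 'n) graded_module" where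
  "graded_direct_sum M N =
    \<lparr>carrier = carrier M \<times> carrier N, mult = undefined, one = undefined,
     zero = (\<zero>\<^bsub>M\<^esub>, \<zero>\<^bsub>N\<^esub>),
     add = (\<lambda>(a, b) (a', b'). (a \<oplus>\<^bsub>M\<^esub> a', b \<oplus>\<^bsub>N\<^esub> b')),
     smult = (\<lambda>p (a, b). (p \<odot>\<^bsub>M\<^esub> a, p \<odot>\<^bsub>N\<^esub> b)),
     component = (\<lambda>v. component M v \<times> component N v)\<rparr>"

text \<open>The component of grade \<open>v\<close> of the homology consists of the classes of the cycles that are
  homogeneous of grade \<open>v\<close>.\<close>

definition graded_homology ::
  "('p, 'l, 'd) graded_module_scheme \<Rightarrow> ('l \<Rightarrow> 'm) \<Rightarrow> ('p, 'm, 'e) graded_module_scheme \<Rightarrow>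
   ('m \<Rightarrow> 'n) \<Rightarrow> ('p, 'n, 'f) graded_module_scheme \<Rightarrow> ('p, 'm set) graded_module" where
  "graded_homology A f M g N =
    module.extend (homology_module A f M g N)
      \<lparr>component = (\<lambda>v. (\<lambda>z. (f ` carrier A) +>\<^bsub>M\<^esub> z) ` (a_kernel M N g \<inter> component M v))\<rparr>"

definition graded_isomorphism ::
  "('p, 'q) ring_scheme \<Rightarrow> nat \<Rightarrow> ('p, 'm, 'c) graded_module_scheme \<Rightarrow>
   ('p, 'n, 'd) graded_module_scheme \<Rightarrow> ('m \<Rightarrow> 'n) \<Rightarrow> bool" where
  "graded_isomorphism P r M N h \<longleftrightarrow>
    bij_betw h (carrier M) (carrier N) \<and>
    (\<forall>x\<in>carrier M. \<forall>y\<in>carrier M. h (x \<oplus>\<^bsub>M\<^esub> y) = h x \<oplus>\<^bsub>N\<^esub> h y) \<and>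
    (\<forall>p\<in>carrier P. \<forall>x\<in>carrier M. h (p \<odot>\<^bsub>M\<^esub> x) = p \<odot>\<^bsub>N\<^esub> h x) \<and>
    (\<forall>v\<in>grades r. h ` component M v = component N v)"

definition graded_isomorphic ::
  "('p, 'q) ring_scheme \<Rightarrow> nat \<Rightarrow> ('p, 'm, 'c) graded_module_scheme \<Rightarrow>
   ('p, 'n, 'd) graded_module_scheme \<Rightarrow> bool" where
  "graded_isomorphic P r M N \<longleftrightarrow> (\<exists>h. graded_isomorphism P r M N h)"


section \<open>Functors on \<open>\<nat>\<^sup>r\<close>\<close>

text \<open>Only the values at grades in \<open>grades r\<close> and at pairs \<open>v \<le> w\<close> of such grades matter.\<close>

record 's set_functor =
  set_at :: "grade \<Rightarrow> 's set"
  set_along :: "grade \<Rightarrow> grade \<Rightarrow> 's \<Rightarrow> 's"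

record ('b, 'm) module_functor =
  module_at :: "grade \<Rightarrow> ('b, 'm) module"
  module_along :: "grade \<Rightarrow> grade \<Rightarrow> 'm \<Rightarrow> 'm"

definition representable :: "grade \<Rightarrow> unit set_functor" where
  "representable v = \<lparr>set_at = (\<lambda>w. if v \<le> w then {()} else {}), set_along = (\<lambda>_ _ x. x)\<rparr>"

definition coproduct :: "'j set \<Rightarrow> ('j \<Rightarrow> 's set_functor) \<Rightarrow> ('j \<times> 's) set_functor" where
  "coproduct J S =
    \<lparr>set_at = (\<lambda>w. SIGMA j:J. set_at (S j) w),
     set_along = (\<lambda>v w (j, x). (j, set_along (S j) v w x))\<rparr>"

definition empty_functor :: "'s set_functor" where
  "empty_functor = \<lparr>set_at = (\<lambda>_. {}), set_along = (\<lambda>_ _ x. x)\<rparr>"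

text \<open>The degree \<open>n - 1\<close> member of a sequence of set-valued functors. In degree \<open>-1\<close> it is empty,
  so that its \<open>R\<close>-span is zero.\<close>

definition pred_functor :: "(nat \<Rightarrow> 's set_functor) \<Rightarrow> nat \<Rightarrow> 's set_functor" where
  "pred_functor S n = (case n of 0 \<Rightarrow> empty_functor | Suc k \<Rightarrow> S k)"

definition span_functor ::
  "('b, 'c) ring_scheme \<Rightarrow> 's set_functor \<Rightarrow> ('b, 's \<Rightarrow> 'b) module_functor" where
  "span_functor R S =
    \<lparr>module_at = (\<lambda>v. span_module R (set_at S v)),
     module_along = (\<lambda>v w. span_map R (set_at S v) (set_at S w) (set_along S v w))\<rparr>"

text \<open>The direct sum of the values of \<open>G\<close>, where a monomial \<open>x\<^sup>w\<close> maps \<open>G v\<close> to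
  \<open>G (v + w)\<close> by the functoriality of \<open>G\<close>.\<close>

definition associated_module ::
  "('b, 'c) ring_scheme \<Rightarrow> nat \<Rightarrow> ('b, 'm) module_functor \<Rightarrow>
   (grade \<Rightarrow> 'b, grade \<Rightarrow> 'm) graded_module" where
  "associated_module R r G =
    (let D = direct_sum (grades r) (module_at G) in
    \<lparr>carrier = carrier D, mult = undefined, one = undefined, zero = zero D, add = add D,
     smult = (\<lambda>p m. \<lambda>u\<in>grades r. \<Oplus>\<^bsub>module_at G u\<^esub>w\<in>{w. w \<le> u}.
        p w \<odot>\<^bsub>module_at G u\<^esub> module_along G (\<lambda>i. u i - w i) u (m (\<lambda>i. u i - w i))),
     component = (\<lambda>v. {m \<in> carrier D. \<forall>u\<in>grades r. u \<noteq> v \<longrightarrow> m u = \<zero>\<^bsub>module_at G u\<^esub>})\<rparr>)"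

abbreviation span_graded ::
  "('b, 'c) ring_scheme \<Rightarrow> nat \<Rightarrow> 's set_functor \<Rightarrow> (grade \<Rightarrow> 'b, grade \<Rightarrow> 's \<Rightarrow> 'b) graded_module"
  where
  "span_graded R r S \<equiv> associated_module R r (span_functor R S)"

text \<open>The homomorphism induced by a natural transformation whose components are all given by
  the same formula \<open>f\<close>.\<close>

definition induced_hom ::
  "('b, 'c) ring_scheme \<Rightarrow> nat \<Rightarrow> 's set_functor \<Rightarrow> 't set_functor \<Rightarrow> ('s \<Rightarrow> 't) \<Rightarrow>
   (grade \<Rightarrow> 's \<Rightarrow> 'b) \<Rightarrow> grade \<Rightarrow> 't \<Rightarrow> 'b" where
  "induced_hom R r S T f m = (\<lambda>v\<in>grades r. span_map R (set_at S v) (set_at T v) f (m v))"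


section \<open>Simplicial complexes and multifiltrations\<close>

record 'a simp_complex =
  vertices :: "'a set"
  simplices :: "'a set set"

definition simplicial_complex :: "'a simp_complex \<Rightarrow> bool" where
  "simplicial_complex X \<longleftrightarrow>
    (\<forall>s\<in>simplices X. s \<subseteq> vertices X) \<and>
    (\<forall>x\<in>vertices X. {x} \<in> simplices X) \<and>
    (\<forall>s\<in>simplices X. \<forall>t. t \<subseteq> s \<longrightarrow> t \<in> simplices X)"

definition simplicial_map :: "'a simp_complex \<Rightarrow> 'b simp_complex \<Rightarrow> ('a \<Rightarrow> 'b) \<Rightarrow> bool" where
  "simplicial_map X Y f \<longleftrightarrow>
    f \<in> vertices X \<rightarrow> vertices Y \<and> (\<forall>s\<in>simplices X. f ` s \<in> simplices Y)"

record 'a space_functor =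
  space_at :: "grade \<Rightarrow> 'a simp_complex"
  space_along :: "grade \<Rightarrow> grade \<Rightarrow> 'a \<Rightarrow> 'a"

definition multifiltration :: "nat \<Rightarrow> 'a space_functor \<Rightarrow> bool" where
  "multifiltration r F \<longleftrightarrow>
    (\<forall>v\<in>grades r. simplicial_complex (space_at F v)) \<and>
    (\<forall>v\<in>grades r. \<forall>w\<in>grades r. v \<le> w \<longrightarrow>
      simplicial_map (space_at F v) (space_at F w) (space_along F v w) \<and>
      inj_on (space_along F v w) (vertices (space_at F v))) \<and>
    (\<forall>v\<in>grades r. \<forall>x\<in>vertices (space_at F v). space_along F v v x = x) \<and>
    (\<forall>u\<in>grades r. \<forall>v\<in>grades r. \<forall>w\<in>grades r. u \<le> v \<longrightarrow> v \<le> w \<longrightarrow>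
      (\<forall>x\<in>vertices (space_at F u).
        space_along F v w (space_along F u v x) = space_along F u w x))"

text \<open>The colimit is the usual one over a directed poset. Its vertices are the germs of vertices
  of the complexes \<open>F v\<close>, that is, classes of pairs \<open>(w, y)\<close> with \<open>y\<close> a vertex of \<open>F w\<close>, where two
  pairs are identified if they agree at some later grade. The map \<open>to_colimit r F v\<close> is the
  canonical map of \<open>F v\<close> into it, and the simplices are the images of the simplices of the \<open>F v\<close>.\<close>

type_synonym 'a germ = "(grade \<times> 'a) set"

definition to_colimit :: "nat \<Rightarrow> 'a space_functor \<Rightarrow> grade \<Rightarrow> 'a \<Rightarrow> 'a germ" where
  "to_colimit r F v x =
    {(w, y). w \<in> grades r \<and> y \<in> vertices (space_at F w) \<and>
      (\<exists>u\<in>grades r. v \<le> u \<and> w \<le> u \<and> space_along F v u x = space_along F w u y)}"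

definition colimit :: "nat \<Rightarrow> 'a space_functor \<Rightarrow> 'a germ simp_complex" where
  "colimit r F =
    \<lparr>vertices = (\<Union>v\<in>grades r. to_colimit r F v ` vertices (space_at F v)),
     simplices = (\<Union>v\<in>grades r. (\<lambda>s. to_colimit r F v ` s) ` simplices (space_at F v))\<rparr>"

definition compact_multifiltration :: "nat \<Rightarrow> 'a space_functor \<Rightarrow> bool" where
  "compact_multifiltration r F \<longleftrightarrow> multifiltration r F \<and> finite (vertices (colimit r F))"


section \<open>Ordered simplices and homology\<close>

definition ordered_simplices :: "'a simp_complex \<Rightarrow> 'a rel \<Rightarrow> nat \<Rightarrow> 'a list set" where
  "ordered_simplices Y ord n =
    {ys. length ys = Suc n \<and> sorted_wrt (\<lambda>x y. (x, y) \<in> ord \<and> x \<noteq> y) ys \<and> set ys \<in> simplices Y}"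

definition face :: "nat \<Rightarrow> 'a list \<Rightarrow> 'a list" where
  "face i ys = take i ys @ drop (Suc i) ys"

definition induced_order :: "nat \<Rightarrow> 'a space_functor \<Rightarrow> 'a germ rel \<Rightarrow> grade \<Rightarrow> 'a rel" where
  "induced_order r F ord v =
    {(x, y). x \<in> vertices (space_at F v) \<and> y \<in> vertices (space_at F v) \<and>
      (to_colimit r F v x, to_colimit r F v y) \<in> ord}"

definition simplex_functor ::
  "nat \<Rightarrow> 'a space_functor \<Rightarrow> 'a germ rel \<Rightarrow> nat \<Rightarrow> 'a list set_functor" where
  "simplex_functor r F ord n =
    \<lparr>set_at = (\<lambda>v. ordered_simplices (space_at F v) (induced_order r F ord v) n),
     set_along = (\<lambda>v w. map (space_along F v w))\<rparr>"

definition boundary ::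
  "('b, 'c) ring_scheme \<Rightarrow> nat \<Rightarrow> 'a space_functor \<Rightarrow> 'a germ rel \<Rightarrow> nat \<Rightarrow> grade \<Rightarrow>
   ('a list \<Rightarrow> 'b) \<Rightarrow> 'a list \<Rightarrow> 'b" where
  "boundary R r F ord n v c =
    (case n of
      0 \<Rightarrow> \<zero>\<^bsub>span_module R {}\<^esub>
    | Suc k \<Rightarrow>
        alternating_sum (span_module R (set_at (simplex_functor r F ord k) v)) n
          (\<lambda>i. span_map R (set_at (simplex_functor r F ord n) v)
                (set_at (simplex_functor r F ord k) v) (face i) c))"

definition homology_functor ::
  "('b, 'c) ring_scheme \<Rightarrow> nat \<Rightarrow> 'a space_functor \<Rightarrow> 'a germ rel \<Rightarrow> nat \<Rightarrow>
   ('b, ('a list \<Rightarrow> 'b) set) module_functor" where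
  "homology_functor R r F ord n =
    (let C = (\<lambda>k. span_functor R (simplex_functor r F ord k));
         C' = span_functor R (pred_functor (simplex_functor r F ord) n)
     in
    \<lparr>module_at = (\<lambda>v. homology_module
        (module_at (C (Suc n)) v) (boundary R r F ord (Suc n) v)
        (module_at (C n) v) (boundary R r F ord n v)
        (module_at C' v)),
     module_along = (\<lambda>v w K. \<Union>c\<in>K.
        (boundary R r F ord (Suc n) w ` carrier (module_at (C (Suc n)) w))
          +>\<^bsub>module_at (C n) w\<^esub> module_along (C n) v w c)\<rparr>)"


section \<open>The presentation\<close>

abbreviation colimit_simplices ::
  "nat \<Rightarrow> 'a space_functor \<Rightarrow> 'a germ rel \<Rightarrow> nat \<Rightarrow> 'a germ list set" where
  "colimit_simplices r F ord m \<equiv> ordered_simplices (colimit r F) ord m"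

definition gen :: "nat \<Rightarrow> 'a space_functor \<Rightarrow> 'a germ list \<Rightarrow> grade set" where
  "gen r F \<sigma> = minimal_elements
    {v \<in> grades r. set \<sigma> \<in> (\<lambda>s. to_colimit r F v ` s) ` simplices (space_at F v)}"

text \<open>\<open>P \<sigma>\<close> lists every unordered pair of distinct elements of \<open>gen r F \<sigma>\<close> exactly once, in a
  chosen order.\<close>

definition pair_choice ::
  "nat \<Rightarrow> 'a space_functor \<Rightarrow> 'a germ rel \<Rightarrow> nat \<Rightarrow> ('a germ list \<Rightarrow> (grade \<times> grade) set) \<Rightarrow> bool"
  where
  "pair_choice r F ord m P \<longleftrightarrow>
    (\<forall>\<sigma>\<in>colimit_simplices r F ord m.
      (\<forall>(v0, v1)\<in>P \<sigma>. v0 \<in> gen r F \<sigma> \<and> v1 \<in> gen r F \<sigma> \<and> v0 \<noteq> v1) \<and>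
      (\<forall>v0\<in>gen r F \<sigma>. \<forall>v1\<in>gen r F \<sigma>. v0 \<noteq> v1 \<longrightarrow>
        ((v0, v1) \<in> P \<sigma>) \<noteq> ((v1, v0) \<in> P \<sigma>)))"

definition GF ::
  "nat \<Rightarrow> 'a space_functor \<Rightarrow> 'a germ rel \<Rightarrow> nat \<Rightarrow> ('a germ list \<times> grade \<times> unit) set_functor" where
  "GF r F ord m =
    coproduct (colimit_simplices r F ord m) (\<lambda>\<sigma>. coproduct (gen r F \<sigma>) representable)"

definition KF ::
  "nat \<Rightarrow> 'a space_functor \<Rightarrow> 'a germ rel \<Rightarrow> ('a germ list \<Rightarrow> (grade \<times> grade) set) \<Rightarrow> nat \<Rightarrow>
   ('a germ list \<times> (grade \<times> grade) \<times> unit) set_functor" where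
  "KF r F ord P m =
    coproduct (colimit_simplices r F ord m)
      (\<lambda>\<sigma>. coproduct (P \<sigma>) (\<lambda>(v0, v1). representable (sup v0 v1)))"

text \<open>The functor \<open>DF r F ord n\<close> is the one written \<open>D\<^sub>n\<close>, and \<open>pred_functor (DF r F ord) n\<close> is \<open>D\<close>
  in degree \<open>n - 1\<close>.\<close>

definition DF ::
  "nat \<Rightarrow> 'a space_functor \<Rightarrow> 'a germ rel \<Rightarrow> nat \<Rightarrow> ('a germ list \<times> unit) set_functor" where
  "DF r F ord m = coproduct (colimit_simplices r F ord m) (\<lambda>_. representable (\<lambda>_. 0))"

definition pi0 :: "'a germ list \<times> (grade \<times> grade) \<times> unit \<Rightarrow> 'a germ list \<times> grade \<times> unit" where
  "pi0 = (\<lambda>(\<sigma>, (v0, v1), x). (\<sigma>, v0, x))"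

definition pi1 :: "'a germ list \<times> (grade \<times> grade) \<times> unit \<Rightarrow> 'a germ list \<times> grade \<times> unit" where
  "pi1 = (\<lambda>(\<sigma>, (v0, v1), x). (\<sigma>, v1, x))"

definition dbar ::
  "nat \<Rightarrow> 'a space_functor \<Rightarrow> nat \<Rightarrow> 'a germ list \<times> grade \<times> unit \<Rightarrow> 'a germ list \<times> grade \<times> unit"
  where
  "dbar r F i = (\<lambda>(\<sigma>, v, x). (face i \<sigma>, lex_least {w \<in> gen r F (face i \<sigma>). w \<le> v}, x))"

definition alpha :: "nat \<Rightarrow> 'a germ list \<times> grade \<times> unit \<Rightarrow> 'a germ list \<times> unit" where
  "alpha j = (\<lambda>(\<sigma>, v, x). (face j \<sigma>, x))"

definition presentation_map ::
  "('b, 'c) ring_scheme \<Rightarrow> nat \<Rightarrow> 'a space_functor \<Rightarrow> 'a germ rel \<Rightarrow>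
   ('a germ list \<Rightarrow> (grade \<times> grade) set) \<Rightarrow> nat \<Rightarrow>
   (grade \<Rightarrow> 'a germ list \<times> (grade \<times> grade) \<times> unit \<Rightarrow> 'b) \<times>
   (grade \<Rightarrow> 'a germ list \<times> grade \<times> unit \<Rightarrow> 'b) \<Rightarrow>
   grade \<Rightarrow> 'a germ list \<times> grade \<times> unit \<Rightarrow> 'b" where
  "presentation_map R r F ord P n =
    (let K = KF r F ord P n; G = GF r F ord n; G' = GF r F ord (Suc n); M = span_graded R r G
     in (\<lambda>(a, b).
       (induced_hom R r K G pi0 a \<ominus>\<^bsub>M\<^esub> induced_hom R r K G pi1 a) \<oplus>\<^bsub>M\<^esub>
       alternating_sum M (Suc n) (\<lambda>i. induced_hom R r G' G (dbar r F i) b)))"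

definition alpha_map ::
  "('b, 'c) ring_scheme \<Rightarrow> nat \<Rightarrow> 'a space_functor \<Rightarrow> 'a germ rel \<Rightarrow> nat \<Rightarrow>
   (grade \<Rightarrow> 'a germ list \<times> grade \<times> unit \<Rightarrow> 'b) \<Rightarrow> grade \<Rightarrow> 'a germ list \<times> unit \<Rightarrow> 'b" where
  "alpha_map R r F ord n m =
    (let D = pred_functor (DF r F ord) n in
      (case n of
        0 \<Rightarrow> \<zero>\<^bsub>span_graded R r D\<^esub>
      | Suc k \<Rightarrow>
          alternating_sum (span_graded R r D) n
            (\<lambda>j. induced_hom R r (GF r F ord n) D (alpha j) m)))"

end

theory Submission
  imports Defs
begin

text \<open>Everything is decided one grade at a time. At grade \<open>v\<close> the module \<open>RGF\<^sub>n\<close> is spanned by the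
  copies \<open>(\<sigma>, w)\<close> of simplices \<open>\<sigma>\<close>, one for each generator \<open>w \<le> v\<close>. Forgetting the generator defines
  a surjection \<open>p\<close> onto the chains of \<open>F v\<close>, natural in \<open>v\<close>, because a simplex of \<open>F v\<close> has a
  minimal grade of appearance below \<open>v\<close>.

  Three observations identify the complex with the preimage under \<open>p\<close> of the simplicial one.
  The kernel of \<open>p\<close> at grade \<open>v\<close> is the image of \<open>\<pi>\<^sub>0 - \<pi>\<^sub>1\<close>, since any two copies of \<open>\<sigma>\<close> present at
  \<open>v\<close> are joined by a pair that is present at \<open>v\<close> (\<open>span_map_kernel_edges\<close>, \<open>ex_pair\<close>). The
  lifted face maps become the face maps of simplices under \<open>p\<close>, whatever generator they choose (\<open>to_chain_dbar\<close>). And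
  the second map is \<open>\<partial> p\<close> followed by the injection of the simplices of \<open>F v\<close> into those of the
  colimit (\<open>alpha_map_eq\<close>). Therefore its kernel is the preimage of the cycles, while the image of the
  first map is the preimage of the boundaries (\<open>presentation_map_image\<close>). As boundaries are cycles,
  the composition vanishes.

  Since \<open>p\<close> is onto, it induces at each grade an isomorphism from the homology of the presentation to
  the homology of \<open>F v\<close>. The locale \<open>levelwise_surjection\<close> assembles these into an isomorphism of
  graded modules; finite supports are preserved because zero classes are lifted by zero, and the
  polynomial action because \<open>p\<close> is natural. The isomorphism is \<open>quotient_map\<close>, which sends the class
  of \<open>x\<close> to the family of classes of \<open>p (x v)\<close>.\<close>

section \<open>Additive maps and cosets\<close>

lemma abelian_group_hom_iff:
  "abelian_group_hom M N h \<longleftrightarrow> abelian_group M \<and> abelian_group N \<and> h \<in> carrier M \<rightarrow> carrier N \<and>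
    (\<forall>x\<in>carrier M. \<forall>y\<in>carrier M. h (x \<oplus>\<^bsub>M\<^esub> y) = h x \<oplus>\<^bsub>N\<^esub> h y)"
proof
  assume "abelian_group_hom M N h"
  then interpret abelian_group_hom M N h .
  show "abelian_group M \<and> abelian_group N \<and> h \<in> carrier M \<rightarrow> carrier N \<and>
    (\<forall>x\<in>carrier M. \<forall>y\<in>carrier M. h (x \<oplus>\<^bsub>M\<^esub> y) = h x \<oplus>\<^bsub>N\<^esub> h y)"
    using G.abelian_group_axioms H.abelian_group_axioms by auto
next
  assume *: "abelian_group M \<and> abelian_group N \<and> h \<in> carrier M \<rightarrow> carrier N \<and>
    (\<forall>x\<in>carrier M. \<forall>y\<in>carrier M. h (x \<oplus>\<^bsub>M\<^esub> y) = h x \<oplus>\<^bsub>N\<^esub> h y)"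
  then have "group (add_monoid M)" "group (add_monoid N)"
    by (simp_all add: abelian_group.a_group)
  then show "abelian_group_hom M N h"
    using * by (intro abelian_group_homI)
      (auto simp: group_hom_def group_hom_axioms_def hom_def)
qed

lemma abelian_group_hom_compose:
  assumes "abelian_group_hom L M g" "abelian_group_hom M N h"
  shows "abelian_group_hom L N (\<lambda>x. h (g x))"
  using assms unfolding abelian_group_hom_iff by (simp add: Pi_iff)

lemma (in abelian_group_hom) hom_finsum:
  assumes "y \<in> A \<rightarrow> carrier G"
  shows "h (finsum G y A) = finsum H (\<lambda>i. h (y i)) A"
proof (cases "finite A")
  case True
  then show ?thesis using assms
  proof (induction A)
    case empty
    show ?case by simp
  next
    case (insert a A)
    then show ?case by (simp add: Pi_iff)
  qed
next
  case False
  then show ?thesis by (simp add: G.finsum_infinite H.finsum_infinite)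
qed

lemma (in abelian_group) minus_zero_right: "x \<in> carrier G \<Longrightarrow> x \<ominus> \<zero> = x"
  by (simp add: minus_eq a_inv_def)

lemma (in abelian_group) sign_add_pow:
  "x \<in> carrier G \<Longrightarrow> [((-1) ^ i :: int)] \<cdot> x = (if even i then x else \<ominus> x)"
  by (cases "even i") (simp_all add: add.int_pow_neg)

lemma (in abelian_group_hom) hom_alternating_sum:
  assumes "\<And>i. i \<le> k \<Longrightarrow> y i \<in> carrier G"
  shows "h (alternating_sum G k y) = alternating_sum H k (\<lambda>i. h (y i))"
  using assms unfolding alternating_sum_def
  by (subst hom_finsum) (auto simp: G.sign_add_pow H.sign_add_pow intro!: H.finsum_cong')

lemma (in abelian_group) alternating_sum_closed:
  assumes "\<And>i. i \<le> k \<Longrightarrow> y i \<in> carrier G"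
  shows "alternating_sum G k y \<in> carrier G"
  using assms unfolding alternating_sum_def by (intro finsum_closed) auto

lemma (in abelian_group) alternating_sum_0:
  assumes "y 0 \<in> carrier G"
  shows "alternating_sum G 0 y = y 0"
  using assms unfolding alternating_sum_def by simp

lemma (in abelian_group) alternating_sum_Suc:
  assumes "\<And>i. i \<le> Suc k \<Longrightarrow> y i \<in> carrier G"
  shows "alternating_sum G (Suc k) y =
    alternating_sum G k y \<oplus> (if odd k then y (Suc k) else \<ominus> y (Suc k))"
proof -
  have "alternating_sum G (Suc k) y = [((-1) ^ Suc k :: int)] \<cdot> y (Suc k) \<oplus> alternating_sum G k y"
    unfolding alternating_sum_def using assms by (subst finsum_Suc) (auto simp: sign_add_pow)
  moreover have "alternating_sum G k y \<in> carrier G"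
    using assms by (intro alternating_sum_closed) auto
  ultimately show ?thesis using assms[of "Suc k"]
    by (simp add: sign_add_pow a_comm del: power_Suc)
qed

lemma (in abelian_group) alternating_sum_cong:
  assumes "\<And>i. i \<le> k \<Longrightarrow> y i = z i" "\<And>i. i \<le> k \<Longrightarrow> z i \<in> carrier G"
  shows "alternating_sum G k y = alternating_sum G k z"
  using assms unfolding alternating_sum_def by (intro finsum_cong') auto

lemma (in abelian_group) alternating_sum_add:
  assumes "\<And>i. i \<le> k \<Longrightarrow> y i \<in> carrier G" "\<And>i. i \<le> k \<Longrightarrow> z i \<in> carrier G"
  shows "alternating_sum G k (\<lambda>i. y i \<oplus> z i) = alternating_sum G k y \<oplus> alternating_sum G k z"
proof -
  have "alternating_sum G k (\<lambda>i. y i \<oplus> z i) =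
      (\<Oplus>i\<in>{..k}. [((-1) ^ i :: int)] \<cdot> y i \<oplus> [((-1) ^ i :: int)] \<cdot> z i)"
    using assms unfolding alternating_sum_def
    by (intro finsum_cong') (auto simp: sign_add_pow minus_add)
  also have "\<dots> = alternating_sum G k y \<oplus> alternating_sum G k z"
    using assms unfolding alternating_sum_def by (intro finsum_addf) auto
  finally show ?thesis .
qed

lemma (in abelian_group) alternating_sum_minus:
  assumes "\<And>i. i \<le> k \<Longrightarrow> y i \<in> carrier G"
  shows "alternating_sum G k (\<lambda>i. \<ominus> y i) = \<ominus> alternating_sum G k y"
proof -
  have "alternating_sum G k (\<lambda>i. \<ominus> y i) \<oplus> alternating_sum G k y =
      alternating_sum G k (\<lambda>i. \<ominus> y i \<oplus> y i)"
    using assms by (subst alternating_sum_add) auto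
  also have "\<dots> = alternating_sum G k (\<lambda>i. \<zero>)"
    using assms by (intro alternating_sum_cong) (auto simp: l_neg)
  also have "\<dots> = \<zero>" 
    unfolding alternating_sum_def by (simp add: sign_add_pow)
  finally show ?thesis
    using assms alternating_sum_closed[of k y] alternating_sum_closed[of k "\<lambda>i. \<ominus> y i"]
    by (intro minus_equality[symmetric]) auto
qed

text \<open>The sign cancellation behind \<open>\<partial>\<partial> = 0\<close>: the simplicial identity \<open>d\<^sub>j d\<^sub>i = d\<^bsub>i-1\<^esub> d\<^sub>j\<close> for
  \<open>j < i\<close> pairs off the terms of the double sum with opposite signs. Raising \<open>k\<close> by one adds a row
  and a column that cancel each other, which is why an induction suffices.\<close>

lemma (in abelian_group) alternating_sum_simplicial:
  assumes "\<And>i j. i \<le> Suc k \<Longrightarrow> j \<le> k \<Longrightarrow> y i j \<in> carrier G"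
    and "\<And>i j. j < i \<Longrightarrow> i \<le> Suc k \<Longrightarrow> y i j = y j (i - 1)"
  shows "alternating_sum G (Suc k) (\<lambda>i. alternating_sum G k (y i)) = \<zero>"
  using assms
proof (induction k)
  case 0
  then have "y 1 0 = y 0 0" by simp
  with 0 show ?case
    by (simp add: alternating_sum_Suc alternating_sum_0 r_neg)
next
  case (Suc k)
  let ?a = "\<lambda>l i. alternating_sum G l (y i)"
  define s where "s x = (if odd k then x else \<ominus> x)" for x
  have s_add: "s (\<ominus> x) = \<ominus> s x" if "x \<in> carrier G" for x
    using that by (auto simp: s_def)
  have c: "?a l i \<in> carrier G" if "i \<le> Suc (Suc k)" "l \<le> Suc k" for i l
    using that Suc.prems(1) by (intro alternating_sum_closed) auto
  have last: "?a (Suc k) (Suc (Suc k)) = alternating_sum G (Suc k) (\<lambda>i. y i (Suc k))"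
    using Suc.prems(2)[of _ "Suc (Suc k)"] Suc.prems(1) by (intro alternating_sum_cong) auto
  have col: "alternating_sum G (Suc k) (\<lambda>i. y i (Suc k)) \<in> carrier G"
    using Suc.prems(1) by (intro alternating_sum_closed) auto
  have "alternating_sum G (Suc k) (\<lambda>i. ?a (Suc k) i) =
      alternating_sum G (Suc k) (\<lambda>i. ?a k i \<oplus> s (y i (Suc k)))"
    unfolding s_def
    using Suc.prems(1) c by (intro alternating_sum_cong alternating_sum_Suc) auto
  also have "\<dots> = alternating_sum G (Suc k) (?a k) \<oplus> alternating_sum G (Suc k) (\<lambda>i. s (y i (Suc k)))"
    using Suc.prems(1) c by (intro alternating_sum_add) (auto simp: s_def)
  also have "alternating_sum G (Suc k) (?a k) = \<zero>"
    using Suc.prems by (intro Suc.IH) auto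
  also have "alternating_sum G (Suc k) (\<lambda>i. s (y i (Suc k))) =
      s (alternating_sum G (Suc k) (\<lambda>i. y i (Suc k)))"
    using Suc.prems(1) by (cases "odd k") (simp_all add: s_def alternating_sum_minus)
  finally have "alternating_sum G (Suc k) (?a (Suc k)) = s (?a (Suc k) (Suc (Suc k)))"
    using col by (simp add: s_def last)
  moreover have "alternating_sum G (Suc (Suc k)) (?a (Suc k)) =
      alternating_sum G (Suc k) (?a (Suc k)) \<oplus> \<ominus> s (?a (Suc k) (Suc (Suc k)))"
    using c by (subst alternating_sum_Suc) (auto simp: s_def)
  ultimately show ?case using c[of "Suc (Suc k)" "Suc k"]
    by (simp add: s_def r_neg)
qed

lemma a_r_coset_carrier_update [simp]: "a_r_coset (M\<lparr>carrier := Z\<rparr>) H x = a_r_coset M H x"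
  by (simp add: a_r_coset_def')

text \<open>The maps induced on quotients (scalar multiplication, transition maps, comparison maps) are
  all given as unions over the representatives of a coset. Since \<open>h\<close> sends \<open>K\<close> into \<open>L\<close>, every
  representative contributes the same coset, so any one of them computes the union.\<close>

lemma (in abelian_group_hom) UN_coset_image:
  assumes "additive_subgroup K G" "additive_subgroup L H" "h ` K \<subseteq> L" "z \<in> carrier G"
  shows "(\<Union>x\<in>K +>\<^bsub>G\<^esub> z. L +>\<^bsub>H\<^esub> h x) = L +>\<^bsub>H\<^esub> h z"
proof -
  interpret K: abelian_subgroup K G
    using assms G.abelian_group_axioms by (intro abelian_subgroupI3)
  interpret L: abelian_subgroup L H
    using assms H.abelian_group_axioms by (intro abelian_subgroupI3)
  have "L +>\<^bsub>H\<^esub> h x = L +>\<^bsub>H\<^esub> h z" if "x \<in> K +>\<^bsub>G\<^esub> z" for x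
  proof -
    from that obtain b where b: "b \<in> K" "x = b \<oplus>\<^bsub>G\<^esub> z" by (auto simp: a_r_coset_def')
    then have "h x = h b \<oplus>\<^bsub>H\<^esub> h z" "h b \<in> L" using assms by auto
    then have "h x \<in> L +>\<^bsub>H\<^esub> h z" by (auto simp: a_r_coset_def')
    then show ?thesis using assms(4) L.a_repr_independence' by auto
  qed
  moreover have "z \<in> K +>\<^bsub>G\<^esub> z" using assms(4) K.a_rcos_self by auto
  ultimately show ?thesis by blast
qed

lemma abelian_group_quotient_module:
  assumes "abelian_subgroup H G"
  shows "abelian_group (quotient_module G H)"
proof -
  interpret abelian_subgroup H G by fact
  interpret Q: comm_group "G A_Mod H" by (rule a_factorgroup_is_comm_group)
  have c: "carrier (quotient_module G H) = carrier (G A_Mod H)"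
    "add (quotient_module G H) = mult (G A_Mod H)" "zero (quotient_module G H) = one (G A_Mod H)"
    by (simp_all add: quotient_module_def A_FactGroup_def' fun_eq_iff)
  show ?thesis
    using Q.l_inv_ex
    by (intro abelian_groupI) (simp_all add: c Q.m_ac del: add_A_FactGroup)
qed

lemma quotient_module_hom:
  assumes "abelian_subgroup H G"
  shows "abelian_group_hom G (quotient_module G H) (\<lambda>x. H +>\<^bsub>G\<^esub> x)"
proof -
  interpret abelian_subgroup H G by fact
  show ?thesis
    unfolding abelian_group_hom_iff
    using abelian_group_axioms abelian_group_quotient_module[OF assms]
    by (auto simp: quotient_module_def a_rcosetsI a_subset a_rcos_sum)
qed

definition linear_map ::
  "('b, 'c) ring_scheme \<Rightarrow> ('b, 'm, 'd) module_scheme \<Rightarrow> ('b, 'n, 'e) module_scheme \<Rightarrow> ('m \<Rightarrow> 'n) \<Rightarrow> bool"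
  where "linear_map R M N h \<longleftrightarrow> abelian_group_hom M N h \<and>
    (\<forall>a\<in>carrier R. \<forall>x\<in>carrier M. h (a \<odot>\<^bsub>M\<^esub> x) = a \<odot>\<^bsub>N\<^esub> h x)"

lemma linear_map_hom: "linear_map R M N h \<Longrightarrow> abelian_group_hom M N h"
  by (simp add: linear_map_def)

lemma linear_map_smult:
  "linear_map R M N h \<Longrightarrow> a \<in> carrier R \<Longrightarrow> x \<in> carrier M \<Longrightarrow> h (a \<odot>\<^bsub>M\<^esub> x) = a \<odot>\<^bsub>N\<^esub> h x"
  by (simp add: linear_map_def)


section \<open>Direct sums and associated graded modules\<close>

lemma direct_sum_simps [simp]:
  "carrier (direct_sum I M) = {x \<in> \<Pi>\<^sub>E i\<in>I. carrier (M i). finite {i \<in> I. x i \<noteq> \<zero>\<^bsub>M i\<^esub>}}"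
  "zero (direct_sum I M) = (\<lambda>i\<in>I. \<zero>\<^bsub>M i\<^esub>)"
  "add (direct_sum I M) x y = (\<lambda>i\<in>I. x i \<oplus>\<^bsub>M i\<^esub> y i)"
  "smult (direct_sum I M) a x = (\<lambda>i\<in>I. a \<odot>\<^bsub>M i\<^esub> x i)"
  by (simp_all add: direct_sum_def)

lemma abelian_group_direct_sum:
  assumes "\<And>i. i \<in> I \<Longrightarrow> abelian_group (M i)"
  shows "abelian_group (direct_sum I M)"
proof (rule abelian_groupI)
  note E = abelian_groupE[OF assms]
  fix x y assume xy: "x \<in> carrier (direct_sum I M)" "y \<in> carrier (direct_sum I M)"
  have "{i \<in> I. x i \<oplus>\<^bsub>M i\<^esub> y i \<noteq> \<zero>\<^bsub>M i\<^esub>} \<subseteq> {i \<in> I. x i \<noteq> \<zero>\<^bsub>M i\<^esub>} \<union> {i \<in> I. y i \<noteq> \<zero>\<^bsub>M i\<^esub>}"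
    using E by auto
  then have "finite {i \<in> I. x i \<oplus>\<^bsub>M i\<^esub> y i \<noteq> \<zero>\<^bsub>M i\<^esub>}"
    by (rule finite_subset) (use xy in auto)
  then show "x \<oplus>\<^bsub>direct_sum I M\<^esub> y \<in> carrier (direct_sum I M)"
    using xy E(1) by (auto simp: PiE_iff cong: conj_cong)
  show "x \<oplus>\<^bsub>direct_sum I M\<^esub> y = y \<oplus>\<^bsub>direct_sum I M\<^esub> x"
    using xy E(4) by (auto simp: PiE_iff)
next
  note E = abelian_groupE[OF assms]
  show "\<zero>\<^bsub>direct_sum I M\<^esub> \<in> carrier (direct_sum I M)"
    using E(2) by (auto cong: conj_cong)
  fix x assume x: "x \<in> carrier (direct_sum I M)"
  show "\<zero>\<^bsub>direct_sum I M\<^esub> \<oplus>\<^bsub>direct_sum I M\<^esub> x = x"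
    using x E(5) by (auto simp: PiE_iff extensional_def)
  define y where "y = (\<lambda>i\<in>I. \<ominus>\<^bsub>M i\<^esub> x i)"
  have eq: "y i \<noteq> \<zero>\<^bsub>M i\<^esub> \<longleftrightarrow> x i \<noteq> \<zero>\<^bsub>M i\<^esub>" if "i \<in> I" for i
  proof -
    interpret abelian_group "M i" using assms that .
    show ?thesis using that x by (auto simp: y_def add.inv_eq_1_iff PiE_iff)
  qed
  have "y \<in> carrier (direct_sum I M)"
    using x assms by (auto simp: y_def PiE_iff abelian_group.a_inv_closed cong: conj_cong)
      (use eq in \<open>simp add: y_def cong: conj_cong\<close>)
  moreover have "y \<oplus>\<^bsub>direct_sum I M\<^esub> x = \<zero>\<^bsub>direct_sum I M\<^esub>"
    using x assms by (auto simp: y_def PiE_iff abelian_group.l_neg)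
  ultimately show "\<exists>y\<in>carrier (direct_sum I M). y \<oplus>\<^bsub>direct_sum I M\<^esub> x = \<zero>\<^bsub>direct_sum I M\<^esub>"
    by blast
next
  note E = abelian_groupE[OF assms]
  fix x y z assume "x \<in> carrier (direct_sum I M)" "y \<in> carrier (direct_sum I M)" "z \<in> carrier (direct_sum I M)"
  then show "x \<oplus>\<^bsub>direct_sum I M\<^esub> y \<oplus>\<^bsub>direct_sum I M\<^esub> z = x \<oplus>\<^bsub>direct_sum I M\<^esub> (y \<oplus>\<^bsub>direct_sum I M\<^esub> z)"
    using E(3) by (auto simp: PiE_iff)
qed

lemma module_direct_sum:
  assumes "cring R" "\<And>i. i \<in> I \<Longrightarrow> module R (M i)"
  shows "module R (direct_sum I M)"
proof (rule moduleI[OF assms(1)])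
  have ag: "abelian_group (M i)" if "i \<in> I" for i
    using assms(2)[OF that] by (simp add: module_def)
  show "abelian_group (direct_sum I M)"
    using ag by (rule abelian_group_direct_sum)
next
  fix a x assume ax: "a \<in> carrier R" "x \<in> carrier (direct_sum I M)"
  have "{i \<in> I. a \<odot>\<^bsub>M i\<^esub> x i \<noteq> \<zero>\<^bsub>M i\<^esub>} \<subseteq> {i \<in> I. x i \<noteq> \<zero>\<^bsub>M i\<^esub>}"
    using ax module.smult_r_null[OF assms(2)] by auto
  then have "finite {i \<in> I. a \<odot>\<^bsub>M i\<^esub> x i \<noteq> \<zero>\<^bsub>M i\<^esub>}"
    by (rule finite_subset) (use ax in auto)
  then show "a \<odot>\<^bsub>direct_sum I M\<^esub> x \<in> carrier (direct_sum I M)"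
    using ax assms(2) by (auto simp: PiE_iff module.smult_closed[OF assms(2)] cong: conj_cong)
qed (auto simp: PiE_iff extensional_def module.smult_l_distr[OF assms(2)]
    module.smult_r_distr[OF assms(2)] module.smult_assoc1[OF assms(2)] module.smult_one[OF assms(2)]
    intro!: restrict_ext)

lemma associated_module_simps [simp]:
  "carrier (associated_module R r G) = carrier (direct_sum (grades r) (module_at G))"
  "zero (associated_module R r G) = zero (direct_sum (grades r) (module_at G))"
  "add (associated_module R r G) = add (direct_sum (grades r) (module_at G))"
  "smult (associated_module R r G) p m = (\<lambda>u\<in>grades r. \<Oplus>\<^bsub>module_at G u\<^esub>w\<in>{w. w \<le> u}.
        p w \<odot>\<^bsub>module_at G u\<^esub> module_along G (\<lambda>i. u i - w i) u (m (\<lambda>i. u i - w i)))"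
  "component (associated_module R r G) v = {m \<in> carrier (direct_sum (grades r) (module_at G)).
      \<forall>u\<in>grades r. u \<noteq> v \<longrightarrow> m u = \<zero>\<^bsub>module_at G u\<^esub>}"
  by (simp_all add: associated_module_def Let_def)

lemma abelian_group_associated_module:
  assumes "\<And>v. v \<in> grades r \<Longrightarrow> abelian_group (module_at G v)"
  shows "abelian_group (associated_module R r G)"
proof -
  interpret D: abelian_group "direct_sum (grades r) (module_at G)"
    using assms by (rule abelian_group_direct_sum)
  show ?thesis
    by (rule abelian_groupI)
      (auto simp: D.a_assoc D.l_neg intro: D.a_comm intro!: bexI[of _ "\<ominus>\<^bsub>direct_sum (grades r) (module_at G)\<^esub> _"] simp del: direct_sum_simps)
qed

lemma associated_module_eval_hom:
  assumes "\<And>v. v \<in> grades r \<Longrightarrow> abelian_group (module_at G v)" "v \<in> grades r"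
  shows "abelian_group_hom (associated_module R r G) (module_at G v) (\<lambda>x. x v)"
  unfolding abelian_group_hom_iff
  using abelian_group_associated_module[OF assms(1)] assms by auto

lemma associated_module_eqI:
  assumes "x \<in> carrier (associated_module R r G)" "y \<in> carrier (associated_module R r G)"
    and "\<And>v. v \<in> grades r \<Longrightarrow> x v = y v"
  shows "x = y"
  using assms by (auto simp: PiE_iff intro: extensionalityI)


section \<open>Linear extensions of maps of sets\<close>

lemma module_self_module:
  assumes "cring R"
  shows "module R (self_module R)"
proof -
  interpret cring R by fact
  have [simp]: "carrier (self_module R) = carrier R" "add (self_module R) = add R"
    "zero (self_module R) = zero R" "smult (self_module R) = mult R"
    by (simp_all add: self_module_def ring.defs)
  show ?thesis
    by (intro moduleI abelian_groupI)
      (auto simp: l_distr r_distr a_assoc m_assoc l_neg intro: a_comm intro!: bexI[of _ "\<ominus>\<^bsub>R\<^esub> _"] is_cring)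
qed

lemma span_module_simps [simp]:
  "carrier (span_module R S) = {c \<in> S \<rightarrow>\<^sub>E carrier R. finite {s \<in> S. c s \<noteq> \<zero>\<^bsub>R\<^esub>}}"
  "zero (span_module R S) = (\<lambda>s\<in>S. \<zero>\<^bsub>R\<^esub>)"
  "add (span_module R S) c d = (\<lambda>s\<in>S. c s \<oplus>\<^bsub>R\<^esub> d s)"
  "smult (span_module R S) a c = (\<lambda>s\<in>S. a \<otimes>\<^bsub>R\<^esub> c s)"
  by (simp_all add: span_module_def self_module_def ring.defs)

text \<open>The entry \<open>b\<close> is arbitrary rather than \<open>1\<close>, so that every element of the span is a sum of such
  vectors and additive maps are determined by their values on them, without recourse to scalars.\<close>

definition basis_vector :: "('b, 'c) ring_scheme \<Rightarrow> 's set \<Rightarrow> 's \<Rightarrow> 'b \<Rightarrow> 's \<Rightarrow> 'b" where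
  "basis_vector R S s b = (\<lambda>t\<in>S. if t = s then b else \<zero>\<^bsub>R\<^esub>)"

context cring
begin

lemma module_span_module: "module R (span_module R S)"
  unfolding span_module_def by (intro module_direct_sum is_cring module_self_module)

lemma abelian_group_span_module: "abelian_group (span_module R S)"
  using module_span_module by (rule module.axioms(2))

lemma basis_vector_closed:
  assumes "b \<in> carrier R"
  shows "basis_vector R S s b \<in> carrier (span_module R S)"
proof -
  have "{t \<in> S. basis_vector R S s b t \<noteq> \<zero>} \<subseteq> {s}" by (auto simp: basis_vector_def)
  then have "finite {t \<in> S. basis_vector R S s b t \<noteq> \<zero>}" by (rule finite_subset) simp
  then show ?thesis using assms by (auto simp: basis_vector_def)
qed

lemma span_module_induct [consumes 1, case_names zero basis add]:
  assumes "c \<in> carrier (span_module R S)"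
    and "Q \<zero>\<^bsub>span_module R S\<^esub>"
    and "\<And>s b. s \<in> S \<Longrightarrow> b \<in> carrier R \<Longrightarrow> Q (basis_vector R S s b)"
    and "\<And>c d. c \<in> carrier (span_module R S) \<Longrightarrow> d \<in> carrier (span_module R S) \<Longrightarrow>
      Q c \<Longrightarrow> Q d \<Longrightarrow> Q (c \<oplus>\<^bsub>span_module R S\<^esub> d)"
  shows "Q c"
proof -
  have "finite A \<Longrightarrow> c \<in> carrier (span_module R S) \<Longrightarrow> {s \<in> S. c s \<noteq> \<zero>} = A \<Longrightarrow> Q c" for A c
  proof (induction A arbitrary: c rule: finite_induct)
    case empty
    then have "c = \<zero>\<^bsub>span_module R S\<^esub>" by (auto simp: PiE_iff extensional_def)
    then show ?case using assms(2) by (simp only:)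
  next
    case (insert s A)
    have s: "s \<in> S" "c s \<in> carrier R" using insert.prems by (auto simp: PiE_iff)
    define d where "d = c(s := \<zero>)"
    have supp: "{t \<in> S. d t \<noteq> \<zero>} = A"
      using insert.prems(2) insert.hyps(2) by (auto simp: d_def)
    then have d: "d \<in> carrier (span_module R S)"
      using insert.prems(1) insert.hyps(1) s by (auto simp: d_def PiE_iff extensional_def)
    have "c = d \<oplus>\<^bsub>span_module R S\<^esub> basis_vector R S s (c s)"
      using insert.prems(1) s by (auto simp: d_def basis_vector_def PiE_iff extensional_def fun_eq_iff)
    moreover have "Q (basis_vector R S s (c s))" using assms(3) s by blast
    moreover have "Q d" using insert.IH d supp by blast
    ultimately show ?case using assms(4) d basis_vector_closed s(2) by metis
  qed
  then show ?thesis using assms(1) by auto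
qed

lemma span_module_hom_eqI:
  assumes "abelian_group_hom (span_module R S) N g" "abelian_group_hom (span_module R S) N h"
    and "\<And>s b. s \<in> S \<Longrightarrow> b \<in> carrier R \<Longrightarrow> g (basis_vector R S s b) = h (basis_vector R S s b)"
    and "c \<in> carrier (span_module R S)"
  shows "g c = h c"
proof -
  interpret g: abelian_group_hom "span_module R S" N g by fact
  interpret h: abelian_group_hom "span_module R S" N h by fact
  from assms(4) show ?thesis
  proof (induction rule: span_module_induct)
    case zero
    show ?case by (simp only: g.hom_zero h.hom_zero)
  next
    case (add c d)
    then show ?case by (simp only: g.hom_add h.hom_add)
  qed (rule assms(3))
qed

text \<open>The index set in the definition of \<^const>\<open>span_map\<close> depends on \<open>c\<close>. Enlarging it to a set that
  contains the relevant supports of several elements makes their sums comparable.\<close>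

lemma span_map_eq_finsum:
  assumes "c \<in> carrier (span_module R S)" "t \<in> T" "finite A"
    and "{s \<in> S. f s = t \<and> c s \<noteq> \<zero>} \<subseteq> A" "A \<subseteq> {s \<in> S. f s = t}"
  shows "span_map R S T f c t = (\<Oplus>s\<in>A. c s)"
  unfolding span_map_def restrict_apply if_P[OF assms(2)]
  using assms by (intro add.finprod_mono_neutral_cong_left) (auto simp: PiE_iff)

lemma span_map_extensional: "span_map R S T f c \<in> extensional T"
  unfolding span_map_def by (rule restrict_extensional)

lemma linear_map_span_map:
  assumes "f \<in> S \<rightarrow> T"
  shows "linear_map R (span_module R S) (span_module R T) (span_map R S T f)"
proof -
  interpret S: module R "span_module R S" by (rule module_span_module)
  let ?fib = "\<lambda>c t. {s \<in> S. f s = t \<and> c s \<noteq> \<zero>}"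
  have fin: "finite (?fib c t)" if "c \<in> carrier (span_module R S)" for c t
    using that by (auto elim!: rev_finite_subset)
  have closed: "span_map R S T f c \<in> carrier (span_module R T)"
    if c: "c \<in> carrier (span_module R S)" for c
  proof -
    have "t \<in> f ` {s \<in> S. c s \<noteq> \<zero>}" if "span_map R S T f c t \<noteq> \<zero>" "t \<in> T" for t
    proof (rule ccontr)
      assume "t \<notin> f ` {s \<in> S. c s \<noteq> \<zero>}"
      then have "?fib c t = {}" by auto
      then have "span_map R S T f c t = \<zero>" using that(2)
        by (simp only: span_map_def restrict_apply if_True finsum_empty)
      then show False using that(1) by simp
    qed
    then have "{t \<in> T. span_map R S T f c t \<noteq> \<zero>} \<subseteq> f ` {s \<in> S. c s \<noteq> \<zero>}" by blast
    then have "finite {t \<in> T. span_map R S T f c t \<noteq> \<zero>}"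
      by (rule finite_subset) (use c in auto)
    moreover have "span_map R S T f c t \<in> carrier R" if "t \<in> T" for t
      using c that by (auto simp: span_map_def PiE_iff intro!: finsum_closed)
    ultimately show ?thesis by (auto simp: PiE_iff) (simp add: span_map_def)
  qed
  have add: "span_map R S T f (c \<oplus>\<^bsub>span_module R S\<^esub> d) =
      span_map R S T f c \<oplus>\<^bsub>span_module R T\<^esub> span_map R S T f d"
    if c: "c \<in> carrier (span_module R S)" and d: "d \<in> carrier (span_module R S)" for c d
  proof (rule extensionalityI[of _ T])
    fix t assume t: "t \<in> T"
    let ?A = "?fib c t \<union> ?fib d t"
    have "span_map R S T f (c \<oplus>\<^bsub>span_module R S\<^esub> d) t = (\<Oplus>s\<in>?A. (c \<oplus>\<^bsub>span_module R S\<^esub> d) s)"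
      using t fin[OF c] fin[OF d] S.a_closed[OF c d]
      by (intro span_map_eq_finsum) auto
    also have "\<dots> = (\<Oplus>s\<in>?A. c s \<oplus> d s)"
      using c d by (intro finsum_cong') auto
    also have "\<dots> = (\<Oplus>s\<in>?A. c s) \<oplus> (\<Oplus>s\<in>?A. d s)"
      using c d by (intro finsum_addf) auto
    also have "(\<Oplus>s\<in>?A. c s) = span_map R S T f c t"
      using t c fin[OF c] fin[OF d] by (intro span_map_eq_finsum[symmetric]) auto
    also have "(\<Oplus>s\<in>?A. d s) = span_map R S T f d t"
      using t d fin[OF c] fin[OF d] by (intro span_map_eq_finsum[symmetric]) auto
    finally have eq: "span_map R S T f (c \<oplus>\<^bsub>span_module R S\<^esub> d) t =
        span_map R S T f c t \<oplus> span_map R S T f d t" .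
    show "span_map R S T f (c \<oplus>\<^bsub>span_module R S\<^esub> d) t =
        (span_map R S T f c \<oplus>\<^bsub>span_module R T\<^esub> span_map R S T f d) t"
      by (rule trans[OF eq]) (simp only: span_module_simps restrict_apply t if_True)
  qed (simp_all add: span_map_extensional)
  have smult: "span_map R S T f (a \<odot>\<^bsub>span_module R S\<^esub> c) = a \<odot>\<^bsub>span_module R T\<^esub> span_map R S T f c"
    if a: "a \<in> carrier R" and c: "c \<in> carrier (span_module R S)" for a c
  proof (rule extensionalityI[of _ T])
    fix t assume t: "t \<in> T"
    have "span_map R S T f (a \<odot>\<^bsub>span_module R S\<^esub> c) t =
        (\<Oplus>s\<in>?fib c t. (a \<odot>\<^bsub>span_module R S\<^esub> c) s)"
      using t fin[OF c] S.smult_closed[OF a c] a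
      by (intro span_map_eq_finsum) auto
    also have "\<dots> = (\<Oplus>s\<in>?fib c t. a \<otimes> c s)"
      using a c by (intro finsum_cong') auto
    also have "\<dots> = a \<otimes> (\<Oplus>s\<in>?fib c t. c s)"
      using a c fin[OF c, of t] by (intro finsum_rdistr[symmetric]) auto
    also have "(\<Oplus>s\<in>?fib c t. c s) = span_map R S T f c t"
      using t by (simp only: span_map_def restrict_apply if_True)
    finally have eq: "span_map R S T f (a \<odot>\<^bsub>span_module R S\<^esub> c) t = a \<otimes> span_map R S T f c t" .
    show "span_map R S T f (a \<odot>\<^bsub>span_module R S\<^esub> c) t =
        (a \<odot>\<^bsub>span_module R T\<^esub> span_map R S T f c) t"
      by (rule trans[OF eq]) (simp only: span_module_simps restrict_apply t if_True)
  qed (simp_all add: span_map_extensional)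
  show ?thesis
    unfolding linear_map_def abelian_group_hom_iff
    by (intro conjI ballI funcsetI abelian_group_span_module closed add smult)
qed

lemmas span_map_hom = linear_map_hom[OF linear_map_span_map]
lemmas span_map_closed = abelian_group_hom.hom_closed[OF span_map_hom]

lemma span_map_basis_vector:
  assumes "s \<in> S" "f s \<in> T" "b \<in> carrier R"
  shows "span_map R S T f (basis_vector R S s b) = basis_vector R T (f s) b"
proof (rule extensionalityI[of _ T])
  fix t assume t: "t \<in> T"
  have "span_map R S T f (basis_vector R S s b) t =
      (\<Oplus>s\<in>(if f s = t then {s} else {}). basis_vector R S s b s)"
    if "t = f s"
    using assms that t
    by (subst span_map_eq_finsum[where A = "{s}"]) (auto simp: basis_vector_closed[simplified] basis_vector_def)
  moreover have "span_map R S T f (basis_vector R S s b) t = \<zero>" if "t \<noteq> f s"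
    using assms that t
    by (subst span_map_eq_finsum[where A = "{}"]) (auto simp: basis_vector_closed[simplified] basis_vector_def)
  ultimately show "span_map R S T f (basis_vector R S s b) t = basis_vector R T (f s) b t"
    using assms t by (auto simp: basis_vector_def)
qed (auto simp: span_map_def basis_vector_def)

lemma span_map_compose:
  assumes "f \<in> S \<rightarrow> T" "g \<in> T \<rightarrow> U" "\<And>s. s \<in> S \<Longrightarrow> h s = g (f s)" "c \<in> carrier (span_module R S)"
  shows "span_map R T U g (span_map R S T f c) = span_map R S U h c"
proof (rule span_module_hom_eqI[OF _ _ _ assms(4)])
  show "abelian_group_hom (span_module R S) (span_module R U) (\<lambda>c. span_map R T U g (span_map R S T f c))"
    using assms by (intro abelian_group_hom_compose[OF span_map_hom span_map_hom])
  show "abelian_group_hom (span_module R S) (span_module R U) (span_map R S U h)"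
    using assms by (intro span_map_hom) (auto simp: Pi_iff)
  fix s b assume "s \<in> S" "b \<in> carrier R"
  then show "span_map R T U g (span_map R S T f (basis_vector R S s b)) = span_map R S U h (basis_vector R S s b)"
    using assms by (simp add: span_map_basis_vector Pi_iff)
qed

lemma span_map_id:
  assumes "\<And>s. s \<in> S \<Longrightarrow> f s = s" "c \<in> carrier (span_module R S)"
  shows "span_map R S S f c = c"
proof (rule span_module_hom_eqI[OF _ _ _ assms(2)])
  show "abelian_group_hom (span_module R S) (span_module R S) (span_map R S S f)"
    using assms by (intro span_map_hom) auto
  show "abelian_group_hom (span_module R S) (span_module R S) (\<lambda>c. c)"
    by (simp add: abelian_group_hom_iff abelian_group_span_module del: span_module_simps)
qed (use assms in \<open>simp add: span_map_basis_vector\<close>)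

lemma span_map_surj:
  assumes "f \<in> S \<rightarrow> T" "T \<subseteq> f ` S"
  shows "span_map R S T f ` carrier (span_module R S) = carrier (span_module R T)"
proof
  show "span_map R S T f ` carrier (span_module R S) \<subseteq> carrier (span_module R T)"
    using span_map_closed[OF assms(1)] by blast
  have inv: "inv_into S f \<in> T \<rightarrow> S" using assms(2) by (auto intro: inv_into_into)
  have "c = span_map R S T f (span_map R T S (inv_into S f) c)" if "c \<in> carrier (span_module R T)" for c
    using that assms
    by (subst span_map_compose[OF inv, of f T "\<lambda>t. t"]) (auto simp: span_map_id f_inv_into_f subset_eq)
  then show "carrier (span_module R T) \<subseteq> span_map R S T f ` carrier (span_module R S)"
    using span_map_closed[OF inv] by blast
qed

lemma span_map_eq_zero_iff:
  assumes "f \<in> S \<rightarrow> T" "inj_on f S" "c \<in> carrier (span_module R S)"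
  shows "span_map R S T f c = \<zero>\<^bsub>span_module R T\<^esub> \<longleftrightarrow> c = \<zero>\<^bsub>span_module R S\<^esub>"
proof
  have h: "abelian_group_hom (span_module R S) (span_module R T) (span_map R S T f)"
    using assms(1) by (rule span_map_hom)
  show "span_map R S T f c = \<zero>\<^bsub>span_module R T\<^esub>" if "c = \<zero>\<^bsub>span_module R S\<^esub>"
    unfolding that by (rule abelian_group_hom.hom_zero[OF h])
  assume 0: "span_map R S T f c = \<zero>\<^bsub>span_module R T\<^esub>"
  have "c s = \<zero>" if "s \<in> S" for s
  proof -
    have "span_map R S T f c (f s) = (\<Oplus>s\<in>{s}. c s)"
      using assms that by (intro span_map_eq_finsum) (auto dest: inj_onD)
    moreover have "c s \<in> carrier R" using assms(3) that by auto
    then have "(\<Oplus>s\<in>{s}. c s) = c s"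
      by (metis (no_types, lifting) Pi_I add.finprod_insert empty_iff finite.emptyI finsum_empty r_zero)
    moreover have "span_map R S T f c (f s) = \<zero>" using 0 assms(1) that by auto
    ultimately show ?thesis by simp
  qed
  then show "c = \<zero>\<^bsub>span_module R S\<^esub>" using assms(3) by (auto simp: PiE_iff extensional_def)
qed

text \<open>The edges \<open>E\<close> with end points \<open>a\<close> and \<open>b\<close> form a complete graph on each fibre of \<open>p\<close>.
  Choose a section \<open>s\<close> of \<open>p\<close> and contract every fibre to its chosen point by \<open>q = s \<circ> p\<close>. A basis
  vector and its contraction are equal or the two ends of one edge, so by additivity \<open>c\<close> and its
  contraction differ by a combination of differences of end points. The contraction of \<open>c\<close> factors
  through the image of \<open>c\<close> under \<open>p\<close>, hence vanishes when that image does.\<close>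

lemma span_map_kernel_edges:
  assumes p: "p \<in> S \<rightarrow> T" "T \<subseteq> p ` S" and a: "a \<in> E \<rightarrow> S" and b: "b \<in> E \<rightarrow> S"
    and edge: "\<And>x y. x \<in> S \<Longrightarrow> y \<in> S \<Longrightarrow> p x = p y \<Longrightarrow> x \<noteq> y \<Longrightarrow>
      \<exists>e\<in>E. a e = x \<and> b e = y \<or> a e = y \<and> b e = x"
    and c: "c \<in> carrier (span_module R S)" "span_map R S T p c = \<zero>\<^bsub>span_module R T\<^esub>"
  shows "\<exists>k\<in>carrier (span_module R E).
    c = span_map R E S a k \<ominus>\<^bsub>span_module R S\<^esub> span_map R E S b k"
proof -
  let ?S = "span_module R S" and ?E = "span_module R E"
  interpret S: abelian_group ?S by (rule abelian_group_span_module)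
  interpret E: abelian_group ?E by (rule abelian_group_span_module)
  interpret a: abelian_group_hom ?E ?S "span_map R E S a" using a by (rule span_map_hom)
  interpret b: abelian_group_hom ?E ?S "span_map R E S b" using b by (rule span_map_hom)
  define s where "s = inv_into S p"
  have s: "s \<in> T \<rightarrow> S" "\<And>t. t \<in> T \<Longrightarrow> p (s t) = t"
    using p(2) by (auto simp: s_def intro: inv_into_into f_inv_into_f)
  define q where "q x = s (p x)" for x
  have q: "q \<in> S \<rightarrow> S" using s p by (auto simp: q_def)
  interpret q: abelian_group_hom ?S ?S "span_map R S S q" using q by (rule span_map_hom)
  define d where "d k = span_map R E S a k \<ominus>\<^bsub>?S\<^esub> span_map R E S b k" for k
  have "\<exists>k\<in>carrier ?E. c \<ominus>\<^bsub>?S\<^esub> span_map R S S q c = d k"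
    using c(1)
  proof (induction rule: span_module_induct)
    case zero
    have "d \<zero>\<^bsub>?E\<^esub> = \<zero>\<^bsub>?S\<^esub>" unfolding d_def a.hom_zero b.hom_zero by (simp add: S.minus_eq S.r_neg del: span_module_simps)
    then show ?case by (metis E.zero_closed S.minus_eq S.r_neg S.zero_closed q.hom_zero)
  next
    case (basis x v)
    let ?x = "basis_vector R S x v"
    have x: "?x \<in> carrier ?S" using basis(2) by (rule basis_vector_closed)
    have qx: "span_map R S S q ?x = basis_vector R S (q x) v"
      using basis q by (intro span_map_basis_vector) auto
    show ?case
    proof (cases "q x = x")
      case True
      then have "?x \<ominus>\<^bsub>?S\<^esub> span_map R S S q ?x = d \<zero>\<^bsub>?E\<^esub>"
        using x unfolding d_def qx a.hom_zero b.hom_zero by (simp add: S.minus_eq S.r_neg del: span_module_simps)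
      then show ?thesis using E.zero_closed by blast
    next
      case False
      have "p (q x) = p x" "q x \<in> S" using basis s p q by (auto simp: q_def)
      then obtain e where e: "e \<in> E" "a e = x \<and> b e = q x \<or> a e = q x \<and> b e = x"
        using edge[of x "q x"] basis False by auto
      let ?e = "basis_vector R E e v"
      have ec: "?e \<in> carrier ?E" using basis(2) by (rule basis_vector_closed)
      have de: "d ?e = basis_vector R S (a e) v \<ominus>\<^bsub>?S\<^esub> basis_vector R S (b e) v"
        using e a b basis by (auto simp: d_def span_map_basis_vector Pi_iff)
      from e(2) show ?thesis
      proof
        assume "a e = x \<and> b e = q x"
        then show ?thesis using de qx ec by auto
      next
        assume *: "a e = q x \<and> b e = x"
        have "?x \<ominus>\<^bsub>?S\<^esub> basis_vector R S (q x) v = \<ominus>\<^bsub>?S\<^esub> (d ?e)"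
          using x basis_vector_closed[OF basis(2), of S "q x"]
          by (simp add: de * S.minus_eq S.minus_add S.a_comm del: span_module_simps)
        also have "\<dots> = d (\<ominus>\<^bsub>?E\<^esub> ?e)"
          using ec by (simp add: d_def S.minus_eq S.minus_add del: span_module_simps)
        finally show ?thesis using qx E.a_inv_closed[OF ec] by auto
      qed
    qed
  next
    case (add c1 c2)
    then obtain k1 k2 where k: "k1 \<in> carrier ?E" "k2 \<in> carrier ?E"
      "c1 \<ominus>\<^bsub>?S\<^esub> span_map R S S q c1 = d k1" "c2 \<ominus>\<^bsub>?S\<^esub> span_map R S S q c2 = d k2" by blast
    have "(c1 \<oplus>\<^bsub>?S\<^esub> c2) \<ominus>\<^bsub>?S\<^esub> span_map R S S q (c1 \<oplus>\<^bsub>?S\<^esub> c2) =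
        (c1 \<ominus>\<^bsub>?S\<^esub> span_map R S S q c1) \<oplus>\<^bsub>?S\<^esub> (c2 \<ominus>\<^bsub>?S\<^esub> span_map R S S q c2)"
      using add by (simp add: S.minus_eq S.minus_add S.a_ac del: span_module_simps)
    also have "\<dots> = d (k1 \<oplus>\<^bsub>?E\<^esub> k2)"
      unfolding k using k(1,2) by (simp add: d_def S.minus_eq S.minus_add S.a_ac del: span_module_simps)
    finally show ?case using E.a_closed[OF k(1,2)] by blast
  qed
  then obtain k where k: "k \<in> carrier ?E" "c \<ominus>\<^bsub>?S\<^esub> span_map R S S q c = d k" by blast
  interpret s: abelian_group_hom "span_module R T" ?S "span_map R T S s" using s(1) by (rule span_map_hom)
  have "span_map R S S q c = span_map R T S s (span_map R S T p c)"
    using p s c by (intro span_map_compose[symmetric]) (auto simp: q_def)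
  also have "\<dots> = \<zero>\<^bsub>?S\<^esub>" unfolding c(2) by (rule s.hom_zero)
  finally have "span_map R S S q c = \<zero>\<^bsub>?S\<^esub>" .
  then have "c = d k" using k(2) S.minus_zero_right[OF c(1)] by (simp only:)
  then show ?thesis using k(1) unfolding d_def by blast
qed

end


section \<open>Quotients of associated graded modules, level by level\<close>

lemma submodule_finsum:
  assumes "module R M" "submodule N R M" "y \<in> A \<rightarrow> N"
  shows "finsum (M\<lparr>carrier := N\<rparr>) y A = finsum M y A" "finsum M y A \<in> N"
proof -
  interpret M: module R M by fact
  interpret N: module R "M\<lparr>carrier := N\<rparr>"
    using assms(2,1) by (rule submodule.submodule_is_module)
  have "N \<subseteq> carrier M" using M.submoduleE[OF assms(2)] by blast
  then interpret i: abelian_group_hom "M\<lparr>carrier := N\<rparr>" M "\<lambda>x. x"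
    unfolding abelian_group_hom_iff using M.abelian_group_axioms N.abelian_group_axioms by auto
  show *: "finsum (M\<lparr>carrier := N\<rparr>) y A = finsum M y A"
    using assms(3) by (intro i.hom_finsum) auto
  have "finsum (M\<lparr>carrier := N\<rparr>) y A \<in> N"
    using assms(3) N.finsum_closed[of y A] by auto
  then show "finsum M y A \<in> N" using * by simp
qed

lemma (in abelian_group) additive_subgroup_vimage:
  assumes "\<And>i. i \<in> I \<Longrightarrow> abelian_group_hom G (N i) (h i)"
    and "\<And>i. i \<in> I \<Longrightarrow> additive_subgroup (L i) (N i)"
  shows "additive_subgroup {x \<in> carrier G. \<forall>i\<in>I. h i x \<in> L i} G"
proof (rule additive_subgroupI, rule add.subgroupI)
  have "h i \<zero> \<in> L i" if "i \<in> I" for i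
    using abelian_group_hom.hom_zero[OF assms(1)[OF that]]
      additive_subgroup.zero_closed[OF assms(2)[OF that]] by simp
  then show "{x \<in> carrier G. \<forall>i\<in>I. h i x \<in> L i} \<noteq> {}" by blast
  fix x assume x: "x \<in> {x \<in> carrier G. \<forall>i\<in>I. h i x \<in> L i}"
  have "h i (\<ominus> x) \<in> L i" if "i \<in> I" for i
  proof -
    interpret i: abelian_group_hom G "N i" "h i" using assms(1) that .
    interpret L: additive_subgroup "L i" "N i" using assms(2) that .
    show ?thesis using x that by simp
  qed
  then show "\<ominus> x \<in> {x \<in> carrier G. \<forall>i\<in>I. h i x \<in> L i}" using x by simp
  fix y assume y: "y \<in> {x \<in> carrier G. \<forall>i\<in>I. h i x \<in> L i}"
  have "h i (x \<oplus> y) \<in> L i" if "i \<in> I" for i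
  proof -
    interpret i: abelian_group_hom G "N i" "h i" using assms(1) that .
    interpret L: additive_subgroup "L i" "N i" using assms(2) that .
    show ?thesis using x y that by simp
  qed
  then show "x \<oplus> y \<in> {x \<in> carrier G. \<forall>i\<in>I. h i x \<in> L i}" using x y by simp
qed blast

lemma grades_le: "u \<in> grades r \<Longrightarrow> w \<le> u \<Longrightarrow> w \<in> grades r"
  unfolding grades_def le_fun_def by simp (metis le_zero_eq)

lemma grades_diff: "u \<in> grades r \<Longrightarrow> (\<lambda>i. u i - w i) \<in> grades r"
  by (simp add: grades_def)

lemma grades_diff_le: "(\<lambda>i. u i - w i) \<le> (u :: grade)"
  by (simp add: le_fun_def)

lemma finite_grades_le:
  assumes "u \<in> grades r"
  shows "finite {w. w \<le> u}"
proof (rule finite_subset)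
  let ?N = "\<Union>i<r. {..u i}"
  have "w i \<in> ?N" if "w \<le> u" "i < r" for w :: grade and i
    using that by (auto simp: le_fun_def)
  moreover have "w i = 0" if "w \<le> u" "\<not> i < r" for w i
    using grades_le[OF assms that(1)] that(2) by (simp add: grades_def)
  ultimately show "{w. w \<le> u} \<subseteq> {w. \<forall>i. (i \<in> {..<r} \<longrightarrow> w i \<in> ?N) \<and> (i \<notin> {..<r} \<longrightarrow> w i = 0)}"
    unfolding lessThan_iff by blast
  show "finite {w :: grade. \<forall>i. (i \<in> {..<r} \<longrightarrow> w i \<in> ?N) \<and> (i \<notin> {..<r} \<longrightarrow> w i = 0)}"
    by (rule finite_set_of_finite_funs) auto
qed

text \<open>A graded module is compared with a functor \<open>C\<close> one grade at a time. At every grade \<open>p\<close> is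
  onto and \<open>B \<subseteq> Z\<close> are submodules of its target, all compatible with the transition maps. By the
  isomorphism theorem the preimages of \<open>Z\<close> and \<open>B\<close> have quotient \<open>Z / B\<close> at each grade; what has
  to be shown is that this survives the passage to associated graded modules, where elements have
  finite support and polynomials act through the transition maps.\<close>

locale levelwise_surjection =
  fixes R :: "('b, 'c) ring_scheme" and r :: nat
    and M :: "('b, 'm) module_functor" and C :: "('b, 'n) module_functor"
    and p :: "grade \<Rightarrow> 'm \<Rightarrow> 'n" and Z B :: "grade \<Rightarrow> 'n set"
  assumes R: "cring R"
    and M_module: "\<And>v. v \<in> grades r \<Longrightarrow> module R (module_at M v)"
    and C_module: "\<And>v. v \<in> grades r \<Longrightarrow> module R (module_at C v)"
    and M_along: "\<And>u v. u \<in> grades r \<Longrightarrow> v \<in> grades r \<Longrightarrow> u \<le> v \<Longrightarrow>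
      abelian_group_hom (module_at M u) (module_at M v) (module_along M u v)"
    and C_along: "\<And>u v. u \<in> grades r \<Longrightarrow> v \<in> grades r \<Longrightarrow> u \<le> v \<Longrightarrow>
      abelian_group_hom (module_at C u) (module_at C v) (module_along C u v)"
    and p_linear: "\<And>v. v \<in> grades r \<Longrightarrow> linear_map R (module_at M v) (module_at C v) (p v)"
    and p_surj: "\<And>v. v \<in> grades r \<Longrightarrow> carrier (module_at C v) \<subseteq> p v ` carrier (module_at M v)"
    and p_natural: "\<And>u v x. u \<in> grades r \<Longrightarrow> v \<in> grades r \<Longrightarrow> u \<le> v \<Longrightarrow>
      x \<in> carrier (module_at M u) \<Longrightarrow> p v (module_along M u v x) = module_along C u v (p u x)"
    and Z_submodule: "\<And>v. v \<in> grades r \<Longrightarrow> submodule (Z v) R (module_at C v)"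
    and B_submodule: "\<And>v. v \<in> grades r \<Longrightarrow> submodule (B v) R (module_at C v)"
    and B_le_Z: "\<And>v. v \<in> grades r \<Longrightarrow> B v \<subseteq> Z v"
    and Z_along: "\<And>u v. u \<in> grades r \<Longrightarrow> v \<in> grades r \<Longrightarrow> u \<le> v \<Longrightarrow> module_along C u v ` Z u \<subseteq> Z v"
    and B_along: "\<And>u v. u \<in> grades r \<Longrightarrow> v \<in> grades r \<Longrightarrow> u \<le> v \<Longrightarrow> module_along C u v ` B u \<subseteq> B v"
begin

abbreviation "A \<equiv> associated_module R r M"

definition "ZA = {x \<in> carrier A. \<forall>v\<in>grades r. p v (x v) \<in> Z v}"

definition "BA = {x \<in> carrier A. \<forall>v\<in>grades r. p v (x v) \<in> B v}"

abbreviation "ZC v \<equiv> module_at C v\<lparr>carrier := Z v\<rparr>"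

definition "quotient_functor =
  \<lparr>module_at = (\<lambda>v. quotient_module (ZC v) (B v)),
   module_along = (\<lambda>v w K. \<Union>c\<in>K. B w +>\<^bsub>module_at C w\<^esub> module_along C v w c)\<rparr>"

definition "quotient_map K = (\<lambda>v\<in>grades r. \<Union>x\<in>K. B v +>\<^bsub>module_at C v\<^esub> p v (x v))"

lemma M_group: "v \<in> grades r \<Longrightarrow> abelian_group (module_at M v)"
  using M_module by (rule module.axioms(2))

lemma p_hom: "v \<in> grades r \<Longrightarrow> abelian_group_hom (module_at M v) (module_at C v) (p v)"
  using p_linear by (rule linear_map_hom)

lemma A_group: "abelian_group A"
  using M_group by (rule abelian_group_associated_module)

lemma p_eval_hom: "v \<in> grades r \<Longrightarrow> abelian_group_hom A (module_at C v) (\<lambda>x. p v (x v))"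
  using associated_module_eval_hom[OF M_group] p_hom by (rule abelian_group_hom_compose)

lemma B_subgroup: "v \<in> grades r \<Longrightarrow> abelian_subgroup (B v) (module_at C v)"
  using submodule.axioms(1)[OF B_submodule] module.axioms(2)[OF C_module]
  by (intro abelian_subgroupI3 additive_subgroupI)

lemma Z_subgroup: "v \<in> grades r \<Longrightarrow> additive_subgroup (Z v) (module_at C v)"
  using submodule.axioms(1)[OF Z_submodule] by (rule additive_subgroupI)

lemma B_subgroup_Z:
  assumes v: "v \<in> grades r"
  shows "abelian_subgroup (B v) (ZC v)"
proof (rule abelian_subgroupI3)
  interpret C: module R "module_at C v" using C_module v .
  show "additive_subgroup (B v) (ZC v)"
    using C.add.subgroup_incl[OF submodule.axioms(1)[OF B_submodule] submodule.axioms(1)[OF Z_submodule] B_le_Z]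
      v by (auto intro!: additive_subgroupI)
  show "abelian_group (ZC v)"
    using submodule.submodule_is_module[OF Z_submodule C_module] v by (auto intro: module.axioms(2))
qed

lemma BA_subgroup: "abelian_subgroup BA A"
  unfolding BA_def
  using A_group p_eval_hom abelian_subgroup.axioms(1)[OF B_subgroup]
  by (intro abelian_subgroupI3 abelian_group.additive_subgroup_vimage)

lemma Z_carrier: "v \<in> grades r \<Longrightarrow> z \<in> Z v \<Longrightarrow> z \<in> carrier (module_at C v)"
  using additive_subgroup.a_subset[OF Z_subgroup] by auto

lemma BA_le_ZA: "BA \<subseteq> ZA"
  using B_le_Z unfolding BA_def ZA_def by blast

lemma carrier_quotient:
  "carrier (quotient_module (A\<lparr>carrier := ZA\<rparr>) BA) = {BA +>\<^bsub>A\<^esub> x | x. x \<in> ZA}"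
  "carrier (module_at quotient_functor v) = {B v +>\<^bsub>module_at C v\<^esub> z | z. z \<in> Z v}"
  by (auto simp: quotient_module_def quotient_functor_def A_RCOSETS_def' a_r_coset_def')

text \<open>The point of defining \<^const>\<open>quotient_map\<close> by a union is that it needs no choice of
  representatives; on cosets it is induced by \<open>p\<close>.\<close>

lemma quotient_map_coset:
  assumes "x \<in> carrier A"
  shows "quotient_map (BA +>\<^bsub>A\<^esub> x) = (\<lambda>v\<in>grades r. B v +>\<^bsub>module_at C v\<^esub> p v (x v))"
  unfolding quotient_map_def
proof (rule restrict_ext)
  fix v assume v: "v \<in> grades r"
  show "(\<Union>x\<in>BA +>\<^bsub>A\<^esub> x. B v +>\<^bsub>module_at C v\<^esub> p v (x v)) = B v +>\<^bsub>module_at C v\<^esub> p v (x v)"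
    using v assms abelian_subgroup.axioms(1)[OF BA_subgroup] abelian_subgroup.axioms(1)[OF B_subgroup]
    by (intro abelian_group_hom.UN_coset_image[OF p_eval_hom]) (auto simp: BA_def)
qed

lemma zero_quotient: "\<zero>\<^bsub>module_at quotient_functor v\<^esub> = B v"
  by (simp add: quotient_functor_def quotient_module_def)

lemma quotient_map_closed:
  assumes "x \<in> ZA"
  shows "quotient_map (BA +>\<^bsub>A\<^esub> x) \<in> carrier (associated_module R r quotient_functor)"
proof -
  have x: "x \<in> carrier A" using assms by (simp add: ZA_def del: associated_module_simps)
  have "B v +>\<^bsub>module_at C v\<^esub> p v (x v) = B v"
    if "v \<in> grades r" "x v = \<zero>\<^bsub>module_at M v\<^esub>" for v
    unfolding that(2) abelian_group_hom.hom_zero[OF p_hom[OF that(1)]]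
    using B_subgroup[OF that(1)] additive_subgroup.zero_closed abelian_subgroup.axioms(1)
    by (intro abelian_subgroup.a_rcos_const) auto
  then have "{v \<in> grades r. quotient_map (BA +>\<^bsub>A\<^esub> x) v \<noteq> B v} \<subseteq>
      {v \<in> grades r. x v \<noteq> \<zero>\<^bsub>module_at M v\<^esub>}"
    unfolding quotient_map_coset[OF x] by auto
  then have "finite {v \<in> grades r. quotient_map (BA +>\<^bsub>A\<^esub> x) v \<noteq> B v}"
    by (rule finite_subset) (use x in auto)
  moreover have "quotient_map (BA +>\<^bsub>A\<^esub> x) v \<in> carrier (module_at quotient_functor v)"
    if "v \<in> grades r" for v
    unfolding quotient_map_coset[OF x] carrier_quotient using that assms by (auto simp: ZA_def)
  ultimately show ?thesis
    unfolding associated_module_simps direct_sum_simps zero_quotient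
    by (auto simp: quotient_map_def)
qed

text \<open>Lifting the coset \<open>B v\<close> by \<open>0\<close> keeps the lift finitely supported, and makes the lift of a
  homogeneous element homogeneous of the same grade.\<close>

lemma quotient_map_lift:
  assumes K: "K \<in> carrier (associated_module R r quotient_functor)"
  obtains x where "x \<in> ZA" "quotient_map (BA +>\<^bsub>A\<^esub> x) = K"
    "\<And>v. v \<in> grades r \<Longrightarrow> K v = B v \<Longrightarrow> x v = \<zero>\<^bsub>module_at M v\<^esub>"
proof -
  have "\<exists>y\<in>carrier (module_at M v). p v y \<in> Z v \<and> K v = B v +>\<^bsub>module_at C v\<^esub> p v y \<and>
      (K v = B v \<longrightarrow> y = \<zero>\<^bsub>module_at M v\<^esub>)" if v: "v \<in> grades r" for v
  proof (cases "K v = B v")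
    case True
    interpret p: abelian_group_hom "module_at M v" "module_at C v" "p v" using v by (rule p_hom)
    interpret B: abelian_subgroup "B v" "module_at C v" using v by (rule B_subgroup)
    show ?thesis using True B_le_Z[OF v] B.zero_closed
      by (intro bexI[of _ "\<zero>\<^bsub>module_at M v\<^esub>"]) (auto simp: B.a_rcos_const)
  next
    case False
    have "K v \<in> carrier (module_at quotient_functor v)" using K v by auto
    then obtain z where z: "z \<in> Z v" "K v = B v +>\<^bsub>module_at C v\<^esub> z"
      unfolding carrier_quotient by blast
    then obtain y where "y \<in> carrier (module_at M v)" "z = p v y"
      using p_surj[OF v] Z_carrier[OF v] by blast
    then show ?thesis using z False by blast
  qed
  then obtain y where y: "\<And>v. v \<in> grades r \<Longrightarrow> y v \<in> carrier (module_at M v)"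
    "\<And>v. v \<in> grades r \<Longrightarrow> p v (y v) \<in> Z v"
    "\<And>v. v \<in> grades r \<Longrightarrow> K v = B v +>\<^bsub>module_at C v\<^esub> p v (y v)"
    "\<And>v. v \<in> grades r \<Longrightarrow> K v = B v \<Longrightarrow> y v = \<zero>\<^bsub>module_at M v\<^esub>"
    by metis
  define x where "x = restrict y (grades r)"
  have "{v \<in> grades r. x v \<noteq> \<zero>\<^bsub>module_at M v\<^esub>} \<subseteq> {v \<in> grades r. K v \<noteq> B v}"
    using y(4) by (auto simp: x_def)
  then have "finite {v \<in> grades r. x v \<noteq> \<zero>\<^bsub>module_at M v\<^esub>}"
    by (rule finite_subset) (use K zero_quotient in auto)
  then have x: "x \<in> carrier A" using y(1) by (auto simp: x_def)
  have "x \<in> ZA" using x y(2) by (simp add: ZA_def x_def del: associated_module_simps)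
  moreover have "quotient_map (BA +>\<^bsub>A\<^esub> x) = K"
    unfolding quotient_map_coset[OF x] using K y(3)
    by (intro extensionalityI[of _ "grades r"]) (auto simp: x_def PiE_iff)
  ultimately show ?thesis using y(4) that by (simp add: x_def)
qed

lemma bij_betw_quotient_map:
  "bij_betw quotient_map (carrier (quotient_module (A\<lparr>carrier := ZA\<rparr>) BA))
    (carrier (associated_module R r quotient_functor))"
proof (rule bij_betwI')
  interpret BA: abelian_subgroup BA A by (rule BA_subgroup)
  fix K L assume "K \<in> carrier (quotient_module (A\<lparr>carrier := ZA\<rparr>) BA)"
    and "L \<in> carrier (quotient_module (A\<lparr>carrier := ZA\<rparr>) BA)"
  then obtain x y where x: "x \<in> ZA" "K = BA +>\<^bsub>A\<^esub> x" and y: "y \<in> ZA" "L = BA +>\<^bsub>A\<^esub> y"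
    unfolding carrier_quotient by blast
  have xy: "x \<in> carrier A" "y \<in> carrier A"
    using x y by (simp_all add: ZA_def del: associated_module_simps)
  have "K = L" if eq: "quotient_map K = quotient_map L"
  proof -
    have "p v ((x \<oplus>\<^bsub>A\<^esub> \<ominus>\<^bsub>A\<^esub> y) v) \<in> B v" if v: "v \<in> grades r" for v
    proof -
      interpret p: abelian_group_hom A "module_at C v" "\<lambda>x. p v (x v)" using v by (rule p_eval_hom)
      interpret B: abelian_subgroup "B v" "module_at C v" using v by (rule B_subgroup)
      have "B v +>\<^bsub>module_at C v\<^esub> p v (x v) = B v +>\<^bsub>module_at C v\<^esub> p v (y v)"
        using fun_cong[OF eq, of v] v unfolding x y quotient_map_coset[OF xy(1)] quotient_map_coset[OF xy(2)]
        by simp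
      then have "p v (x v) \<oplus>\<^bsub>module_at C v\<^esub> \<ominus>\<^bsub>module_at C v\<^esub> p v (y v) \<in> B v"
        using xy p.hom_closed B.a_rcos_module B.a_repr_independenceD by metis
      then show ?thesis
        using p.hom_add[OF xy(1) BA.a_inv_closed[OF xy(2)]] p.hom_a_inv[OF xy(2)] by simp
    qed
    moreover have "x \<oplus>\<^bsub>A\<^esub> \<ominus>\<^bsub>A\<^esub> y \<in> carrier A"
      by (intro BA.add.m_closed BA.add.inv_closed xy)
    ultimately have "x \<oplus>\<^bsub>A\<^esub> \<ominus>\<^bsub>A\<^esub> y \<in> BA" unfolding BA_def by blast
    then have "x \<in> BA +>\<^bsub>A\<^esub> y" using BA.a_rcos_module xy by blast
    then show ?thesis unfolding x y using BA.a_repr_independence' xy(2) by metis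
  qed
  then show "(quotient_map K = quotient_map L) = (K = L)" by blast
  show "quotient_map K \<in> carrier (associated_module R r quotient_functor)"
    unfolding x(2) using x(1) by (rule quotient_map_closed)
next
  fix K assume "K \<in> carrier (associated_module R r quotient_functor)"
  then obtain x where "x \<in> ZA" "quotient_map (BA +>\<^bsub>A\<^esub> x) = K" by (rule quotient_map_lift)
  then show "\<exists>L\<in>carrier (quotient_module (A\<lparr>carrier := ZA\<rparr>) BA). K = quotient_map L"
    unfolding carrier_quotient by blast
qed

lemma quotient_map_add:
  assumes "x \<in> ZA" "y \<in> ZA"
  shows "quotient_map ((BA +>\<^bsub>A\<^esub> x) \<oplus>\<^bsub>quotient_module (A\<lparr>carrier := ZA\<rparr>) BA\<^esub> (BA +>\<^bsub>A\<^esub> y)) =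
    quotient_map (BA +>\<^bsub>A\<^esub> x) \<oplus>\<^bsub>associated_module R r quotient_functor\<^esub> quotient_map (BA +>\<^bsub>A\<^esub> y)"
proof -
  interpret BA: abelian_subgroup BA A by (rule BA_subgroup)
  have xy: "x \<in> carrier A" "y \<in> carrier A"
    using assms by (simp_all add: ZA_def del: associated_module_simps)
  have xy': "x \<oplus>\<^bsub>A\<^esub> y \<in> carrier A" using xy by (rule BA.add.m_closed)
  have "(BA +>\<^bsub>A\<^esub> x) \<oplus>\<^bsub>quotient_module (A\<lparr>carrier := ZA\<rparr>) BA\<^esub> (BA +>\<^bsub>A\<^esub> y) =
      (BA +>\<^bsub>A\<^esub> x) <+>\<^bsub>A\<^esub> (BA +>\<^bsub>A\<^esub> y)"
    by (simp add: quotient_module_def set_add_def' a_r_coset_def')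
  also have "\<dots> = BA +>\<^bsub>A\<^esub> (x \<oplus>\<^bsub>A\<^esub> y)" using xy by (rule BA.a_rcos_sum)
  finally have sum: "(BA +>\<^bsub>A\<^esub> x) \<oplus>\<^bsub>quotient_module (A\<lparr>carrier := ZA\<rparr>) BA\<^esub> (BA +>\<^bsub>A\<^esub> y) =
    BA +>\<^bsub>A\<^esub> (x \<oplus>\<^bsub>A\<^esub> y)" .
  have "B v +>\<^bsub>module_at C v\<^esub> p v ((x \<oplus>\<^bsub>A\<^esub> y) v) =
      (B v +>\<^bsub>module_at C v\<^esub> p v (x v)) \<oplus>\<^bsub>module_at quotient_functor v\<^esub>
      (B v +>\<^bsub>module_at C v\<^esub> p v (y v))" if v: "v \<in> grades r" for v
  proof -
    interpret p: abelian_group_hom A "module_at C v" "\<lambda>x. p v (x v)" using v by (rule p_eval_hom)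
    interpret B: abelian_subgroup "B v" "module_at C v" using v by (rule B_subgroup)
    have "(B v +>\<^bsub>module_at C v\<^esub> p v (x v)) \<oplus>\<^bsub>module_at quotient_functor v\<^esub>
        (B v +>\<^bsub>module_at C v\<^esub> p v (y v)) =
        (B v +>\<^bsub>module_at C v\<^esub> p v (x v)) <+>\<^bsub>module_at C v\<^esub> (B v +>\<^bsub>module_at C v\<^esub> p v (y v))"
      by (simp add: quotient_functor_def quotient_module_def set_add_def' a_r_coset_def')
    also have "\<dots> = B v +>\<^bsub>module_at C v\<^esub> (p v (x v) \<oplus>\<^bsub>module_at C v\<^esub> p v (y v))"
      using p.hom_closed xy by (intro B.a_rcos_sum)
    also have "p v (x v) \<oplus>\<^bsub>module_at C v\<^esub> p v (y v) = p v ((x \<oplus>\<^bsub>A\<^esub> y) v)"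
      using p.hom_add[OF xy] by (rule sym)
    finally show ?thesis by (rule sym)
  qed
  then show ?thesis
    unfolding sum quotient_map_coset[OF xy'] quotient_map_coset[OF xy(1)] quotient_map_coset[OF xy(2)]
    unfolding associated_module_simps(3)[of R r quotient_functor] direct_sum_simps(3)[of _ "module_at quotient_functor"]
    by (intro restrict_ext) (simp del: associated_module_simps)
qed

text \<open>The component at grade \<open>u\<close> of \<open>a\<close> acting on the image of \<open>x\<close> under \<open>p\<close>. Both sides of the
  linearity of \<^const>\<open>quotient_map\<close> reduce to the coset of this element.\<close>

definition "poly_action a x u = (\<Oplus>\<^bsub>module_at C u\<^esub>w\<in>{w. w \<le> u}.
  a w \<odot>\<^bsub>module_at C u\<^esub> module_along C (\<lambda>i. u i - w i) u (p (\<lambda>i. u i - w i) (x (\<lambda>i. u i - w i))))"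

lemma action_term:
  assumes "a \<in> carrier (mpoly_ring R r)" "x \<in> carrier A" "u \<in> grades r" "w \<le> u"
  shows "a w \<in> carrier R" "x (\<lambda>i. u i - w i) \<in> carrier (module_at M (\<lambda>i. u i - w i))"
    "module_along M (\<lambda>i. u i - w i) u (x (\<lambda>i. u i - w i)) \<in> carrier (module_at M u)"
    "a w \<odot>\<^bsub>module_at M u\<^esub> module_along M (\<lambda>i. u i - w i) u (x (\<lambda>i. u i - w i)) \<in> carrier (module_at M u)"
proof -
  show 1: "a w \<in> carrier R" using assms grades_le[OF assms(3,4)] by (auto simp: mpoly_ring_def)
  show 2: "x (\<lambda>i. u i - w i) \<in> carrier (module_at M (\<lambda>i. u i - w i))"
    using assms(2) grades_diff[OF assms(3)] by auto
  show 3: "module_along M (\<lambda>i. u i - w i) u (x (\<lambda>i. u i - w i)) \<in> carrier (module_at M u)"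
    using abelian_group_hom.hom_closed[OF M_along 2] grades_diff[OF assms(3)] grades_diff_le assms(3)
    by blast
  show "a w \<odot>\<^bsub>module_at M u\<^esub> module_along M (\<lambda>i. u i - w i) u (x (\<lambda>i. u i - w i)) \<in> carrier (module_at M u)"
    using module.smult_closed[OF M_module[OF assms(3)] 1 3] .
qed

lemma p_smult:
  assumes "a \<in> carrier (mpoly_ring R r)" "x \<in> carrier A" "u \<in> grades r"
  shows "p u ((a \<odot>\<^bsub>A\<^esub> x) u) = poly_action a x u"
proof -
  interpret p: abelian_group_hom "module_at M u" "module_at C u" "p u" using assms(3) by (rule p_hom)
  interpret C: module R "module_at C u" using assms(3) by (rule C_module)
  note t = action_term[OF assms]
  have pt: "p u (a w \<odot>\<^bsub>module_at M u\<^esub> module_along M (\<lambda>i. u i - w i) u (x (\<lambda>i. u i - w i))) =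
      a w \<odot>\<^bsub>module_at C u\<^esub> module_along C (\<lambda>i. u i - w i) u (p (\<lambda>i. u i - w i) (x (\<lambda>i. u i - w i)))"
    if "w \<le> u" for w
    using linear_map_smult[OF p_linear[OF assms(3)] t(1,3)[OF that]]
      p_natural[OF grades_diff[OF assms(3)] assms(3) grades_diff_le t(2)[OF that]] by simp
  have "p u ((a \<odot>\<^bsub>A\<^esub> x) u) = (\<Oplus>\<^bsub>module_at C u\<^esub>w\<in>{w. w \<le> u}.
      p u (a w \<odot>\<^bsub>module_at M u\<^esub> module_along M (\<lambda>i. u i - w i) u (x (\<lambda>i. u i - w i))))"
    using assms(3) t(4) by (auto intro!: p.hom_finsum)
  also have "\<dots> = poly_action a x u"
    unfolding poly_action_def using pt p.hom_closed[OF t(4)] by (intro p.H.finsum_cong') auto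
  finally show ?thesis .
qed

lemma poly_action_mem:
  assumes "a \<in> carrier (mpoly_ring R r)" "x \<in> carrier A" "u \<in> grades r"
    and S: "\<And>v. v \<in> grades r \<Longrightarrow> submodule (S v) R (module_at C v)"
    and S_along: "\<And>u v. u \<in> grades r \<Longrightarrow> v \<in> grades r \<Longrightarrow> u \<le> v \<Longrightarrow> module_along C u v ` S u \<subseteq> S v"
    and x: "\<And>v. v \<in> grades r \<Longrightarrow> p v (x v) \<in> S v"
  shows "poly_action a x u \<in> S u"
  unfolding poly_action_def
proof (rule submodule_finsum(2)[OF C_module[OF assms(3)] S[OF assms(3)]], rule funcsetI)
  fix w assume w: "w \<in> {w. w \<le> u}"
  have "module_along C (\<lambda>i. u i - w i) u (p (\<lambda>i. u i - w i) (x (\<lambda>i. u i - w i))) \<in> S u"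
    using x[OF grades_diff[OF assms(3)]] S_along[OF grades_diff[OF assms(3)] assms(3) grades_diff_le]
    by blast
  then show "a w \<odot>\<^bsub>module_at C u\<^esub> module_along C (\<lambda>i. u i - w i) u (p (\<lambda>i. u i - w i) (x (\<lambda>i. u i - w i))) \<in> S u"
    using submodule.smult_closed[OF S[OF assms(3)] action_term(1)[OF assms(1-3)]] w by blast
qed

text \<open>The product of a polynomial and an element has finite support because a nonzero term at grade
  \<open>u\<close> exhibits \<open>u\<close> as the sum of an exponent of \<open>a\<close> and a grade in the support of \<open>x\<close>.\<close>

lemma smult_hom:
  assumes a: "a \<in> carrier (mpoly_ring R r)"
  shows "abelian_group_hom A A (\<lambda>x. a \<odot>\<^bsub>A\<^esub> x)"
  unfolding abelian_group_hom_iff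
proof (intro conjI A_group funcsetI ballI)
  fix x assume x: "x \<in> carrier A"
  note t = action_term[OF a x]
  have "{u \<in> grades r. (a \<odot>\<^bsub>A\<^esub> x) u \<noteq> \<zero>\<^bsub>module_at M u\<^esub>} \<subseteq>
      (\<lambda>(w, v). \<lambda>i. w i + v i) ` ({w \<in> grades r. a w \<noteq> \<zero>\<^bsub>R\<^esub>} \<times> {v \<in> grades r. x v \<noteq> \<zero>\<^bsub>module_at M v\<^esub>})"
  proof safe
    fix u assume u: "u \<in> grades r" "(a \<odot>\<^bsub>A\<^esub> x) u \<noteq> \<zero>\<^bsub>module_at M u\<^esub>"
    interpret M: module R "module_at M u" using u(1) by (rule M_module)
    have "\<exists>w\<le>u. a w \<odot>\<^bsub>module_at M u\<^esub> module_along M (\<lambda>i. u i - w i) u (x (\<lambda>i. u i - w i)) \<noteq> \<zero>\<^bsub>module_at M u\<^esub>"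
      using u by (auto intro!: M.M.add.finprod_one_eqI)
    then obtain w where w: "w \<le> u"
      "a w \<odot>\<^bsub>module_at M u\<^esub> module_along M (\<lambda>i. u i - w i) u (x (\<lambda>i. u i - w i)) \<noteq> \<zero>\<^bsub>module_at M u\<^esub>" by blast
    let ?v = "\<lambda>i. u i - w i"
    have v: "?v \<in> grades r" using u(1) by (rule grades_diff)
    interpret al: abelian_group_hom "module_at M ?v" "module_at M u" "module_along M ?v u"
      using M_along[OF v u(1) grades_diff_le] .
    have "a w \<noteq> \<zero>\<^bsub>R\<^esub>" using w(2) t(3)[OF u(1) w(1)] by auto
    moreover have "x ?v \<noteq> \<zero>\<^bsub>module_at M ?v\<^esub>" using w(2) t(1)[OF u(1) w(1)] by auto
    moreover have "u = (\<lambda>i. w i + ?v i)" using w(1) by (auto simp: le_fun_def)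
    ultimately show "u \<in> (\<lambda>(w, v). \<lambda>i. w i + v i) ` ({w \<in> grades r. a w \<noteq> \<zero>\<^bsub>R\<^esub>} \<times> {v \<in> grades r. x v \<noteq> \<zero>\<^bsub>module_at M v\<^esub>})"
      using grades_le[OF u(1) w(1)] v by (intro image_eqI[of _ _ "(w, ?v)"]) auto
  qed
  then have "finite {u \<in> grades r. (a \<odot>\<^bsub>A\<^esub> x) u \<noteq> \<zero>\<^bsub>module_at M u\<^esub>}"
    by (rule finite_subset) (use a x in \<open>auto simp: mpoly_ring_def\<close>)
  moreover have "(a \<odot>\<^bsub>A\<^esub> x) u \<in> carrier (module_at M u)" if "u \<in> grades r" for u
    using abelian_group.axioms(1)[OF M_group[OF that]] t(4)[OF that] that
    by (auto intro!: abelian_monoid.finsum_closed)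
  ultimately show "a \<odot>\<^bsub>A\<^esub> x \<in> carrier A" by (simp add: PiE_iff)
next
  fix x y assume x: "x \<in> carrier A" and y: "y \<in> carrier A"
  note tx = action_term[OF a x] and ty = action_term[OF a y]
  show "a \<odot>\<^bsub>A\<^esub> (x \<oplus>\<^bsub>A\<^esub> y) = a \<odot>\<^bsub>A\<^esub> x \<oplus>\<^bsub>A\<^esub> a \<odot>\<^bsub>A\<^esub> y"
  proof (rule extensionalityI[of _ "grades r"])
    fix u assume u: "u \<in> grades r"
    interpret M: module R "module_at M u" using u by (rule M_module)
    let ?t = "\<lambda>x w. a w \<odot>\<^bsub>module_at M u\<^esub> module_along M (\<lambda>i. u i - w i) u (x (\<lambda>i. u i - w i))"
    have t: "?t (x \<oplus>\<^bsub>A\<^esub> y) w = ?t x w \<oplus>\<^bsub>module_at M u\<^esub> ?t y w" if w: "w \<le> u" for w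
    proof -
      let ?v = "\<lambda>i. u i - w i"
      have v: "?v \<in> grades r" using u by (rule grades_diff)
      interpret al: abelian_group_hom "module_at M ?v" "module_at M u" "module_along M ?v u"
        using M_along[OF v u grades_diff_le] .
      have "(x \<oplus>\<^bsub>A\<^esub> y) ?v = x ?v \<oplus>\<^bsub>module_at M ?v\<^esub> y ?v" using v by simp
      then show ?thesis
        using al.hom_add[OF tx(2)[OF u w] ty(2)[OF u w]]
          M.smult_r_distr[OF tx(1,3)[OF u w] ty(3)[OF u w]] by simp
    qed
    have "(\<Oplus>\<^bsub>module_at M u\<^esub>w\<in>{w. w \<le> u}. ?t (x \<oplus>\<^bsub>A\<^esub> y) w) =
        (\<Oplus>\<^bsub>module_at M u\<^esub>w\<in>{w. w \<le> u}. ?t x w \<oplus>\<^bsub>module_at M u\<^esub> ?t y w)"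
      using t tx(4)[OF u] ty(4)[OF u] by (intro M.M.finsum_cong') auto
    also have "\<dots> = (\<Oplus>\<^bsub>module_at M u\<^esub>w\<in>{w. w \<le> u}. ?t x w) \<oplus>\<^bsub>module_at M u\<^esub>
        (\<Oplus>\<^bsub>module_at M u\<^esub>w\<in>{w. w \<le> u}. ?t y w)"
      using tx(4)[OF u] ty(4)[OF u] by (intro M.M.finsum_addf) auto
    finally show "(a \<odot>\<^bsub>A\<^esub> (x \<oplus>\<^bsub>A\<^esub> y)) u = (a \<odot>\<^bsub>A\<^esub> x \<oplus>\<^bsub>A\<^esub> a \<odot>\<^bsub>A\<^esub> y) u"
      using u by (simp only: associated_module_simps direct_sum_simps restrict_apply if_True)
  qed simp_all
qed

lemma smult_BA:
  assumes "a \<in> carrier (mpoly_ring R r)" "x \<in> BA"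
  shows "a \<odot>\<^bsub>A\<^esub> x \<in> BA"
proof -
  have x: "x \<in> carrier A" "\<And>v. v \<in> grades r \<Longrightarrow> p v (x v) \<in> B v"
    using assms(2) by (simp_all add: BA_def del: associated_module_simps)
  have "p u ((a \<odot>\<^bsub>A\<^esub> x) u) \<in> B u" if "u \<in> grades r" for u
    unfolding p_smult[OF assms(1) x(1) that]
    using assms(1) x(1) that B_submodule B_along x(2) by (rule poly_action_mem)
  then show ?thesis
    unfolding BA_def using abelian_group_hom.hom_closed[OF smult_hom[OF assms(1)] x(1)] by blast
qed

text \<open>In the quotient functor the transition maps and the scalars act on representatives, and taking
  cosets is additive, so the whole sum may be computed in \<open>C u\<close> before passing to the coset.\<close>

lemma quotient_functor_action:
  assumes a: "a \<in> carrier (mpoly_ring R r)" and x: "x \<in> ZA" and u: "u \<in> grades r"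
  shows "(a \<odot>\<^bsub>associated_module R r quotient_functor\<^esub> quotient_map (BA +>\<^bsub>A\<^esub> x)) u =
    B u +>\<^bsub>module_at C u\<^esub> poly_action a x u"
proof -
  have xA: "x \<in> carrier A" and xZ: "\<And>v. v \<in> grades r \<Longrightarrow> p v (x v) \<in> Z v"
    using x by (simp_all add: ZA_def del: associated_module_simps)
  interpret C: module R "module_at C u" using u by (rule C_module)
  note Bu = abelian_subgroup.axioms(1)[OF B_subgroup]
  interpret q: abelian_group_hom "ZC u" "quotient_module (ZC u) (B u)" "\<lambda>x. B u +>\<^bsub>ZC u\<^esub> x"
    using B_subgroup_Z[OF u] by (rule quotient_module_hom)
  let ?z = "\<lambda>w. module_along C (\<lambda>i. u i - w i) u (p (\<lambda>i. u i - w i) (x (\<lambda>i. u i - w i)))"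
  have zZ: "?z w \<in> Z u" for w
    using Z_along[OF grades_diff[OF u] u grades_diff_le] xZ[OF grades_diff[OF u]] by blast
  have azZ: "a w \<odot>\<^bsub>module_at C u\<^esub> ?z w \<in> Z u" if "w \<le> u" for w
    using submodule.smult_closed[OF Z_submodule[OF u] action_term(1)[OF a xA u that] zZ] .
  have along: "module_along quotient_functor (\<lambda>i. u i - w i) u (quotient_map (BA +>\<^bsub>A\<^esub> x) (\<lambda>i. u i - w i)) =
      B u +>\<^bsub>module_at C u\<^esub> ?z w" for w
  proof -
    let ?v = "\<lambda>i. u i - w i"
    have v: "?v \<in> grades r" using u by (rule grades_diff)
    have "quotient_map (BA +>\<^bsub>A\<^esub> x) ?v = B ?v +>\<^bsub>module_at C ?v\<^esub> p ?v (x ?v)"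
      unfolding quotient_map_coset[OF xA] using v by simp
    then show ?thesis
      using abelian_group_hom.UN_coset_image[OF C_along[OF v u grades_diff_le] Bu[OF v] Bu[OF u]
          B_along[OF v u grades_diff_le] Z_carrier[OF v xZ[OF v]]]
      by (simp add: quotient_functor_def)
  qed
  have smult: "a w \<odot>\<^bsub>module_at quotient_functor u\<^esub> (B u +>\<^bsub>module_at C u\<^esub> ?z w) =
      B u +>\<^bsub>module_at C u\<^esub> (a w \<odot>\<^bsub>module_at C u\<^esub> ?z w)" if w: "w \<le> u" for w
  proof -
    have aw: "a w \<in> carrier R" using action_term(1)[OF a xA u w] .
    interpret s: abelian_group_hom "module_at C u" "module_at C u" "\<lambda>z. a w \<odot>\<^bsub>module_at C u\<^esub> z"
      unfolding abelian_group_hom_iff using aw C.smult_r_distr C.abelian_group_axioms by auto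
    have "(\<lambda>z. a w \<odot>\<^bsub>module_at C u\<^esub> z) ` B u \<subseteq> B u"
      using submodule.smult_closed[OF B_submodule[OF u] aw] by blast
    then show ?thesis
      using s.UN_coset_image[OF Bu[OF u] Bu[OF u]] Z_carrier[OF u zZ]
      by (simp add: quotient_functor_def quotient_module_def)
  qed
  have "(a \<odot>\<^bsub>associated_module R r quotient_functor\<^esub> quotient_map (BA +>\<^bsub>A\<^esub> x)) u =
      (\<Oplus>\<^bsub>module_at quotient_functor u\<^esub>w\<in>{w. w \<le> u}. a w \<odot>\<^bsub>module_at quotient_functor u\<^esub>
        (B u +>\<^bsub>module_at C u\<^esub> ?z w))"
    by (simp only: associated_module_simps restrict_apply u if_True along)
  also have "\<dots> = (\<Oplus>\<^bsub>module_at quotient_functor u\<^esub>w\<in>{w. w \<le> u}.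
      B u +>\<^bsub>module_at C u\<^esub> (a w \<odot>\<^bsub>module_at C u\<^esub> ?z w))"
  proof -
    have "abelian_monoid (module_at quotient_functor u)"
      using q.H.abelian_monoid_axioms by (simp add: quotient_functor_def)
    then show ?thesis
      using smult azZ unfolding carrier_quotient
      by (intro abelian_monoid.finsum_cong') (auto simp: carrier_quotient)
  qed
  also have "\<dots> = B u +>\<^bsub>module_at C u\<^esub> finsum (ZC u) (\<lambda>w. a w \<odot>\<^bsub>module_at C u\<^esub> ?z w) {w. w \<le> u}"
    using q.hom_finsum[of "\<lambda>w. a w \<odot>\<^bsub>module_at C u\<^esub> ?z w" "{w. w \<le> u}"] azZ
    by (simp add: quotient_functor_def Pi_iff)
  also have "finsum (ZC u) (\<lambda>w. a w \<odot>\<^bsub>module_at C u\<^esub> ?z w) {w. w \<le> u} = poly_action a x u"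
    unfolding poly_action_def using azZ
    by (intro submodule_finsum(1)[OF C_module[OF u] Z_submodule[OF u]]) auto
  finally show ?thesis .
qed

lemma quotient_map_smult:
  assumes a: "a \<in> carrier (mpoly_ring R r)" and x: "x \<in> ZA"
  shows "quotient_map (a \<odot>\<^bsub>quotient_module (A\<lparr>carrier := ZA\<rparr>) BA\<^esub> (BA +>\<^bsub>A\<^esub> x)) =
    a \<odot>\<^bsub>associated_module R r quotient_functor\<^esub> quotient_map (BA +>\<^bsub>A\<^esub> x)"
proof -
  have xA: "x \<in> carrier A" using x by (simp add: ZA_def del: associated_module_simps)
  note BA = abelian_subgroup.axioms(1)[OF BA_subgroup]
  interpret s: abelian_group_hom A A "\<lambda>x. a \<odot>\<^bsub>A\<^esub> x" using a by (rule smult_hom)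
  have "a \<odot>\<^bsub>quotient_module (A\<lparr>carrier := ZA\<rparr>) BA\<^esub> (BA +>\<^bsub>A\<^esub> x) =
      (\<Union>x\<in>BA +>\<^bsub>A\<^esub> x. BA +>\<^bsub>A\<^esub> (a \<odot>\<^bsub>A\<^esub> x))"
    by (simp add: quotient_module_def del: associated_module_simps)
  also have "\<dots> = BA +>\<^bsub>A\<^esub> (a \<odot>\<^bsub>A\<^esub> x)"
    using smult_BA[OF a] by (intro s.UN_coset_image BA xA) blast
  finally have *: "a \<odot>\<^bsub>quotient_module (A\<lparr>carrier := ZA\<rparr>) BA\<^esub> (BA +>\<^bsub>A\<^esub> x) = BA +>\<^bsub>A\<^esub> (a \<odot>\<^bsub>A\<^esub> x)" .
  have cl: "a \<odot>\<^bsub>A\<^esub> x \<in> carrier A" using xA by (rule s.hom_closed)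
  show ?thesis
  proof (rule extensionalityI[of _ "grades r"])
    fix u assume u: "u \<in> grades r"
    show "quotient_map (a \<odot>\<^bsub>quotient_module (A\<lparr>carrier := ZA\<rparr>) BA\<^esub> (BA +>\<^bsub>A\<^esub> x)) u =
        (a \<odot>\<^bsub>associated_module R r quotient_functor\<^esub> quotient_map (BA +>\<^bsub>A\<^esub> x)) u"
      unfolding quotient_functor_action[OF a x u] * quotient_map_coset[OF cl]
      using u p_smult[OF a xA u] by (simp del: associated_module_simps)
  qed (simp_all add: quotient_map_def)
qed

lemma quotient_map_component:
  assumes v: "v \<in> grades r"
  shows "quotient_map ` ((\<lambda>z. BA +>\<^bsub>A\<^esub> z) ` (ZA \<inter> component A v)) =
    component (associated_module R r quotient_functor) v"
proof (intro equalityI subsetI)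
  fix K assume "K \<in> quotient_map ` ((\<lambda>z. BA +>\<^bsub>A\<^esub> z) ` (ZA \<inter> component A v))"
  then obtain x where x: "x \<in> ZA" "x \<in> component A v" "K = quotient_map (BA +>\<^bsub>A\<^esub> x)" by blast
  have "K u = \<zero>\<^bsub>module_at quotient_functor u\<^esub>" if u: "u \<in> grades r" "u \<noteq> v" for u
  proof -
    interpret p: abelian_group_hom "module_at M u" "module_at C u" "p u" using u(1) by (rule p_hom)
    interpret B: abelian_subgroup "B u" "module_at C u" using u(1) by (rule B_subgroup)
    have "x u = \<zero>\<^bsub>module_at M u\<^esub>" using x(2) u by simp
    moreover have "x \<in> carrier A" using x(1) by (simp add: ZA_def del: associated_module_simps)
    ultimately show ?thesis
      unfolding x(3) zero_quotient using u by (simp add: quotient_map_coset B.a_rcos_const del: associated_module_simps)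
  qed
  then show "K \<in> component (associated_module R r quotient_functor) v"
    using quotient_map_closed[OF x(1)] x(3) by (simp del: direct_sum_simps)
next
  fix K assume K: "K \<in> component (associated_module R r quotient_functor) v"
  then have "K \<in> carrier (associated_module R r quotient_functor)" by simp
  then obtain x where x: "x \<in> ZA" "quotient_map (BA +>\<^bsub>A\<^esub> x) = K"
    "\<And>u. u \<in> grades r \<Longrightarrow> K u = B u \<Longrightarrow> x u = \<zero>\<^bsub>module_at M u\<^esub>" by (rule quotient_map_lift) blast
  then have "x \<in> component A v" using K by (auto simp: ZA_def zero_quotient simp del: direct_sum_simps)
  then show "K \<in> quotient_map ` ((\<lambda>z. BA +>\<^bsub>A\<^esub> z) ` (ZA \<inter> component A v))"
    using x by blast
qed

theorem graded_isomorphism_quotient_map: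
  "graded_isomorphism (mpoly_ring R r) r
    (module.extend (quotient_module (A\<lparr>carrier := ZA\<rparr>) BA)
      \<lparr>component = (\<lambda>v. (\<lambda>z. BA +>\<^bsub>A\<^esub> z) ` (ZA \<inter> component A v))\<rparr>)
    (associated_module R r quotient_functor) quotient_map"
proof -
  let ?Q = "quotient_module (A\<lparr>carrier := ZA\<rparr>) BA"
  have [simp]: "carrier (module.extend M' c) = carrier M'" "add (module.extend M' c) = add M'"
    "smult (module.extend M' c) = smult M'" for M' :: "(grade \<Rightarrow> 'b, (grade \<Rightarrow> 'm) set) module"
      and c :: "'x"
    by (simp_all add: module.defs)
  have [simp]: "component (module.extend M' \<lparr>component = c\<rparr>) = c"
    for M' :: "(grade \<Rightarrow> 'b, (grade \<Rightarrow> 'm) set) module" and c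
    by (simp add: module.defs)
  show ?thesis
    unfolding graded_isomorphism_def
  proof (intro conjI ballI)
    fix K L assume "K \<in> carrier (module.extend ?Q \<lparr>component = (\<lambda>v. (\<lambda>z. BA +>\<^bsub>A\<^esub> z) ` (ZA \<inter> component A v))\<rparr>)"
      "L \<in> carrier (module.extend ?Q \<lparr>component = (\<lambda>v. (\<lambda>z. BA +>\<^bsub>A\<^esub> z) ` (ZA \<inter> component A v))\<rparr>)"
    then show "quotient_map (K \<oplus>\<^bsub>module.extend ?Q \<lparr>component = (\<lambda>v. (\<lambda>z. BA +>\<^bsub>A\<^esub> z) ` (ZA \<inter> component A v))\<rparr>\<^esub> L) =
        quotient_map K \<oplus>\<^bsub>associated_module R r quotient_functor\<^esub> quotient_map L"
      using quotient_map_add by (auto simp: carrier_quotient simp del: associated_module_simps)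
  next
    fix a K assume "a \<in> carrier (mpoly_ring R r)"
      "K \<in> carrier (module.extend ?Q \<lparr>component = (\<lambda>v. (\<lambda>z. BA +>\<^bsub>A\<^esub> z) ` (ZA \<inter> component A v))\<rparr>)"
    then show "quotient_map (a \<odot>\<^bsub>module.extend ?Q \<lparr>component = (\<lambda>v. (\<lambda>z. BA +>\<^bsub>A\<^esub> z) ` (ZA \<inter> component A v))\<rparr>\<^esub> K) =
        a \<odot>\<^bsub>associated_module R r quotient_functor\<^esub> quotient_map K"
      using quotient_map_smult by (auto simp: carrier_quotient simp del: associated_module_simps)
  qed (use bij_betw_quotient_map quotient_map_component in \<open>simp_all del: associated_module_simps\<close>)
qed

end


section \<open>Simplices of a multifiltration and of its colimit\<close>

text \<open>The lexicographic order is not total on all functions, but two grades differ at finitely many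
  places only; hence a finite nonempty set of grades has a least element.\<close>

lemma lex_least_mem:
  assumes "finite A" "A \<noteq> {}" "A \<subseteq> grades r"
  shows "lex_least A \<in> A"
proof -
  have tri: "less_fun u w \<or> u = w \<or> less_fun w u" if "u \<in> grades r" "w \<in> grades r" for u w
  proof (rule less_fun_trichotomy, rule finite_subset)
    show "{k. u k \<noteq> w k} \<subseteq> {..<r}" using that by (force simp: grades_def not_less[symmetric])
  qed simp
  have "\<exists>w\<in>A. \<forall>u\<in>A. u \<noteq> w \<longrightarrow> less_fun w u"
    using assms
  proof (induction A rule: finite_ne_induct)
    case (insert x A)
    then obtain w where w: "w \<in> A" "\<forall>u\<in>A. u \<noteq> w \<longrightarrow> less_fun w u" by blast
    then consider "less_fun x w" | "x = w" | "less_fun w x" using tri insert.prems by blast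
    then show ?case
    proof cases
      case 1
      then have "\<forall>u\<in>insert x A. u \<noteq> x \<longrightarrow> less_fun x u"
        using w(2) by (metis insert_iff less_fun_trans)
      then show ?thesis by blast
    qed (use w in blast)+
  qed simp
  then obtain w where w: "w \<in> A" "\<forall>u\<in>A. u \<noteq> w \<longrightarrow> less_fun w u" by blast
  have "x = w" if x: "x \<in> A" "\<forall>u\<in>A. u \<noteq> x \<longrightarrow> less_fun x u" for x
    using less_fun_asym[of x w] w x by metis
  then have "lex_least A = w" unfolding lex_least_def
    using w by (intro the_equality conjI) blast+
  then show ?thesis using w(1) by simp
qed

lemma length_face: "i < length ys \<Longrightarrow> length (face i ys) = length ys - 1"
  by (simp add: face_def)

lemma set_face: "set (face i ys) \<subseteq> set ys"
  unfolding face_def by (auto dest: in_set_takeD in_set_dropD)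

lemma map_face: "map f (face i ys) = face i (map f ys)"
  by (simp add: face_def take_map drop_map)

lemma face_face:
  assumes "j < i" "i < length ys"
  shows "face j (face i ys) = face (i - 1) (face j ys)"
proof -
  have nth: "face k zs ! m = (if m < k then zs ! m else zs ! Suc m)"
    if "k < length zs" "m < length zs - 1" for k m and zs :: "'a list"
    using that by (auto simp: face_def nth_append min_def)
  show ?thesis
    using assms by (intro nth_equalityI) (auto simp: length_face nth)
qed

lemma sorted_wrt_face:
  assumes "sorted_wrt Q ys"
  shows "sorted_wrt Q (face i ys)"
proof -
  have "sorted_wrt Q (take i ys @ drop i ys)" using assms by simp
  then have "sorted_wrt Q (take i ys)" "\<forall>x\<in>set (take i ys). \<forall>y\<in>set (drop i ys). Q x y"
    unfolding sorted_wrt_append by blast+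
  moreover have "set (drop (Suc i) ys) \<subseteq> set (drop i ys)"
    by (rule set_drop_subset_set_drop) simp
  moreover have "sorted_wrt Q (drop (Suc i) ys)" using assms by (rule sorted_wrt_drop)
  ultimately show ?thesis unfolding face_def sorted_wrt_append by blast
qed

lemma face_ordered_simplex:
  assumes "ys \<in> ordered_simplices Y ord (Suc n)" "i \<le> Suc n"
    and "\<And>s t. s \<in> simplices Y \<Longrightarrow> t \<subseteq> s \<Longrightarrow> t \<in> simplices Y"
  shows "face i ys \<in> ordered_simplices Y ord n"
  using assms set_face[of i ys] by (auto simp: ordered_simplices_def length_face sorted_wrt_face)

locale multifiltered_complex =
  fixes r :: nat and F :: "'a space_functor" and ord :: "'a germ rel"
  assumes F: "multifiltration r F"
begin

abbreviation "V v \<equiv> vertices (space_at F v)"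

abbreviation "germ \<equiv> to_colimit r F"

abbreviation "S n v \<equiv> set_at (simplex_functor r F ord n) v"

abbreviation "X n \<equiv> colimit_simplices r F ord n"

text \<open>The minimal elements of this set form \<open>gen r F \<sigma>\<close>.\<close>

definition "births \<sigma> = {v \<in> grades r. set \<sigma> \<in> (\<lambda>s. germ v ` s) ` simplices (space_at F v)}"

text \<open>The simplex of \<open>F v\<close> with the germs \<open>\<sigma>\<close>, meaningful when \<open>v \<in> births \<sigma>\<close>.\<close>

definition "realize v \<sigma> = map (inv_into (V v) (germ v)) \<sigma>"

lemma S_eq: "S n v = ordered_simplices (space_at F v) (induced_order r F ord v) n"
  by (simp add: simplex_functor_def)

lemma complex:
  assumes "v \<in> grades r" "s \<in> simplices (space_at F v)"
  shows "s \<subseteq> V v" "t \<subseteq> s \<Longrightarrow> t \<in> simplices (space_at F v)"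
  using F assms by (auto simp: multifiltration_def simplicial_complex_def)

lemma along:
  assumes "u \<in> grades r" "v \<in> grades r" "u \<le> v"
  shows "x \<in> V u \<Longrightarrow> space_along F u v x \<in> V v"
    "s \<in> simplices (space_at F u) \<Longrightarrow> space_along F u v ` s \<in> simplices (space_at F v)"
    "inj_on (space_along F u v) (V u)"
    "w \<in> grades r \<Longrightarrow> v \<le> w \<Longrightarrow> x \<in> V u \<Longrightarrow>
      space_along F v w (space_along F u v x) = space_along F u w x"
proof -
  have "simplicial_map (space_at F u) (space_at F v) (space_along F u v)"
    "inj_on (space_along F u v) (V u)"
    using F assms unfolding multifiltration_def by blast+
  then show "x \<in> V u \<Longrightarrow> space_along F u v x \<in> V v"
    "s \<in> simplices (space_at F u) \<Longrightarrow> space_along F u v ` s \<in> simplices (space_at F v)"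
    "inj_on (space_along F u v) (V u)"
    unfolding simplicial_map_def by blast+
  show "w \<in> grades r \<Longrightarrow> v \<le> w \<Longrightarrow> x \<in> V u \<Longrightarrow>
      space_along F v w (space_along F u v x) = space_along F u w x"
    using F assms unfolding multifiltration_def by blast
qed

lemma sup_grades: "u \<in> grades r \<Longrightarrow> v \<in> grades r \<Longrightarrow> sup u v \<in> grades r"
  by (simp add: grades_def)

text \<open>A witness \<open>t\<close> for equality of germs seen from \<open>u\<close> need not lie above \<open>v\<close>; replacing it by the
  join of \<open>t\<close> and \<open>v\<close> gives one that serves both sides.\<close>

lemma germ_along:
  assumes "u \<in> grades r" "v \<in> grades r" "u \<le> v" "x \<in> V u"
  shows "germ v (space_along F u v x) = germ u x"
proof -
  have "(\<exists>t\<in>grades r. v \<le> t \<and> w \<le> t \<and> space_along F v t (space_along F u v x) = space_along F w t y) \<longleftrightarrow>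
      (\<exists>t\<in>grades r. u \<le> t \<and> w \<le> t \<and> space_along F u t x = space_along F w t y)"
    if w: "w \<in> grades r" "y \<in> V w" for w y
  proof
    assume "\<exists>t\<in>grades r. v \<le> t \<and> w \<le> t \<and> space_along F v t (space_along F u v x) = space_along F w t y"
    then obtain t where t: "t \<in> grades r" "v \<le> t" "w \<le> t"
      "space_along F v t (space_along F u v x) = space_along F w t y" by blast
    have "space_along F u t x = space_along F w t y"
      by (rule trans[OF along(4)[OF assms(1-3) t(1,2) assms(4), symmetric] t(4)])
    then show "\<exists>t\<in>grades r. u \<le> t \<and> w \<le> t \<and> space_along F u t x = space_along F w t y"
      using t(1,3) order_trans[OF assms(3) t(2)] by blast
  next
    assume "\<exists>t\<in>grades r. u \<le> t \<and> w \<le> t \<and> space_along F u t x = space_along F w t y"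
    then obtain t where t: "t \<in> grades r" "u \<le> t" "w \<le> t"
      "space_along F u t x = space_along F w t y" by blast
    let ?t = "sup t v"
    have tt: "?t \<in> grades r" "t \<le> ?t" "v \<le> ?t" "w \<le> ?t"
      using sup_grades[OF t(1) assms(2)] le_supI1[OF t(3)] by simp_all
    have "space_along F v ?t (space_along F u v x) = space_along F u ?t x"
      using along(4)[OF assms(1-3) tt(1,3) assms(4)] .
    also have "\<dots> = space_along F t ?t (space_along F u t x)"
      by (rule along(4)[OF assms(1) t(1,2) tt(1,2) assms(4), symmetric])
    also have "\<dots> = space_along F w ?t y"
      unfolding t(4) using along(4)[OF w(1) t(1,3) tt(1,2) w(2)] .
    finally show "\<exists>t\<in>grades r. v \<le> t \<and> w \<le> t \<and> space_along F v t (space_along F u v x) = space_along F w t y"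
      using tt by blast
  qed
  then show ?thesis unfolding to_colimit_def by auto
qed

lemma inj_on_germ:
  assumes "v \<in> grades r"
  shows "inj_on (germ v) (V v)"
proof (rule inj_onI)
  fix x y assume x: "x \<in> V v" and y: "y \<in> V v" and eq: "germ v x = germ v y"
  have "(v, x) \<in> germ v x" using x assms by (auto simp: to_colimit_def)
  then have "(v, x) \<in> germ v y" using eq by simp
  then obtain u where u: "u \<in> grades r" "v \<le> u" "space_along F v u y = space_along F v u x"
    unfolding to_colimit_def by blast
  show "x = y" using inj_onD[OF along(3)[OF assms u(1,2)] u(3) y x] by (rule sym)
qed

lemma births_upward:
  assumes "u \<in> births \<sigma>" "v \<in> grades r" "u \<le> v"
  shows "v \<in> births \<sigma>"
proof -
  obtain s where u: "u \<in> grades r" and s: "s \<in> simplices (space_at F u)" "set \<sigma> = germ u ` s"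
    using assms(1) unfolding births_def by blast
  have "germ v ` space_along F u v ` s = germ u ` s"
    unfolding image_image using complex(1)[OF u s(1)] germ_along[OF u assms(2,3)]
    by (intro image_cong refl) blast
  then have "set \<sigma> = germ v ` (space_along F u v ` s)" using s(2) by simp
  then show ?thesis
    using along(2)[OF u assms(2,3) s(1)] assms(2) unfolding births_def
    by (intro CollectI conjI image_eqI)
qed

lemma births_face: "births \<sigma> \<subseteq> births (face i \<sigma>)"
proof
  fix v assume "v \<in> births \<sigma>"
  then obtain s where v: "v \<in> grades r" and s: "s \<in> simplices (space_at F v)" "set \<sigma> = germ v ` s"
    unfolding births_def by blast
  then obtain t where "t \<subseteq> s" "set (face i \<sigma>) = germ v ` t"
    using set_face[of i \<sigma>] unfolding s(2) subset_image_iff by blast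
  then show "v \<in> births (face i \<sigma>)"
    using complex(2)[OF v s(1)] v unfolding births_def by (intro CollectI conjI image_eqI)
qed

lemma gen_births: "v \<in> gen r F \<sigma> \<Longrightarrow> v \<in> births \<sigma>"
  by (simp add: gen_def births_def minimal_elements_def)

lemma births_grades: "v \<in> births \<sigma> \<Longrightarrow> v \<in> grades r"
  by (simp add: births_def)

text \<open>Only finitely many grades lie below \<open>v\<close>, so there is a minimal one among those at which \<open>\<sigma>\<close> is
  present; being minimal below \<open>v\<close>, it is minimal altogether.\<close>

lemma ex_gen_le:
  assumes "v \<in> births \<sigma>"
  shows "\<exists>w\<in>gen r F \<sigma>. w \<le> v"
proof -
  have "finite {w \<in> births \<sigma>. w \<le> v}"
    by (rule finite_subset[OF _ finite_grades_le[OF births_grades[OF assms]]]) blast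
  then obtain w where w: "w \<in> births \<sigma>" "w \<le> v" "\<forall>u\<in>{w \<in> births \<sigma>. w \<le> v}. u \<le> w \<longrightarrow> w = u"
    using finite_has_minimal2[of "{w \<in> births \<sigma>. w \<le> v}" v] assms by auto
  then have "\<forall>u\<in>births \<sigma>. u \<le> w \<longrightarrow> u = w" using order_trans by blast
  then have "w \<in> gen r F \<sigma>" using w(1) unfolding gen_def minimal_elements_def births_def by blast
  then show ?thesis using w(2) by blast
qed

lemma lex_least_gen:
  assumes "v \<in> births \<sigma>"
  shows "lex_least {w \<in> gen r F \<sigma>. w \<le> v} \<in> gen r F \<sigma>" "lex_least {w \<in> gen r F \<sigma>. w \<le> v} \<le> v"
proof -
  have "lex_least {w \<in> gen r F \<sigma>. w \<le> v} \<in> {w \<in> gen r F \<sigma>. w \<le> v}"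
  proof (rule lex_least_mem)
    show "finite {w \<in> gen r F \<sigma>. w \<le> v}"
      by (rule finite_subset[OF _ finite_grades_le[OF births_grades[OF assms]]]) blast
    show "{w \<in> gen r F \<sigma>. w \<le> v} \<subseteq> grades r" using gen_births births_grades by blast
  qed (use ex_gen_le[OF assms] in blast)
  then show "lex_least {w \<in> gen r F \<sigma>. w \<le> v} \<in> gen r F \<sigma>" "lex_least {w \<in> gen r F \<sigma>. w \<le> v} \<le> v"
    by simp_all
qed

lemma S_subset: "v \<in> grades r \<Longrightarrow> ys \<in> S n v \<Longrightarrow> set ys \<subseteq> V v"
  using complex(1) by (auto simp: S_eq ordered_simplices_def)

lemma map_germ_simplex:
  assumes "v \<in> grades r" "ys \<in> S n v"
  shows "map (germ v) ys \<in> X n" "v \<in> births (map (germ v) ys)"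
proof -
  have ys: "length ys = Suc n" "set ys \<in> simplices (space_at F v)"
    "sorted_wrt (\<lambda>x y. (x, y) \<in> induced_order r F ord v \<and> x \<noteq> y) ys"
    using assms(2) by (auto simp: S_eq ordered_simplices_def)
  have "sorted_wrt (\<lambda>x y. (germ v x, germ v y) \<in> ord \<and> germ v x \<noteq> germ v y) ys"
    using ys(3) by (rule sorted_wrt_mono_rel[rotated])
      (auto simp: induced_order_def dest: inj_onD[OF inj_on_germ[OF assms(1)]])
  then have "sorted_wrt (\<lambda>x y. (x, y) \<in> ord \<and> x \<noteq> y) (map (germ v) ys)"
    by (simp add: sorted_wrt_map)
  then show "map (germ v) ys \<in> X n"
    using ys assms(1) by (auto simp: ordered_simplices_def colimit_def)
  show "v \<in> births (map (germ v) ys)"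
    using ys(2) assms(1) unfolding births_def by (intro CollectI conjI image_eqI[of _ _ "set ys"]) simp_all
qed

lemma germ_inv:
  assumes "v \<in> births \<sigma>" "x \<in> set \<sigma>"
  shows "inv_into (V v) (germ v) x \<in> V v" "germ v (inv_into (V v) (germ v) x) = x"
proof -
  have "x \<in> germ v ` V v" using assms complex(1) by (fastforce simp: births_def)
  then show "inv_into (V v) (germ v) x \<in> V v" "germ v (inv_into (V v) (germ v) x) = x"
    by (simp_all add: inv_into_into f_inv_into_f)
qed

lemma map_germ_realize: "v \<in> births \<sigma> \<Longrightarrow> map (germ v) (realize v \<sigma>) = \<sigma>"
  unfolding realize_def map_map by (rule map_idI) (simp add: germ_inv(2))

lemma realize_simplex:
  assumes "\<sigma> \<in> X n" "v \<in> births \<sigma>"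
  shows "realize v \<sigma> \<in> S n v"
proof -
  let ?i = "inv_into (V v) (germ v)"
  have v: "v \<in> grades r" using assms(2) by (rule births_grades)
  have \<sigma>: "length \<sigma> = Suc n" "sorted_wrt (\<lambda>x y. (x, y) \<in> ord \<and> x \<noteq> y) \<sigma>"
    using assms(1) by (auto simp: ordered_simplices_def)
  obtain s where s: "s \<in> simplices (space_at F v)" "set \<sigma> = germ v ` s"
    using assms(2) unfolding births_def by blast
  have "?i ` germ v ` s = s"
    using inv_into_image_cancel[OF inj_on_germ[OF v] complex(1)[OF v s(1)]] .
  then have "set (realize v \<sigma>) \<in> simplices (space_at F v)" using s by (simp add: realize_def)
  moreover have "sorted_wrt (\<lambda>x y. (x, y) \<in> induced_order r F ord v \<and> x \<noteq> y) (realize v \<sigma>)"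
    unfolding realize_def sorted_wrt_map
  proof (rule sorted_wrt_mono_rel[OF _ \<sigma>(2)])
    fix x y assume xy: "x \<in> set \<sigma>" "y \<in> set \<sigma>" "(x, y) \<in> ord \<and> x \<noteq> y"
    note x = germ_inv[OF assms(2) xy(1)] and y = germ_inv[OF assms(2) xy(2)]
    have "?i x \<noteq> ?i y" using x(2) y(2) xy(3) by metis
    then show "(?i x, ?i y) \<in> induced_order r F ord v \<and> ?i x \<noteq> ?i y"
      using x y xy(3) by (simp add: induced_order_def)
  qed
  ultimately show ?thesis using \<sigma>(1) by (simp add: S_eq ordered_simplices_def realize_def)
qed

text \<open>A list of vertices of \<open>F v\<close> is determined by its germs, so identities between simplices can
  be checked in the colimit.\<close>

lemma map_germ_eq_iff:
  assumes "v \<in> grades r" "set xs \<subseteq> V v" "set ys \<subseteq> V v"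
  shows "map (germ v) xs = map (germ v) ys \<longleftrightarrow> xs = ys"
  using inj_on_subset[OF inj_on_germ[OF assms(1)], of "set xs \<union> set ys"] assms(2,3)
  by (simp add: inj_on_map_eq_map)

lemma map_along_simplex:
  assumes "u \<in> grades r" "v \<in> grades r" "u \<le> v" "ys \<in> S n u"
  shows "map (space_along F u v) ys \<in> S n v"
    "map (germ v) (map (space_along F u v) ys) = map (germ u) ys"
proof -
  have sub: "set ys \<subseteq> V u" using assms S_subset by blast
  show eq: "map (germ v) (map (space_along F u v) ys) = map (germ u) ys"
    using sub germ_along[OF assms(1-3)] by auto
  have b: "v \<in> births (map (germ u) ys)"
    using map_germ_simplex(2)[OF assms(1,4)] assms(2,3) by (rule births_upward)
  have r: "realize v (map (germ u) ys) \<in> S n v"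
    using map_germ_simplex(1)[OF assms(1,4)] b by (rule realize_simplex)
  have "map (space_along F u v) ys = realize v (map (germ u) ys)"
    using map_germ_eq_iff[OF assms(2), of "map (space_along F u v) ys" "realize v (map (germ u) ys)"]
      eq map_germ_realize[OF b] sub along(1)[OF assms(1-3)] S_subset[OF assms(2) r] by auto
  then show "map (space_along F u v) ys \<in> S n v" using r by simp
qed

lemma face_S: "v \<in> grades r \<Longrightarrow> ys \<in> S (Suc n) v \<Longrightarrow> i \<le> Suc n \<Longrightarrow> face i ys \<in> S n v"
  unfolding S_eq using complex(2) by (intro face_ordered_simplex) auto

lemma face_X:
  assumes "\<sigma> \<in> X (Suc n)" "i \<le> Suc n"
  shows "face i \<sigma> \<in> X n"
proof (rule face_ordered_simplex[OF assms])
  fix s t assume "s \<in> simplices (colimit r F)" "t \<subseteq> s"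
  then obtain v s' where s': "v \<in> grades r" "s' \<in> simplices (space_at F v)" "s = germ v ` s'"
    by (auto simp: colimit_def)
  obtain t' where t': "t' \<subseteq> s'" "t = germ v ` t'"
    using \<open>t \<subseteq> s\<close> unfolding s'(3) subset_image_iff by blast
  then show "t \<in> simplices (colimit r F)"
    using complex(2)[OF s'(1,2) t'(1)] s'(1) unfolding colimit_def by auto
qed


section \<open>The presentation at a fixed grade\<close>

abbreviation "G n v \<equiv> set_at (GF r F ord n) v"

lemma GF_simps:
  "G n v = {(\<sigma>, w, ()) | \<sigma> w. \<sigma> \<in> X n \<and> w \<in> gen r F \<sigma> \<and> w \<le> v}"
  "set_along (GF r F ord n) u v x = x"
  by (auto simp: GF_def coproduct_def representable_def split: if_splits prod.splits)

lemma KF_simps: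
  "set_at (KF r F ord P n) v = {(\<sigma>, (v0, v1), ()) | \<sigma> v0 v1. \<sigma> \<in> X n \<and> (v0, v1) \<in> P \<sigma> \<and> v0 \<le> v \<and> v1 \<le> v}"
  by (auto simp: KF_def coproduct_def representable_def split: if_splits prod.splits)

lemma DF_simps: "set_at (DF r F ord n) v = X n \<times> {()}"
  by (auto simp: DF_def coproduct_def representable_def le_fun_def)

text \<open>This forgets the generator: all copies of \<open>\<sigma>\<close> present at grade \<open>v\<close> go to the one simplex of
  \<open>F v\<close> with germs \<open>\<sigma>\<close>. It is onto because a simplex present at \<open>v\<close> has a generator below \<open>v\<close>.\<close>

definition "simplex_at v = (\<lambda>(\<sigma>, w :: grade, x :: unit). realize v \<sigma>)"

lemma G_births: "v \<in> grades r \<Longrightarrow> (\<sigma>, w, x) \<in> G n v \<Longrightarrow> v \<in> births \<sigma>"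
  unfolding GF_simps using births_upward[OF gen_births] by blast

lemma simplex_at_mem: "v \<in> grades r \<Longrightarrow> simplex_at v \<in> G n v \<rightarrow> S n v"
  using G_births realize_simplex by (auto simp: simplex_at_def GF_simps)

lemma simplex_at_surj:
  assumes "v \<in> grades r"
  shows "S n v \<subseteq> simplex_at v ` G n v"
proof
  fix ys assume ys: "ys \<in> S n v"
  let ?\<sigma> = "map (germ v) ys"
  have \<sigma>: "?\<sigma> \<in> X n" "v \<in> births ?\<sigma>" using map_germ_simplex[OF assms ys] .
  then obtain w where "w \<in> gen r F ?\<sigma>" "w \<le> v" using ex_gen_le by blast
  then have "(?\<sigma>, w, ()) \<in> G n v" using \<sigma> by (auto simp: GF_simps)
  moreover have "realize v ?\<sigma> = ys"
    using map_germ_eq_iff[OF assms, of "realize v ?\<sigma>" ys] map_germ_realize[OF \<sigma>(2)]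
      S_subset[OF assms realize_simplex[OF \<sigma>]] S_subset[OF assms ys] by simp
  ultimately show "ys \<in> simplex_at v ` G n v" by (force simp: simplex_at_def)
qed

lemma simplex_at_along:
  assumes "u \<in> grades r" "v \<in> grades r" "u \<le> v" "x \<in> G n u"
  shows "simplex_at v x = map (space_along F u v) (simplex_at u x)"
proof -
  obtain \<sigma> w where x: "x = (\<sigma>, w, ())" "\<sigma> \<in> X n" using assms(4) by (auto simp: GF_simps)
  have u: "u \<in> births \<sigma>" using G_births assms(1,4) x by blast
  have v: "v \<in> births \<sigma>" using births_upward[OF u assms(2,3)] .
  note Su = realize_simplex[OF x(2) u] and Sv = realize_simplex[OF x(2) v]
  have "map (germ v) (realize v \<sigma>) = map (germ v) (map (space_along F u v) (realize u \<sigma>))"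
    unfolding map_along_simplex(2)[OF assms(1-3) Su] map_germ_realize[OF u] map_germ_realize[OF v] ..
  then have "realize v \<sigma> = map (space_along F u v) (realize u \<sigma>)"
    using map_germ_eq_iff[OF assms(2)] S_subset[OF assms(2) Sv]
      S_subset[OF assms(2) map_along_simplex(1)[OF assms(1-3) Su]] by blast
  then show ?thesis by (simp add: simplex_at_def x)
qed

lemma dbar_mem:
  assumes "v \<in> grades r" "i \<le> Suc n"
  shows "dbar r F i \<in> G (Suc n) v \<rightarrow> G n v"
proof
  fix x assume "x \<in> G (Suc n) v"
  then obtain \<sigma> w where x: "x = (\<sigma>, w, ())" "\<sigma> \<in> X (Suc n)" "w \<in> gen r F \<sigma>" "w \<le> v"
    by (auto simp: GF_simps)
  have "w \<in> births (face i \<sigma>)" using gen_births[OF x(3)] births_face by blast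
  note l = lex_least_gen[OF this]
  show "dbar r F i x \<in> G n v"
    using face_X[OF x(2) assms(2)] l(1) order_trans[OF l(2) x(4)] by (auto simp: dbar_def x(1) GF_simps)
qed

text \<open>The lexicographic choice of a generator made by \<^const>\<open>dbar\<close> is invisible after forgetting
  generators, so \<^const>\<open>dbar\<close> becomes the face map.\<close>

lemma simplex_at_dbar: "simplex_at v (dbar r F i x) = face i (simplex_at v x)"
  by (auto simp: simplex_at_def dbar_def realize_def map_face split: prod.splits)

lemma alpha_mem: "j \<le> Suc k \<Longrightarrow> alpha j \<in> G (Suc k) v \<rightarrow> set_at (DF r F ord k) w"
  using face_X by (auto simp: alpha_def GF_simps DF_simps)

definition "into_colimit v ys = (map (germ v) ys, ())"

lemma into_colimit_mem: "v \<in> grades r \<Longrightarrow> into_colimit v \<in> S n v \<rightarrow> set_at (DF r F ord n) w"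
  using map_germ_simplex(1) by (auto simp: into_colimit_def DF_simps)

lemma inj_on_into_colimit: "v \<in> grades r \<Longrightarrow> inj_on (into_colimit v) (S n v)"
  using map_germ_eq_iff S_subset by (intro inj_onI) (auto simp: into_colimit_def)

text \<open>The map \<^const>\<open>alpha\<close> is the face map on simplices of \<open>F v\<close> followed by the inclusion into
  the colimit. As that inclusion is injective, the alternating sums of both have the same kernel.\<close>

lemma alpha_eq:
  assumes "v \<in> grades r" "x \<in> G n v"
  shows "alpha j x = into_colimit v (face j (simplex_at v x))"
proof -
  obtain \<sigma> w where x: "x = (\<sigma>, w, ())" using assms(2) by (auto simp: GF_simps)
  then have "v \<in> births \<sigma>" using G_births[OF assms(1)] assms(2) by blast
  with x show ?thesis by (simp add: alpha_def into_colimit_def simplex_at_def map_face map_germ_realize)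
qed

end


section \<open>Linear maps and their alternating sums\<close>

lemma linear_map_alternating_sum:
  assumes "module R M" "module R N" "\<And>i. i \<le> k \<Longrightarrow> linear_map R M N (h i)"
  shows "linear_map R M N (\<lambda>x. alternating_sum N k (\<lambda>i. h i x))"
proof -
  interpret M: module R M by fact
  interpret N: module R N by fact
  have closed: "h i x \<in> carrier N" if "i \<le> k" "x \<in> carrier M" for i x
    using abelian_group_hom.hom_closed[OF linear_map_hom[OF assms(3)]] that by blast
  have "alternating_sum N k (\<lambda>i. h i (x \<oplus>\<^bsub>M\<^esub> y)) =
      alternating_sum N k (\<lambda>i. h i x) \<oplus>\<^bsub>N\<^esub> alternating_sum N k (\<lambda>i. h i y)"
    if xy: "x \<in> carrier M" "y \<in> carrier M" for x y
  proof -
    have "alternating_sum N k (\<lambda>i. h i (x \<oplus>\<^bsub>M\<^esub> y)) = alternating_sum N k (\<lambda>i. h i x \<oplus>\<^bsub>N\<^esub> h i y)"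
      using abelian_group_hom.hom_add[OF linear_map_hom[OF assms(3)] xy] closed xy
      by (intro N.alternating_sum_cong) auto
    then show ?thesis using closed xy by (simp add: N.alternating_sum_add)
  qed
  moreover have "alternating_sum N k (\<lambda>i. h i (a \<odot>\<^bsub>M\<^esub> x)) = a \<odot>\<^bsub>N\<^esub> alternating_sum N k (\<lambda>i. h i x)"
    if ax: "a \<in> carrier R" "x \<in> carrier M" for a x
  proof -
    interpret s: abelian_group_hom N N "\<lambda>y. a \<odot>\<^bsub>N\<^esub> y"
      unfolding abelian_group_hom_iff using ax N.smult_r_distr N.abelian_group_axioms by auto
    have "alternating_sum N k (\<lambda>i. h i (a \<odot>\<^bsub>M\<^esub> x)) = alternating_sum N k (\<lambda>i. a \<odot>\<^bsub>N\<^esub> h i x)"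
      using linear_map_smult[OF assms(3) ax] closed ax by (intro N.alternating_sum_cong) auto
    then show ?thesis using closed ax by (simp add: s.hom_alternating_sum)
  qed
  moreover have "alternating_sum N k (\<lambda>i. h i x) \<in> carrier N" if "x \<in> carrier M" for x
    using closed that by (intro N.alternating_sum_closed)
  ultimately show ?thesis
    unfolding linear_map_def abelian_group_hom_iff
    by (intro conjI ballI funcsetI M.abelian_group_axioms N.abelian_group_axioms)
qed

lemma linear_map_zero:
  assumes "module R M" "module R N"
  shows "linear_map R M N (\<lambda>_. \<zero>\<^bsub>N\<^esub>)"
proof -
  interpret M: module R M by fact
  interpret N: module R N by fact
  show ?thesis unfolding linear_map_def abelian_group_hom_iff
    using M.abelian_group_axioms N.abelian_group_axioms by auto
qed

lemma submodule_linear_image: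
  assumes "module R M" "module R N" "linear_map R M N h"
  shows "submodule (h ` carrier M) R N"
proof -
  interpret M: module R M by fact
  interpret N: module R N by fact
  interpret h: abelian_group_hom M N h using assms(3) by (rule linear_map_hom)
  show ?thesis
  proof (rule N.submoduleI)
    show "\<zero>\<^bsub>N\<^esub> \<in> h ` carrier M" using h.hom_zero M.zero_closed by (metis imageI)
    fix a assume "a \<in> h ` carrier M"
    then obtain x where "x \<in> carrier M" "a = h x" by blast
    then show "\<ominus>\<^bsub>N\<^esub> a \<in> h ` carrier M"
      by (intro image_eqI[of _ _ "\<ominus>\<^bsub>M\<^esub> x"]) auto
  next
    fix a b assume "a \<in> h ` carrier M" "b \<in> h ` carrier M"
    then obtain x y where "x \<in> carrier M" "a = h x" "y \<in> carrier M" "b = h y" by blast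
    then show "a \<oplus>\<^bsub>N\<^esub> b \<in> h ` carrier M"
      by (intro image_eqI[of _ _ "x \<oplus>\<^bsub>M\<^esub> y"]) auto
  next
    fix a b assume a: "a \<in> carrier R" and "b \<in> h ` carrier M"
    then obtain x where "x \<in> carrier M" "b = h x" by blast
    then show "a \<odot>\<^bsub>N\<^esub> b \<in> h ` carrier M"
      using linear_map_smult[OF assms(3) a] a by (intro image_eqI[of _ _ "a \<odot>\<^bsub>M\<^esub> x"]) auto
  qed auto
qed

lemma submodule_linear_kernel:
  assumes "module R M" "module R N" "linear_map R M N h"
  shows "submodule (a_kernel M N h) R M"
proof -
  interpret M: module R M by fact
  interpret N: module R N by fact
  interpret h: abelian_group_hom M N h using assms(3) by (rule linear_map_hom)
  show ?thesis
  proof (intro submodule.intro submodule_axioms.intro)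
    show "subgroup (a_kernel M N h) (add_monoid M)"
      using h.additive_subgroup_a_kernel by (rule additive_subgroup.a_subgroup)
    fix a x assume a: "a \<in> carrier R" and x: "x \<in> a_kernel M N h"
    then have "h (a \<odot>\<^bsub>M\<^esub> x) = a \<odot>\<^bsub>N\<^esub> h x"
      by (intro linear_map_smult[OF assms(3)]) (simp_all add: a_kernel_def')
    then show "a \<odot>\<^bsub>M\<^esub> x \<in> a_kernel M N h"
      using a x by (simp add: a_kernel_def')
  qed
qed

lemma span_functor_simps [simp]:
  "module_at (span_functor R T) v = span_module R (set_at T v)"
  "module_along (span_functor R T) u v = span_map R (set_at T u) (set_at T v) (set_along T u v)"
  by (simp_all add: span_functor_def)

context cring
begin

lemma abelian_group_span_graded: "abelian_group (span_graded R r T)"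
  by (rule abelian_group_associated_module) (simp add: abelian_group_span_module del: span_module_simps)

lemma span_graded_eval_hom:
  "v \<in> grades r \<Longrightarrow> abelian_group_hom (span_graded R r T) (span_module R (set_at T v)) (\<lambda>x. x v)"
  using associated_module_eval_hom[of r "span_functor R T" v R]
  by (simp add: abelian_group_span_module del: span_module_simps associated_module_simps)

lemma span_graded_carrierI:
  assumes "x \<in> extensional (grades r)"
    and "\<And>v. v \<in> grades r \<Longrightarrow> x v \<in> carrier (span_module R (set_at T v))"
    and "finite A" "\<And>v. v \<in> grades r \<Longrightarrow> v \<notin> A \<Longrightarrow> x v = \<zero>\<^bsub>span_module R (set_at T v)\<^esub>"
  shows "x \<in> carrier (span_graded R r T)"
proof -
  have "{v \<in> grades r. x v \<noteq> \<zero>\<^bsub>span_module R (set_at T v)\<^esub>} \<subseteq> A" using assms(4) by blast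
  then have "finite {v \<in> grades r. x v \<noteq> \<zero>\<^bsub>span_module R (set_at T v)\<^esub>}"
    using assms(3) by (rule finite_subset)
  then show ?thesis using assms(1,2) by (simp add: PiE_iff del: span_module_simps)
qed

lemma span_graded_carrierD:
  assumes "x \<in> carrier (span_graded R r T)"
  shows "v \<in> grades r \<Longrightarrow> x v \<in> carrier (span_module R (set_at T v))"
    and "finite {v \<in> grades r. x v \<noteq> \<zero>\<^bsub>span_module R (set_at T v)\<^esub>}"
    and "x \<in> extensional (grades r)"
  using assms by (simp_all add: PiE_iff del: span_module_simps)

lemma induced_hom_closed:
  assumes "\<And>v. v \<in> grades r \<Longrightarrow> h \<in> set_at T v \<rightarrow> set_at U v" "x \<in> carrier (span_graded R r T)"
  shows "induced_hom R r T U h x \<in> carrier (span_graded R r U)"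
proof (rule span_graded_carrierI)
  show "finite {v \<in> grades r. x v \<noteq> \<zero>\<^bsub>span_module R (set_at T v)\<^esub>}"
    using span_graded_carrierD(2)[OF assms(2)] .
  fix v assume v: "v \<in> grades r"
  interpret h: abelian_group_hom "span_module R (set_at T v)" "span_module R (set_at U v)"
    "span_map R (set_at T v) (set_at U v) h"
    using assms(1)[OF v] by (rule span_map_hom)
  show "induced_hom R r T U h x v \<in> carrier (span_module R (set_at U v))"
    using h.hom_closed[OF span_graded_carrierD(1)[OF assms(2) v]] v
    by (simp only: induced_hom_def restrict_apply if_True)
  assume "v \<notin> {v \<in> grades r. x v \<noteq> \<zero>\<^bsub>span_module R (set_at T v)\<^esub>}"
  then have "x v = \<zero>\<^bsub>span_module R (set_at T v)\<^esub>" using v by blast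
  then show "induced_hom R r T U h x v = \<zero>\<^bsub>span_module R (set_at U v)\<^esub>"
    using h.hom_zero v by (simp only: induced_hom_def restrict_apply if_True)
qed (simp add: induced_hom_def)

lemma induced_hom_apply:
  "v \<in> grades r \<Longrightarrow> induced_hom R r T U h x v = span_map R (set_at T v) (set_at U v) h (x v)"
  by (simp only: induced_hom_def restrict_apply if_True)

lemma induced_hom_alternating_sum:
  assumes "\<And>i v. i \<le> k \<Longrightarrow> v \<in> grades r \<Longrightarrow> h i \<in> set_at T v \<rightarrow> set_at U v"
    and "x \<in> carrier (span_graded R r T)"
  shows "alternating_sum (span_graded R r U) k (\<lambda>i. induced_hom R r T U (h i) x) \<in> carrier (span_graded R r U)"
    and "v \<in> grades r \<Longrightarrow> alternating_sum (span_graded R r U) k (\<lambda>i. induced_hom R r T U (h i) x) v =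
      alternating_sum (span_module R (set_at U v)) k (\<lambda>i. span_map R (set_at T v) (set_at U v) (h i) (x v))"
proof -
  have c: "induced_hom R r T U (h i) x \<in> carrier (span_graded R r U)" if "i \<le> k" for i
    using assms(1)[OF that] assms(2) by (rule induced_hom_closed)
  show "alternating_sum (span_graded R r U) k (\<lambda>i. induced_hom R r T U (h i) x) \<in> carrier (span_graded R r U)"
    using abelian_group_span_graded c by (rule abelian_group.alternating_sum_closed)
  assume v: "v \<in> grades r"
  show "alternating_sum (span_graded R r U) k (\<lambda>i. induced_hom R r T U (h i) x) v =
      alternating_sum (span_module R (set_at U v)) k (\<lambda>i. span_map R (set_at T v) (set_at U v) (h i) (x v))"
    unfolding induced_hom_apply[OF v, symmetric]
    using span_graded_eval_hom[OF v] c by (rule abelian_group_hom.hom_alternating_sum)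
qed

end

section \<open>Boundary maps\<close>

locale multifiltered_chains = multifiltered_complex r F ord + cring R
  for r F ord and R :: "('b, 'c) ring_scheme" (structure)
begin

abbreviation "bd n v \<equiv> boundary R r F ord n v"

abbreviation "T n v \<equiv> set_at (pred_functor (simplex_functor r F ord) n) v"

lemma bd_Suc:
  "bd (Suc k) v c = alternating_sum (span_module R (S k v)) (Suc k)
    (\<lambda>i. span_map R (S (Suc k) v) (S k v) (face i) c)"
  by (simp add: boundary_def)

lemma linear_map_bd:
  assumes "v \<in> grades r"
  shows "linear_map R (span_module R (S n v)) (span_module R (T n v)) (bd n v)"
proof (cases n)
  case 0
  have "bd n v = (\<lambda>_. \<zero>\<^bsub>span_module R {}\<^esub>)" unfolding boundary_def 0 by simp
  then show ?thesis
    using linear_map_zero[OF module_span_module module_span_module] 0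
    by (simp add: pred_functor_def empty_functor_def del: span_module_simps)
next
  case (Suc k)
  have "bd n v = (\<lambda>c. alternating_sum (span_module R (S k v)) (Suc k)
      (\<lambda>i. span_map R (S (Suc k) v) (S k v) (face i) c))"
    unfolding Suc by (rule ext) (rule bd_Suc)
  moreover have "T n v = S k v" by (simp add: pred_functor_def Suc)
  moreover have "linear_map R (span_module R (S (Suc k) v)) (span_module R (S k v))
      (\<lambda>c. alternating_sum (span_module R (S k v)) (Suc k)
        (\<lambda>i. span_map R (S (Suc k) v) (S k v) (face i) c))"
    using face_S[OF assms]
    by (intro linear_map_alternating_sum module_span_module linear_map_span_map) blast
  ultimately show ?thesis using Suc by simp
qed

lemma linear_map_bd_Suc:
  "v \<in> grades r \<Longrightarrow> linear_map R (span_module R (S (Suc k) v)) (span_module R (S k v)) (bd (Suc k) v)"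
  using linear_map_bd[of v "Suc k"] by (simp add: pred_functor_def del: span_module_simps)

lemma face_map: "v \<in> grades r \<Longrightarrow> i \<le> Suc k \<Longrightarrow> face i \<in> S (Suc k) v \<rightarrow> S k v"
  using face_S by blast

lemma bd_bd:
  assumes v: "v \<in> grades r" and c: "c \<in> carrier (span_module R (S (Suc n) v))"
  shows "bd n v (bd (Suc n) v c) = \<zero>\<^bsub>span_module R (T n v)\<^esub>"
proof (cases n)
  case 0
  then show ?thesis by (simp add: boundary_def pred_functor_def empty_functor_def)
next
  case (Suc k)
  let ?C = "span_module R (S k v)"
  let ?d = "\<lambda>k i. span_map R (S (Suc k) v) (S k v) (face i)"
  interpret C: abelian_group ?C by (rule abelian_group_span_module)
  interpret b: abelian_group_hom "span_module R (S (Suc k) v)" ?C "bd (Suc k) v"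
    using linear_map_bd_Suc[OF v] by (rule linear_map_hom)
  have c': "c \<in> carrier (span_module R (S (Suc (Suc k)) v))" using c Suc by simp
  have d: "?d (Suc k) i c \<in> carrier (span_module R (S (Suc k) v))" if "i \<le> Suc (Suc k)" for i
    using face_map[OF v that] c' by (rule span_map_closed)
  have "bd (Suc k) v (bd (Suc (Suc k)) v c) =
      alternating_sum ?C (Suc (Suc k)) (\<lambda>i. bd (Suc k) v (?d (Suc k) i c))"
    unfolding bd_Suc[of "Suc k"] using d by (rule b.hom_alternating_sum)
  also have "\<dots> = alternating_sum ?C (Suc (Suc k)) (\<lambda>i. alternating_sum ?C (Suc k) (\<lambda>j. ?d k j (?d (Suc k) i c)))"
    unfolding bd_Suc ..
  also have "\<dots> = \<zero>\<^bsub>?C\<^esub>"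
  proof (rule C.alternating_sum_simplicial)
    fix i j assume i: "i \<le> Suc (Suc k)" and j: "j \<le> Suc k"
    show "?d k j (?d (Suc k) i c) \<in> carrier ?C"
      using face_map[OF v j] d[OF i] by (rule span_map_closed)
  next
    fix i j assume ji: "j < i" and i: "i \<le> Suc (Suc k)"
    then have j: "j \<le> Suc (Suc k)" "j \<le> Suc k" "i - 1 \<le> Suc k" by auto
    have "?d k j (?d (Suc k) i c) = span_map R (S (Suc (Suc k)) v) (S k v) (\<lambda>ys. face j (face i ys)) c"
      using face_map[OF v i] face_map[OF v j(2)] refl c' by (rule span_map_compose)
    also have "\<dots> = ?d k (i - 1) (?d (Suc k) j c)"
    proof (rule span_map_compose[OF face_map[OF v j(1)] face_map[OF v j(3)] _ c', symmetric])
      fix ys assume "ys \<in> S (Suc (Suc k)) v"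
      then have "i < length ys" using i by (auto simp: S_eq ordered_simplices_def)
      with ji show "face j (face i ys) = face (i - 1) (face j ys)" by (rule face_face)
    qed
    finally show "?d k j (?d (Suc k) i c) = ?d k (i - 1) (?d (Suc k) j c)" .
  qed
  finally show ?thesis by (simp add: Suc pred_functor_def del: span_module_simps)
qed

lemma along_map:
  "u \<in> grades r \<Longrightarrow> v \<in> grades r \<Longrightarrow> u \<le> v \<Longrightarrow> map (space_along F u v) \<in> S n u \<rightarrow> S n v"
  using map_along_simplex(1) by blast

lemma bd_natural:
  assumes uv: "u \<in> grades r" "v \<in> grades r" "u \<le> v" and c: "c \<in> carrier (span_module R (S (Suc k) u))"
  shows "bd (Suc k) v (span_map R (S (Suc k) u) (S (Suc k) v) (map (space_along F u v)) c) =
    span_map R (S k u) (S k v) (map (space_along F u v)) (bd (Suc k) u c)"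
proof -
  let ?a = "map (space_along F u v)"
  interpret a: abelian_group_hom "span_module R (S k u)" "span_module R (S k v)" "span_map R (S k u) (S k v) ?a"
    using along_map[OF uv] by (rule span_map_hom)
  have d: "span_map R (S (Suc k) u) (S k u) (face i) c \<in> carrier (span_module R (S k u))" if "i \<le> Suc k" for i
    using face_map[OF uv(1) that] c by (rule span_map_closed)
  have eq: "span_map R (S (Suc k) v) (S k v) (face i) (span_map R (S (Suc k) u) (S (Suc k) v) ?a c) =
      span_map R (S k u) (S k v) ?a (span_map R (S (Suc k) u) (S k u) (face i) c)" if i: "i \<le> Suc k" for i
  proof -
    have "span_map R (S (Suc k) v) (S k v) (face i) (span_map R (S (Suc k) u) (S (Suc k) v) ?a c) =
        span_map R (S (Suc k) u) (S k v) (\<lambda>ys. face i (?a ys)) c"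
      using along_map[OF uv] face_map[OF uv(2) i] refl c by (rule span_map_compose)
    also have "\<dots> = span_map R (S k u) (S k v) ?a (span_map R (S (Suc k) u) (S k u) (face i) c)"
      by (rule span_map_compose[OF face_map[OF uv(1) i] along_map[OF uv] map_face[symmetric] c, symmetric])
    finally show ?thesis .
  qed
  have "bd (Suc k) v (span_map R (S (Suc k) u) (S (Suc k) v) ?a c) =
      alternating_sum (span_module R (S k v)) (Suc k)
        (\<lambda>i. span_map R (S k u) (S k v) ?a (span_map R (S (Suc k) u) (S k u) (face i) c))"
    unfolding bd_Suc using eq a.hom_closed[OF d]
    by (intro abelian_group.alternating_sum_cong[OF abelian_group_span_module])
  also have "\<dots> = span_map R (S k u) (S k v) ?a (bd (Suc k) u c)"
    unfolding bd_Suc by (rule a.hom_alternating_sum[symmetric]) (rule d)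
  finally show ?thesis .
qed

abbreviation "cycles n v \<equiv> a_kernel (span_module R (S n v)) (span_module R (T n v)) (bd n v)"

abbreviation "boundaries n v \<equiv> bd (Suc n) v ` carrier (span_module R (S (Suc n) v))"

abbreviation "to_chain n v \<equiv> span_map R (G n v) (S n v) (simplex_at v)"

lemma boundaries_le_cycles: "v \<in> grades r \<Longrightarrow> boundaries n v \<subseteq> cycles n v"
  using abelian_group_hom.hom_closed[OF linear_map_hom[OF linear_map_bd_Suc]] bd_bd
  by (auto simp: a_kernel_def' simp del: span_module_simps)

text \<open>Boundaries and cycles form subfunctors of the chains because the boundary maps are natural.\<close>

lemma along_boundaries:
  assumes uv: "u \<in> grades r" "v \<in> grades r" "u \<le> v"
  shows "span_map R (S n u) (S n v) (map (space_along F u v)) ` boundaries n u \<subseteq> boundaries n v"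
proof
  fix z assume "z \<in> span_map R (S n u) (S n v) (map (space_along F u v)) ` boundaries n u"
  then obtain c where c: "c \<in> carrier (span_module R (S (Suc n) u))"
    "z = span_map R (S n u) (S n v) (map (space_along F u v)) (bd (Suc n) u c)" by blast
  then have "z = bd (Suc n) v (span_map R (S (Suc n) u) (S (Suc n) v) (map (space_along F u v)) c)"
    by (simp only: bd_natural[OF uv c(1)])
  then show "z \<in> boundaries n v" using span_map_closed[OF along_map[OF uv] c(1)] by blast
qed

lemma along_cycles:
  assumes uv: "u \<in> grades r" "v \<in> grades r" "u \<le> v"
  shows "span_map R (S n u) (S n v) (map (space_along F u v)) ` cycles n u \<subseteq> cycles n v"
proof
  fix z assume "z \<in> span_map R (S n u) (S n v) (map (space_along F u v)) ` cycles n u"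
  then obtain c where c: "c \<in> carrier (span_module R (S n u))" "bd n u c = \<zero>\<^bsub>span_module R (T n u)\<^esub>"
    "z = span_map R (S n u) (S n v) (map (space_along F u v)) c"
    unfolding a_kernel_def' by blast
  have z: "z \<in> carrier (span_module R (S n v))"
    unfolding c(3) using along_map[OF uv] c(1) by (rule span_map_closed)
  have "bd n v z = \<zero>\<^bsub>span_module R (T n v)\<^esub>"
  proof (cases n)
    case 0
    then show ?thesis by (simp add: boundary_def pred_functor_def empty_functor_def)
  next
    case (Suc k)
    have "bd n v z = span_map R (S k u) (S k v) (map (space_along F u v)) (bd n u c)"
      using bd_natural[OF uv] c(1) unfolding c(3) Suc by blast
    also have "bd n u c = \<zero>\<^bsub>span_module R (S k u)\<^esub>"
      using c(2) by (simp add: Suc pred_functor_def del: span_module_simps)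
    also have "span_map R (S k u) (S k v) (map (space_along F u v)) \<dots> = \<zero>\<^bsub>span_module R (S k v)\<^esub>"
      by (rule abelian_group_hom.hom_zero[OF span_map_hom[OF along_map[OF uv]]])
    finally show ?thesis by (simp add: Suc pred_functor_def del: span_module_simps)
  qed
  then show "z \<in> cycles n v" using z unfolding a_kernel_def' by blast
qed

lemma G_mono: "u \<le> v \<Longrightarrow> G n u \<subseteq> G n v"
  by (auto simp: GF_simps intro: order_trans)

lemma levelwise_surjection:
  "levelwise_surjection R r (span_functor R (GF r F ord n)) (span_functor R (simplex_functor r F ord n))
    (to_chain n) (cycles n) (boundaries n)"
proof (rule levelwise_surjection.intro, unfold span_functor_simps)
  have GG: "set_along (GF r F ord n) u v \<in> G n u \<rightarrow> G n v" if "u \<le> v" for u v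
    using subsetD[OF G_mono[OF that]] by (intro funcsetI) (simp only: GF_simps(2))
  have SS: "set_along (simplex_functor r F ord n) u v = map (space_along F u v)" for u v
    by (simp add: simplex_functor_def)
  show "cring R" by (rule is_cring)
  show "module R (span_module R (G n v))" "module R (span_module R (S n v))" for v
    by (rule module_span_module)+
  fix u v assume v: "v \<in> grades r"
  show "linear_map R (span_module R (G n v)) (span_module R (S n v)) (to_chain n v)"
    using simplex_at_mem[OF v] by (rule linear_map_span_map)
  show "carrier (span_module R (S n v)) \<subseteq> to_chain n v ` carrier (span_module R (G n v))"
    using span_map_surj[OF simplex_at_mem[OF v] simplex_at_surj[OF v]] by blast
  show "submodule (cycles n v) R (span_module R (S n v))"
    using module_span_module module_span_module linear_map_bd[OF v] by (rule submodule_linear_kernel)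
  show "submodule (boundaries n v) R (span_module R (S n v))"
    using module_span_module module_span_module linear_map_bd_Suc[OF v] by (rule submodule_linear_image)
  show "boundaries n v \<subseteq> cycles n v" using v by (rule boundaries_le_cycles)
  assume u: "u \<in> grades r" and uv: "u \<le> v"
  show "abelian_group_hom (span_module R (G n u)) (span_module R (G n v))
      (span_map R (G n u) (G n v) (set_along (GF r F ord n) u v))"
    using GG[OF uv] by (rule span_map_hom)
  show "abelian_group_hom (span_module R (S n u)) (span_module R (S n v))
      (span_map R (S n u) (S n v) (set_along (simplex_functor r F ord n) u v))"
    unfolding SS using along_map[OF u v uv] by (rule span_map_hom)
  show "span_map R (S n u) (S n v) (set_along (simplex_functor r F ord n) u v) ` cycles n u \<subseteq> cycles n v"
    unfolding SS by (rule along_cycles[OF u v uv])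
  show "span_map R (S n u) (S n v) (set_along (simplex_functor r F ord n) u v) ` boundaries n u \<subseteq> boundaries n v"
    unfolding SS by (rule along_boundaries[OF u v uv])
  fix x assume x: "x \<in> carrier (span_module R (G n u))"
  have "to_chain n v (span_map R (G n u) (G n v) (set_along (GF r F ord n) u v) x) =
      span_map R (G n u) (S n v) (simplex_at v) x"
    using GG[OF uv] simplex_at_mem[OF v] _ x by (rule span_map_compose) (simp add: GF_simps(2))
  also have "\<dots> = span_map R (S n u) (S n v) (map (space_along F u v)) (to_chain n u x)"
    using simplex_at_mem[OF u] along_map[OF u v uv] simplex_at_along[OF u v uv] x
    by (rule span_map_compose[symmetric])
  finally show "to_chain n v (span_map R (G n u) (G n v) (set_along (GF r F ord n) u v) x) =
      span_map R (S n u) (S n v) (set_along (simplex_functor r F ord n) u v) (to_chain n u x)"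
    unfolding SS .
qed


section \<open>Kernel and image of the presentation\<close>

lemma to_chain_dbar:
  assumes v: "v \<in> grades r" and b: "b \<in> carrier (span_module R (G (Suc n) v))"
  shows "to_chain n v (alternating_sum (span_module R (G n v)) (Suc n)
      (\<lambda>i. span_map R (G (Suc n) v) (G n v) (dbar r F i) b)) = bd (Suc n) v (to_chain (Suc n) v b)"
proof -
  interpret p: abelian_group_hom "span_module R (G n v)" "span_module R (S n v)" "to_chain n v"
    using simplex_at_mem[OF v] by (rule span_map_hom)
  have d: "span_map R (G (Suc n) v) (G n v) (dbar r F i) b \<in> carrier (span_module R (G n v))"
    if "i \<le> Suc n" for i
    using dbar_mem[OF v that] b by (rule span_map_closed)
  have eq: "to_chain n v (span_map R (G (Suc n) v) (G n v) (dbar r F i) b) =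
      span_map R (S (Suc n) v) (S n v) (face i) (to_chain (Suc n) v b)" if i: "i \<le> Suc n" for i
  proof -
    have "to_chain n v (span_map R (G (Suc n) v) (G n v) (dbar r F i) b) =
        span_map R (G (Suc n) v) (S n v) (\<lambda>x. face i (simplex_at v x)) b"
      using dbar_mem[OF v i] simplex_at_mem[OF v] simplex_at_dbar[of v i, symmetric] b by (rule span_map_compose)
    also have "\<dots> = span_map R (S (Suc n) v) (S n v) (face i) (to_chain (Suc n) v b)"
      using simplex_at_mem[OF v] face_map[OF v i] refl b by (rule span_map_compose[symmetric])
    finally show ?thesis .
  qed
  have c: "span_map R (S (Suc n) v) (S n v) (face i) (to_chain (Suc n) v b) \<in> carrier (span_module R (S n v))"
    if "i \<le> Suc n" for i
    unfolding eq[OF that, symmetric] using d[OF that] by (rule p.hom_closed)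
  have "to_chain n v (alternating_sum (span_module R (G n v)) (Suc n)
      (\<lambda>i. span_map R (G (Suc n) v) (G n v) (dbar r F i) b)) =
      alternating_sum (span_module R (S n v)) (Suc n)
        (\<lambda>i. to_chain n v (span_map R (G (Suc n) v) (G n v) (dbar r F i) b))"
    by (rule p.hom_alternating_sum) (rule d)
  also have "\<dots> = bd (Suc n) v (to_chain (Suc n) v b)"
    unfolding bd_Suc using eq c by (rule p.H.alternating_sum_cong)
  finally show ?thesis .
qed

text \<open>At each grade the second map is the boundary of the underlying chain followed by an injection,
  so its kernel is the preimage of the cycles. In degree \<open>0\<close> every chain is a cycle and the second
  map is zero.\<close>

lemma alpha_map_eq:
  assumes x: "x \<in> carrier (span_graded R r (GF r F ord n))"
  shows "alpha_map R r F ord n x = \<zero>\<^bsub>span_graded R r (pred_functor (DF r F ord) n)\<^esub> \<longleftrightarrow>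
    (\<forall>v\<in>grades r. to_chain n v (x v) \<in> cycles n v)"
proof (cases n)
  case 0
  have "to_chain n v (x v) \<in> cycles n v" if "v \<in> grades r" for v
    using span_map_closed[OF simplex_at_mem[OF that] span_graded_carrierD(1)[OF x that]]
    by (simp add: a_kernel_def' 0 boundary_def pred_functor_def empty_functor_def del: span_module_simps(1))
  then show ?thesis by (simp add: alpha_map_def 0 Let_def)
next
  case (Suc k)
  let ?D = "DF r F ord k"
  have D: "pred_functor (DF r F ord) n = ?D" by (simp add: pred_functor_def Suc)
  have am: "alpha_map R r F ord n x = alternating_sum (span_graded R r ?D) (Suc k)
      (\<lambda>j. induced_hom R r (GF r F ord n) ?D (alpha j) x)"
    by (simp add: alpha_map_def D Let_def) (simp add: Suc)
  have mem: "alpha j \<in> G n v \<rightarrow> set_at ?D v" if "j \<le> Suc k" "v \<in> grades r" for j v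
    using alpha_mem[OF that(1)] unfolding Suc .
  have am_closed: "alternating_sum (span_graded R r ?D) (Suc k)
      (\<lambda>j. induced_hom R r (GF r F ord n) ?D (alpha j) x) \<in> carrier (span_graded R r ?D)"
    using mem x by (rule induced_hom_alternating_sum(1))
  have am_apply: "alternating_sum (span_graded R r ?D) (Suc k)
      (\<lambda>j. induced_hom R r (GF r F ord n) ?D (alpha j) x) v =
      alternating_sum (span_module R (set_at ?D v)) (Suc k)
        (\<lambda>j. span_map R (G n v) (set_at ?D v) (alpha j) (x v))" if v: "v \<in> grades r" for v
    using mem x v by (rule induced_hom_alternating_sum(2))
  have lv: "alpha_map R r F ord n x v = \<zero>\<^bsub>span_module R (set_at ?D v)\<^esub> \<longleftrightarrow>
      to_chain n v (x v) \<in> cycles n v" if v: "v \<in> grades r" for v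
  proof -
    let ?\<iota> = "span_map R (S k v) (set_at ?D v) (into_colimit v)"
    have xv: "x v \<in> carrier (span_module R (G n v))" using x v by (rule span_graded_carrierD)
    have pv: "to_chain n v (x v) \<in> carrier (span_module R (S n v))"
      using simplex_at_mem[OF v] xv by (rule span_map_closed)
    interpret \<iota>: abelian_group_hom "span_module R (S k v)" "span_module R (set_at ?D v)" ?\<iota>
      using into_colimit_mem[OF v] by (rule span_map_hom)
    have d: "span_map R (S n v) (S k v) (face j) (to_chain n v (x v)) \<in> carrier (span_module R (S k v))"
      if "j \<le> Suc k" for j
      using face_map[OF v that, folded Suc] pv by (rule span_map_closed)
    have eq: "span_map R (G n v) (set_at ?D v) (alpha j) (x v) =
        ?\<iota> (span_map R (S n v) (S k v) (face j) (to_chain n v (x v)))" if j: "j \<le> Suc k" for j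
    proof -
      have f: "(\<lambda>y. face j (simplex_at v y)) \<in> G n v \<rightarrow> S k v"
        using simplex_at_mem[OF v] face_map[OF v j, folded Suc] by (auto simp: Pi_iff)
      have "span_map R (G n v) (set_at ?D v) (alpha j) (x v) =
          ?\<iota> (span_map R (G n v) (S k v) (\<lambda>y. face j (simplex_at v y)) (x v))"
        using f into_colimit_mem[OF v] alpha_eq[OF v] xv by (rule span_map_compose[symmetric])
      also have "span_map R (G n v) (S k v) (\<lambda>y. face j (simplex_at v y)) (x v) =
          span_map R (S n v) (S k v) (face j) (to_chain n v (x v))"
        using simplex_at_mem[OF v] face_map[OF v j, folded Suc] refl xv by (rule span_map_compose[symmetric])
      finally show ?thesis .
    qed
    have "alpha_map R r F ord n x v = alternating_sum (span_module R (set_at ?D v)) (Suc k)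
        (\<lambda>j. ?\<iota> (span_map R (S n v) (S k v) (face j) (to_chain n v (x v))))"
      unfolding am am_apply[OF v] using eq \<iota>.hom_closed[OF d] by (rule \<iota>.H.alternating_sum_cong)
    also have "\<dots> = ?\<iota> (bd n v (to_chain n v (x v)))"
      unfolding Suc bd_Suc by (rule \<iota>.hom_alternating_sum[symmetric]) (rule d[unfolded Suc])
    finally have "alpha_map R r F ord n x v = ?\<iota> (bd n v (to_chain n v (x v)))" .
    moreover have "bd n v (to_chain n v (x v)) \<in> carrier (span_module R (S k v))"
      using abelian_group_hom.hom_closed[OF linear_map_hom[OF linear_map_bd_Suc[OF v]]] pv
      unfolding Suc by blast
    ultimately show ?thesis
      using span_map_eq_zero_iff[OF into_colimit_mem[OF v] inj_on_into_colimit[OF v]] pv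
      by (simp add: a_kernel_def' Suc pred_functor_def del: span_module_simps)
  qed
  have "alpha_map R r F ord n x \<in> extensional (grades r)"
    unfolding am by (rule span_graded_carrierD(3)[OF am_closed])
  then have "alpha_map R r F ord n x = \<zero>\<^bsub>span_graded R r ?D\<^esub> \<longleftrightarrow>
      (\<forall>v\<in>grades r. alpha_map R r F ord n x v = \<zero>\<^bsub>span_module R (set_at ?D v)\<^esub>)"
    by (auto intro: extensionalityI simp del: span_module_simps)
  then show ?thesis unfolding D using lv by blast
qed


abbreviation "K P n v \<equiv> set_at (KF r F ord P n) v"

lemma pi_mem:
  assumes "pair_choice r F ord n P"
  shows "pi0 \<in> K P n v \<rightarrow> G n v" "pi1 \<in> K P n v \<rightarrow> G n v"
proof -
  have "v0 \<in> gen r F \<sigma> \<and> v1 \<in> gen r F \<sigma>" if "\<sigma> \<in> X n" "(v0, v1) \<in> P \<sigma>" for \<sigma> v0 v1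
    using assms that unfolding pair_choice_def by fast
  then show "pi0 \<in> K P n v \<rightarrow> G n v" "pi1 \<in> K P n v \<rightarrow> G n v"
    by (auto simp: KF_simps GF_simps pi0_def pi1_def)
qed

text \<open>Two copies of one simplex at grade \<open>v\<close> differ in their generators \<open>w\<close> and \<open>w'\<close> only. Both lie
  below \<open>v\<close>, hence so does their join, which makes the pair available at grade \<open>v\<close>. This is the
  complete graph required by \<open>span_map_kernel_edges\<close>.\<close>

lemma ex_pair:
  assumes P: "pair_choice r F ord n P" and v: "v \<in> grades r"
    and x: "x \<in> G n v" and y: "y \<in> G n v" and eq: "simplex_at v x = simplex_at v y" and "x \<noteq> y"
  shows "\<exists>e\<in>K P n v. pi0 e = x \<and> pi1 e = y \<or> pi0 e = y \<and> pi1 e = x"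
proof -
  obtain \<sigma> w where x': "x = (\<sigma>, w, ())" "\<sigma> \<in> X n" "w \<in> gen r F \<sigma>" "w \<le> v"
    using x by (auto simp: GF_simps)
  obtain \<tau> w' where y': "y = (\<tau>, w', ())" "w' \<in> gen r F \<tau>" "w' \<le> v"
    using y by (auto simp: GF_simps)
  have "\<sigma> = map (germ v) (simplex_at v x)" "\<tau> = map (germ v) (simplex_at v y)"
    using map_germ_realize G_births[OF v] x y by (simp_all add: simplex_at_def x'(1) y'(1))
  then have \<tau>: "\<tau> = \<sigma>" using eq by simp
  then have "w \<noteq> w'" using \<open>x \<noteq> y\<close> by (simp add: x'(1) y'(1))
  then have "(w, w') \<in> P \<sigma> \<or> (w', w) \<in> P \<sigma>"
    using P x'(2,3) y'(2) unfolding pair_choice_def \<tau> by blast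
  then show ?thesis
  proof
    assume "(w, w') \<in> P \<sigma>"
    then have "(\<sigma>, (w, w'), ()) \<in> K P n v" using x' y' by (simp add: KF_simps)
    then show ?thesis by (rule bexI[rotated]) (simp add: pi0_def pi1_def x'(1) y'(1) \<tau>)
  next
    assume "(w', w) \<in> P \<sigma>"
    then have "(\<sigma>, (w', w), ()) \<in> K P n v" using x' y' by (simp add: KF_simps)
    then show ?thesis by (rule bexI[rotated]) (simp add: pi0_def pi1_def x'(1) y'(1) \<tau>)
  qed
qed

definition "presentation_at P n v a b =
  (span_map R (K P n v) (G n v) pi0 a \<ominus>\<^bsub>span_module R (G n v)\<^esub> span_map R (K P n v) (G n v) pi1 a)
  \<oplus>\<^bsub>span_module R (G n v)\<^esub> alternating_sum (span_module R (G n v)) (Suc n)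
      (\<lambda>i. span_map R (G (Suc n) v) (G n v) (dbar r F i) b)"

lemma dbar_sum_hom:
  assumes v: "v \<in> grades r"
  shows "abelian_group_hom (span_module R (G (Suc n) v)) (span_module R (G n v))
    (\<lambda>b. alternating_sum (span_module R (G n v)) (Suc n)
      (\<lambda>i. span_map R (G (Suc n) v) (G n v) (dbar r F i) b))"
  using dbar_mem[OF v]
  by (intro linear_map_hom[where R = R] linear_map_alternating_sum module_span_module linear_map_span_map)

text \<open>The two copies related by a pair become the same simplex, so only the second summand is seen by
  \<^const>\<open>simplex_at\<close>.\<close>

lemma to_chain_presentation_at:
  assumes P: "pair_choice r F ord n P" and v: "v \<in> grades r"
    and a: "a \<in> carrier (span_module R (K P n v))" and b: "b \<in> carrier (span_module R (G (Suc n) v))"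
  shows "to_chain n v (presentation_at P n v a b) = bd (Suc n) v (to_chain (Suc n) v b)"
proof -
  interpret p: abelian_group_hom "span_module R (G n v)" "span_module R (S n v)" "to_chain n v"
    using simplex_at_mem[OF v] by (rule span_map_hom)
  let ?p0 = "span_map R (K P n v) (G n v) pi0 a" and ?p1 = "span_map R (K P n v) (G n v) pi1 a"
  let ?d = "alternating_sum (span_module R (G n v)) (Suc n)
      (\<lambda>i. span_map R (G (Suc n) v) (G n v) (dbar r F i) b)"
  have c: "?p0 \<in> carrier (span_module R (G n v))" "?p1 \<in> carrier (span_module R (G n v))"
    using span_map_closed[OF pi_mem(1)[OF P] a] span_map_closed[OF pi_mem(2)[OF P] a] .
  have d: "?d \<in> carrier (span_module R (G n v))"
    using abelian_group_hom.hom_closed[OF dbar_sum_hom[OF v] b] .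
  have "to_chain n v ?p0 = span_map R (K P n v) (S n v) (\<lambda>e. simplex_at v (pi0 e)) a"
    using pi_mem(1)[OF P] simplex_at_mem[OF v] refl a by (rule span_map_compose)
  also have "(\<lambda>e. simplex_at v (pi0 e)) = (\<lambda>e. simplex_at v (pi1 e))"
    by (simp add: fun_eq_iff simplex_at_def pi0_def pi1_def split: prod.splits)
  also have "span_map R (K P n v) (S n v) (\<lambda>e. simplex_at v (pi1 e)) a = to_chain n v ?p1"
    using pi_mem(2)[OF P] simplex_at_mem[OF v] refl a by (rule span_map_compose[symmetric])
  finally have "to_chain n v (?p0 \<ominus>\<^bsub>span_module R (G n v)\<^esub> ?p1) = \<zero>\<^bsub>span_module R (S n v)\<^esub>"
    using c p.hom_closed[OF c(2)] by (simp add: p.G.minus_eq p.H.r_neg del: span_module_simps)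
  then show ?thesis
    unfolding presentation_at_def to_chain_dbar[OF v b, symmetric]
    using p.G.minus_closed[OF c] d p.hom_closed[OF d] by (simp del: span_module_simps)
qed

lemma presentation_at_zero:
  assumes P: "pair_choice r F ord n P" and v: "v \<in> grades r"
  shows "presentation_at P n v \<zero>\<^bsub>span_module R (K P n v)\<^esub> \<zero>\<^bsub>span_module R (G (Suc n) v)\<^esub> =
    \<zero>\<^bsub>span_module R (G n v)\<^esub>"
proof -
  interpret G: abelian_group "span_module R (G n v)" by (rule abelian_group_span_module)
  show ?thesis
    unfolding presentation_at_def abelian_group_hom.hom_zero[OF dbar_sum_hom[OF v]]
      abelian_group_hom.hom_zero[OF span_map_hom[OF pi_mem(1)[OF P]]]
      abelian_group_hom.hom_zero[OF span_map_hom[OF pi_mem(2)[OF P]]]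
    by (simp add: G.minus_zero_right del: span_module_simps)
qed

text \<open>Let the chain underlying \<open>x\<close> be the boundary of \<open>c\<close>. Lift \<open>c\<close> to \<open>b\<close>; subtracting the lifted boundary of
  \<open>b\<close> from \<open>x\<close> leaves an element without underlying chain, which comes from the pairs.\<close>

lemma presentation_at_surj:
  assumes P: "pair_choice r F ord n P" and v: "v \<in> grades r"
    and x: "x \<in> carrier (span_module R (G n v))" "to_chain n v x \<in> boundaries n v"
  shows "\<exists>a\<in>carrier (span_module R (K P n v)). \<exists>b\<in>carrier (span_module R (G (Suc n) v)).
    presentation_at P n v a b = x"
proof -
  interpret p: abelian_group_hom "span_module R (G n v)" "span_module R (S n v)" "to_chain n v"
    using simplex_at_mem[OF v] by (rule span_map_hom)
  let ?d = "\<lambda>b. alternating_sum (span_module R (G n v)) (Suc n)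
      (\<lambda>i. span_map R (G (Suc n) v) (G n v) (dbar r F i) b)"
  obtain c where c: "c \<in> carrier (span_module R (S (Suc n) v))" "to_chain n v x = bd (Suc n) v c"
    using x(2) by blast
  have "c \<in> to_chain (Suc n) v ` carrier (span_module R (G (Suc n) v))"
    unfolding span_map_surj[OF simplex_at_mem[OF v] simplex_at_surj[OF v]] by (rule c(1))
  then obtain b where b: "b \<in> carrier (span_module R (G (Suc n) v))"
    "to_chain n v x = bd (Suc n) v (to_chain (Suc n) v b)"
    using c(2) by blast
  have d: "?d b \<in> carrier (span_module R (G n v))"
    using abelian_group_hom.hom_closed[OF dbar_sum_hom[OF v] b(1)] .
  have "to_chain n v (x \<ominus>\<^bsub>span_module R (G n v)\<^esub> ?d b) = \<zero>\<^bsub>span_module R (S n v)\<^esub>"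
    using x(1) d p.hom_closed[OF x(1)] to_chain_dbar[OF v b(1)] b(2)[symmetric]
    by (simp add: p.G.minus_eq p.H.r_neg del: span_module_simps)
  then obtain a where a: "a \<in> carrier (span_module R (K P n v))"
    "x \<ominus>\<^bsub>span_module R (G n v)\<^esub> ?d b =
      span_map R (K P n v) (G n v) pi0 a \<ominus>\<^bsub>span_module R (G n v)\<^esub> span_map R (K P n v) (G n v) pi1 a"
    using span_map_kernel_edges[OF simplex_at_mem[OF v] simplex_at_surj[OF v] pi_mem[OF P] ex_pair[OF P v]
        p.G.minus_closed[OF x(1) d]] by blast
  have "presentation_at P n v a b = x"
    unfolding presentation_at_def a(2)[symmetric]
    using x(1) d by (simp add: p.G.minus_eq p.G.a_assoc p.G.l_neg del: span_module_simps)
  then show ?thesis using a(1) b(1) by blast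
qed

lemma presentation_map_apply:
  assumes P: "pair_choice r F ord n P"
    and a: "a \<in> carrier (span_graded R r (KF r F ord P n))"
    and b: "b \<in> carrier (span_graded R r (GF r F ord (Suc n)))"
  shows "presentation_map R r F ord P n (a, b) \<in> carrier (span_graded R r (GF r F ord n))"
    and "v \<in> grades r \<Longrightarrow> presentation_map R r F ord P n (a, b) v = presentation_at P n v (a v) (b v)"
proof -
  let ?M = "span_graded R r (GF r F ord n)"
  let ?p0 = "induced_hom R r (KF r F ord P n) (GF r F ord n) pi0 a"
  let ?p1 = "induced_hom R r (KF r F ord P n) (GF r F ord n) pi1 a"
  let ?d = "alternating_sum ?M (Suc n) (\<lambda>i. induced_hom R r (GF r F ord (Suc n)) (GF r F ord n) (dbar r F i) b)"
  interpret M: abelian_group ?M by (rule abelian_group_span_graded)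
  have eq: "presentation_map R r F ord P n (a, b) = (?p0 \<ominus>\<^bsub>?M\<^esub> ?p1) \<oplus>\<^bsub>?M\<^esub> ?d"
    by (simp add: presentation_map_def Let_def)
  have p0: "?p0 \<in> carrier ?M" using pi_mem(1)[OF P] a by (rule induced_hom_closed)
  have p1: "?p1 \<in> carrier ?M" using pi_mem(2)[OF P] a by (rule induced_hom_closed)
  have d: "?d \<in> carrier ?M" using dbar_mem b by (rule induced_hom_alternating_sum(1))
  show "presentation_map R r F ord P n (a, b) \<in> carrier ?M"
    unfolding eq using p0 p1 d by (intro M.add.m_closed M.minus_closed)
  assume v: "v \<in> grades r"
  interpret e: abelian_group_hom ?M "span_module R (G n v)" "\<lambda>x. x v"
    using v by (rule span_graded_eval_hom)
  have dv: "?d v = alternating_sum (span_module R (G n v)) (Suc n)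
      (\<lambda>i. span_map R (G (Suc n) v) (G n v) (dbar r F i) (b v))"
    using dbar_mem b v by (rule induced_hom_alternating_sum(2))
  have "(?p0 \<ominus>\<^bsub>?M\<^esub> ?p1) v = ?p0 v \<ominus>\<^bsub>span_module R (G n v)\<^esub> ?p1 v"
    using e.hom_add[OF p0 M.a_inv_closed[OF p1]] unfolding e.hom_a_inv[OF p1] a_minus_def .
  then have "((?p0 \<ominus>\<^bsub>?M\<^esub> ?p1) \<oplus>\<^bsub>?M\<^esub> ?d) v =
      (?p0 v \<ominus>\<^bsub>span_module R (G n v)\<^esub> ?p1 v) \<oplus>\<^bsub>span_module R (G n v)\<^esub> ?d v"
    using e.hom_add[OF M.minus_closed[OF p0 p1] d] by (simp only:)
  then show "presentation_map R r F ord P n (a, b) v = presentation_at P n v (a v) (b v)"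
    unfolding eq dv induced_hom_apply[OF v] presentation_at_def .
qed

text \<open>Preimages are chosen grade by grade. They are taken to be \<open>0\<close> wherever \<open>x\<close> vanishes, so that
  together they form finitely supported families.\<close>

lemma presentation_map_image:
  assumes P: "pair_choice r F ord n P"
  shows "presentation_map R r F ord P n `
      (carrier (span_graded R r (KF r F ord P n)) \<times> carrier (span_graded R r (GF r F ord (Suc n)))) =
    {x \<in> carrier (span_graded R r (GF r F ord n)). \<forall>v\<in>grades r. to_chain n v (x v) \<in> boundaries n v}"
proof (intro equalityI subsetI)
  fix x assume "x \<in> presentation_map R r F ord P n `
      (carrier (span_graded R r (KF r F ord P n)) \<times> carrier (span_graded R r (GF r F ord (Suc n))))"
  then obtain a b where a: "a \<in> carrier (span_graded R r (KF r F ord P n))"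
    and b: "b \<in> carrier (span_graded R r (GF r F ord (Suc n)))"
    and x: "x = presentation_map R r F ord P n (a, b)" by blast
  have "to_chain n v (x v) \<in> boundaries n v" if v: "v \<in> grades r" for v
    unfolding x presentation_map_apply(2)[OF P a b v]
      to_chain_presentation_at[OF P v span_graded_carrierD(1)[OF a v] span_graded_carrierD(1)[OF b v]]
    using span_map_closed[OF simplex_at_mem[OF v] span_graded_carrierD(1)[OF b v]] by (rule imageI)
  then show "x \<in> {x \<in> carrier (span_graded R r (GF r F ord n)). \<forall>v\<in>grades r. to_chain n v (x v) \<in> boundaries n v}"
    using presentation_map_apply(1)[OF P a b] x by blast
next
  fix x assume "x \<in> {x \<in> carrier (span_graded R r (GF r F ord n)). \<forall>v\<in>grades r. to_chain n v (x v) \<in> boundaries n v}"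
  then have x: "x \<in> carrier (span_graded R r (GF r F ord n))"
    "\<And>v. v \<in> grades r \<Longrightarrow> to_chain n v (x v) \<in> boundaries n v" by blast+
  let ?Z = "\<lambda>v. x v = \<zero>\<^bsub>span_module R (G n v)\<^esub>"
  define Q where "Q v a b \<longleftrightarrow>
      a \<in> carrier (span_module R (K P n v)) \<and> b \<in> carrier (span_module R (G (Suc n) v)) \<and>
      presentation_at P n v a b = x v \<and>
      (?Z v \<longrightarrow> a = \<zero>\<^bsub>span_module R (K P n v)\<^esub> \<and> b = \<zero>\<^bsub>span_module R (G (Suc n) v)\<^esub>)"
    for v a b
  have "\<exists>a b. Q v a b" if v: "v \<in> grades r" for v
  proof (cases "?Z v")
    case True
    then have "Q v \<zero>\<^bsub>span_module R (K P n v)\<^esub> \<zero>\<^bsub>span_module R (G (Suc n) v)\<^esub>"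
      unfolding Q_def using presentation_at_zero[OF P v] abelian_groupE(2)[OF abelian_group_span_module] by simp
    then show ?thesis by blast
  next
    case False
    then show ?thesis unfolding Q_def
      using presentation_at_surj[OF P v span_graded_carrierD(1)[OF x(1) v] x(2)[OF v]] by blast
  qed
  then obtain a b where Q: "\<And>v. v \<in> grades r \<Longrightarrow> Q v (a v) (b v)" by metis
  have ab: "a v \<in> carrier (span_module R (K P n v))" "b v \<in> carrier (span_module R (G (Suc n) v))"
    "presentation_at P n v (a v) (b v) = x v" "?Z v \<Longrightarrow> a v = \<zero>\<^bsub>span_module R (K P n v)\<^esub>"
    "?Z v \<Longrightarrow> b v = \<zero>\<^bsub>span_module R (G (Suc n) v)\<^esub>" if "v \<in> grades r" for v
    using Q[OF that] unfolding Q_def by blast+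
  let ?a = "restrict a (grades r)" and ?b = "restrict b (grades r)"
  have a: "?a \<in> carrier (span_graded R r (KF r F ord P n))"
  proof (rule span_graded_carrierI[OF _ _ span_graded_carrierD(2)[OF x(1)]])
    fix v assume v: "v \<in> grades r"
    then show "?a v \<in> carrier (span_module R (K P n v))" using ab(1) by (simp del: span_module_simps)
    assume "v \<notin> {v \<in> grades r. x v \<noteq> \<zero>\<^bsub>span_module R (G n v)\<^esub>}"
    then show "?a v = \<zero>\<^bsub>span_module R (K P n v)\<^esub>" using ab(4) v by (simp del: span_module_simps)
  qed simp
  have b: "?b \<in> carrier (span_graded R r (GF r F ord (Suc n)))"
  proof (rule span_graded_carrierI[OF _ _ span_graded_carrierD(2)[OF x(1)]])
    fix v assume v: "v \<in> grades r"
    then show "?b v \<in> carrier (span_module R (G (Suc n) v))" using ab(2) by (simp del: span_module_simps)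
    assume "v \<notin> {v \<in> grades r. x v \<noteq> \<zero>\<^bsub>span_module R (G n v)\<^esub>}"
    then show "?b v = \<zero>\<^bsub>span_module R (G (Suc n) v)\<^esub>" using ab(5) v by (simp del: span_module_simps)
  qed simp
  have "presentation_map R r F ord P n (?a, ?b) = x"
  proof (rule associated_module_eqI[OF presentation_map_apply(1)[OF P a b] x(1)])
    fix v assume v: "v \<in> grades r"
    then show "presentation_map R r F ord P n (?a, ?b) v = x v"
      unfolding presentation_map_apply(2)[OF P a b v] using ab(3) by simp
  qed
  then show "x \<in> presentation_map R r F ord P n `
      (carrier (span_graded R r (KF r F ord P n)) \<times> carrier (span_graded R r (GF r F ord (Suc n))))"
    using a b by (intro image_eqI[of _ _ "(?a, ?b)"] SigmaI) simp_all
qed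

sublocale levels: levelwise_surjection R r "span_functor R (GF r F ord n)"
  "span_functor R (simplex_functor r F ord n)" "to_chain n" "cycles n" "boundaries n" for n
  by (rule levelwise_surjection)

lemma kernel_alpha_map:
  "a_kernel (span_graded R r (GF r F ord n)) (span_graded R r (pred_functor (DF r F ord) n))
    (alpha_map R r F ord n) = levels.ZA n"
  unfolding levels.ZA_def
  by (subst a_kernel_def', rule Collect_cong, use alpha_map_eq in blast)

lemma image_presentation_map:
  assumes "pair_choice r F ord n P"
  shows "presentation_map R r F ord P n ` carrier (graded_direct_sum (span_graded R r (KF r F ord P n))
      (span_graded R r (GF r F ord (Suc n)))) = levels.BA n"
  using presentation_map_image[OF assms] unfolding levels.BA_def by (simp add: graded_direct_sum_def del: associated_module_simps)

lemma quotient_functor_eq: "levels.quotient_functor n = homology_functor R r F ord n"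
  by (simp add: levels.quotient_functor_def homology_functor_def homology_module_def Let_def del: span_module_simps)

end

theorem proposition5p2:
  fixes R :: "('b, 'c) ring_scheme" and r n :: nat
    and F :: "'a space_functor" and ord :: "'a germ rel"
    and P :: "'a germ list \<Rightarrow> (grade \<times> grade) set"
  defines "KG \<equiv> graded_direct_sum (span_graded R r (KF r F ord P n))
                                  (span_graded R r (GF r F ord (Suc n)))"
    and "G \<equiv> span_graded R r (GF r F ord n)"
    and "D \<equiv> span_graded R r (pred_functor (DF r F ord) n)"
    and "f \<equiv> presentation_map R r F ord P n"
    and "g \<equiv> alpha_map R r F ord n"
  assumes "cring R"
    and "compact_multifiltration r F"
    and "linear_order_on (vertices (colimit r F)) ord"
    and "pair_choice r F ord n P"
  shows "(\<forall>x\<in>carrier KG. g (f x) = \<zero>\<^bsub>D\<^esub>) \<and>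
    graded_isomorphic (mpoly_ring R r) r
      (graded_homology KG f G g D)
      (associated_module R r (homology_functor R r F ord n))"
proof
  interpret multifiltered_chains r F ord R
    using assms(6,7) by (simp add: multifiltered_chains_def multifiltered_complex_def compact_multifiltration_def)
  have kernel: "a_kernel G D g = levels.ZA n"
    unfolding G_def D_def g_def by (rule kernel_alpha_map)
  have image: "f ` carrier KG = levels.BA n"
    unfolding f_def KG_def using assms(9) by (rule image_presentation_map)
  show "\<forall>x\<in>carrier KG. g (f x) = \<zero>\<^bsub>D\<^esub>"
  proof
    fix x assume "x \<in> carrier KG"
    then have "f x \<in> a_kernel G D g"
      unfolding kernel using image levels.BA_le_ZA by blast
    then show "g (f x) = \<zero>\<^bsub>D\<^esub>" unfolding a_kernel_def' by blast
  qed
  have homology: "graded_homology KG f G g D =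
      module.extend (quotient_module (G\<lparr>carrier := levels.ZA n\<rparr>) (levels.BA n))
        \<lparr>component = (\<lambda>v. (\<lambda>z. levels.BA n +>\<^bsub>G\<^esub> z) ` (levels.ZA n \<inter> component G v))\<rparr>"
    unfolding graded_homology_def homology_module_def kernel image ..
  show "graded_isomorphic (mpoly_ring R r) r (graded_homology KG f G g D)
      (associated_module R r (homology_functor R r F ord n))"
    unfolding homology unfolding graded_isomorphic_def G_def quotient_functor_eq[symmetric]
    by (rule exI, rule levels.graded_isomorphism_quotient_map)
qed

end
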